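(* Let $\Gamma$ be the group associated with a triangle presentation and $\Delta$ the associated triangle building with boundary $\Omega$. The action of $\Gamma$ on $\Omega$ is measure-theoretically free, i.e. \[ \nu_v\left(\{ \omega\in\Omega : g\omega= \omega\}\right) = 0 \] for all vertices $v\in\Delta$ and elements $g\in\Gamma\setminus\{ e\}$.
   Context: **Triangle groups.** Let $(P,L)$ be a finite projective plane of order $q\ge 2$ and $\lambda:P\to L$ a bijection. A triangle presentation is a set $\mathcal{T}\subseteq P^3$ such that: (1) for all $x,y\in P$, $(x,y,z)\in\mathcal T$ for some $z\in P$ if and only if $y$ and $\lambda(x)$ are incident; (2) $(x,y,z)\in\mathcal T\Rightarrow (y,z,x)\in\mathcal T$; (3) for all $x,y\in P$, $(x,y,z)\in\mathcal T$ for at most one $z\in P$. Put $\Gamma=\langle a_x\ (x\in P) : a_xa_ya_z=e \text{ for all }(x,y,z)\in\mathcal T\rangle$, with identity $e$. The Cayley graph of $\Gamma$ (via right multiplication by the $a_x^{\pm1}$) is the one-skeleton of a thick affine building $\Delta=\Delta_{\mathcal T}$ of type $\tilde A_2$ (a triangle building): the vertices are the elements of $\Gamma$, and the chambers (triangles) are the sets $\{g,ga_x^{-1},ga_y\}$ with $(x,y,z)\in\mathcal T$ for some $z$. $\Gamma$ acts simply transitively on the vertices by left multiplication. Edges are oriented as $g\to ga_x$. **Boundary.** An apartment is a subcomplex isomorphic to the Coxeter complex of type $\tilde A_2$ (a Euclidean plane tessellated by equilateral triangles). A sector is one of the six simplicial cones based at a vertex of an apartment. Two sectors are equivalent if they contain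 a common subsector. $\Omega$ is the set of equivalence classes of sectors; for $\omega\in\Omega$ and a vertex $v$ there is a unique sector $\mathcal S_v(\omega)$ in the class $\omega$ based at $v$. For $u\in \mathcal S_v(\omega)$ let $I_v^u(\omega)$ be the convex hull of $u$ and the chamber of $\mathcal S_v(\omega)$ containing $v$. The sets $\{\omega' : I_v^u(\omega)\subseteq \mathcal S_v(\omega')\}$ form a base for a totally disconnected compact Hausdorff topology on $\Omega$. $\Gamma$ acts on $\Omega$ by left multiplication of sectors. **Measures.** For a sector based at $v$, one of its two bounding rays has all edges oriented away from $v$ and the other all edges oriented towards $v$; let $a_{m,n}$ ($m,n\ge0$) be the vertex reached from $v=a_{0,0}$ by $m$ unit steps parallel to the first and $n$ unit steps parallel to the second. $V_v^{m,n}$ is the set of vertices that equal $a_{m,n}$ in some sector based at $v$, and $\Omega_v^u=\{\omega : u\in\mathcal S_v(\omega)\}$. For each vertex $v$, $\nu_v$ is the Borel probability measure on $\Omega$ which, for every $m,n\ge0$, assigns equal measure to each of the disjoint sets $\Omega_v^u$, $u\in V_v^{m,n}$. The measures $\nu_v$ are mutually absolutely continuous. *)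

theory Defs
  imports "HOL-Probability.Probability" "HOL-Algebra.Group"
begin

definition projective_plane :: "'p set \<Rightarrow> 'l set \<Rightarrow> ('p \<Rightarrow> 'l \<Rightarrow> bool) \<Rightarrow> bool" where
  "projective_plane P L inc \<longleftrightarrow>
     (\<forall>x\<in>P. \<forall>y\<in>P. x \<noteq> y \<longrightarrow> (\<exists>!l. l \<in> L \<and> inc x l \<and> inc y l)) \<and>
     (\<forall>l\<in>L. \<forall>m\<in>L. l \<noteq> m \<longrightarrow> (\<exists>!x. x \<in> P \<and> inc x l \<and> inc x m)) \<and>
     (\<exists>Q \<subseteq> P. card Q = 4 \<and> (\<forall>l\<in>L. card {x \<in> Q. inc x l} \<le> 2))"

definition finite_projective_plane ::
    "'p set \<Rightarrow> 'l set \<Rightarrow> ('p \<Rightarrow> 'l \<Rightarrow> bool) \<Rightarrow> nat \<Rightarrow> bool" where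
  "finite_projective_plane P L inc q \<longleftrightarrow>
     finite P \<and> finite L \<and> projective_plane P L inc \<and>
     (\<forall>l\<in>L. card {x \<in> P. inc x l} = q + 1)"

definition triangle_presentation ::
    "'p set \<Rightarrow> ('p \<Rightarrow> 'l \<Rightarrow> bool) \<Rightarrow> ('p \<Rightarrow> 'l) \<Rightarrow> ('p \<times> 'p \<times> 'p) set \<Rightarrow> bool" where
  "triangle_presentation P inc lam T \<longleftrightarrow>
     T \<subseteq> P \<times> P \<times> P \<and>
     (\<forall>x\<in>P. \<forall>y\<in>P. (\<exists>z\<in>P. (x, y, z) \<in> T) \<longleftrightarrow> inc y (lam x)) \<and>
     (\<forall>x y z. (x, y, z) \<in> T \<longrightarrow> (y, z, x) \<in> T) \<and>
     (\<forall>x\<in>P. \<forall>y\<in>P. \<forall>z z'. (x, y, z) \<in> T \<and> (x, y, z') \<in> T \<longrightarrow> z = z')"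

text \<open>
  A word is a list of signed letters: \<open>(x, True)\<close> stands for the generator \<open>x\<close> and
  \<open>(x, False)\<close> for its formal inverse. The group with generators \<open>X\<close> and relators \<open>R\<close>
  is the quotient of the monoid of words by the least congruence that identifies every
  \<open>x x\<inverse>\<close>, every \<open>x\<inverse> x\<close> and every relator with the empty word.
\<close>

type_synonym 'x word = "('x \<times> bool) list"

definition words :: "'x set \<Rightarrow> 'x word set" where
  "words X = lists (X \<times> UNIV)"

inductive_set pres_cong :: "'x set \<Rightarrow> 'x word set \<Rightarrow> ('x word \<times> 'x word) set"
  for X :: "'x set" and R :: "'x word set" where
  refl: "u \<in> words X \<Longrightarrow> (u, u) \<in> pres_cong X R"
| sym: "(u, w) \<in> pres_cong X R \<Longrightarrow> (w, u) \<in> pres_cong X R"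
| trans: "(u, w) \<in> pres_cong X R \<Longrightarrow> (w, t) \<in> pres_cong X R \<Longrightarrow> (u, t) \<in> pres_cong X R"
| cancel: "u \<in> words X \<Longrightarrow> w \<in> words X \<Longrightarrow> x \<in> X \<Longrightarrow>
    (u @ [(x, b), (x, \<not> b)] @ w, u @ w) \<in> pres_cong X R"
| relator: "u \<in> words X \<Longrightarrow> w \<in> words X \<Longrightarrow> r \<in> R \<Longrightarrow> r \<in> words X \<Longrightarrow>
    (u @ r @ w, u @ w) \<in> pres_cong X R"

definition presented_group :: "'x set \<Rightarrow> 'x word set \<Rightarrow> 'x word set monoid" where
  "presented_group X R =
     \<lparr>carrier = words X // pres_cong X R,
      mult = (\<lambda>A B. \<Union>u\<in>A. \<Union>w\<in>B. pres_cong X R `` {u @ w}),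
      one = pres_cong X R `` {[]}\<rparr>"

lemma words_simps [simp]:
  "[] \<in> words X"
  "u @ w \<in> words X \<longleftrightarrow> u \<in> words X \<and> w \<in> words X"
  "a # u \<in> words X \<longleftrightarrow> fst a \<in> X \<and> u \<in> words X"
  by (cases a; auto simp: words_def)+

lemma pres_cong_words:
  "(u, w) \<in> pres_cong X R \<Longrightarrow> u \<in> words X \<and> w \<in> words X"
  by (induction rule: pres_cong.induct) auto

lemma equiv_pres_cong: "equiv (words X) (pres_cong X R)"
proof (rule equivI)
  show "pres_cong X R \<subseteq> words X \<times> words X"
    using pres_cong_words by fast
  show "refl_on (words X) (pres_cong X R)"
    by (rule refl_onI) (rule pres_cong.refl)
  show "sym (pres_cong X R)"
    by (rule symI) (rule pres_cong.sym)
  show "trans (pres_cong X R)"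
    by (rule transI) (rule pres_cong.trans)
qed

lemma pres_cong_append_left:
  "(u, w) \<in> pres_cong X R \<Longrightarrow> t \<in> words X \<Longrightarrow> (t @ u, t @ w) \<in> pres_cong X R"
proof (induction rule: pres_cong.induct)
  case (refl u)
  then show ?case by (intro pres_cong.refl) simp
next
  case (sym u w)
  then show ?case by (blast intro: pres_cong.sym)
next
  case (trans u w s)
  then show ?case by (blast intro: pres_cong.trans)
next
  case (cancel u w x b)
  then show ?case using pres_cong.cancel[of "t @ u" X w x b R] by simp
next
  case (relator u w r)
  then show ?case using pres_cong.relator[of "t @ u" X w r R] by simp
qed

lemma pres_cong_append_right:
  "(u, w) \<in> pres_cong X R \<Longrightarrow> t \<in> words X \<Longrightarrow> (u @ t, w @ t) \<in> pres_cong X R"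
proof (induction rule: pres_cong.induct)
  case (refl u)
  then show ?case by (intro pres_cong.refl) simp
next
  case (sym u w)
  then show ?case by (blast intro: pres_cong.sym)
next
  case (trans u w s)
  then show ?case by (blast intro: pres_cong.trans)
next
  case (cancel u w x b)
  then show ?case using pres_cong.cancel[of u X "w @ t" x b R] by simp
next
  case (relator u w r)
  then show ?case using pres_cong.relator[of u X "w @ t" r R] by simp
qed

lemma presented_mult_class:
  assumes "u \<in> words X" "w \<in> words X"
  shows "mult (presented_group X R) (pres_cong X R `` {u}) (pres_cong X R `` {w}) =
    pres_cong X R `` {u @ w}"
proof -
  let ?c = "\<lambda>u. pres_cong X R `` {u}"
  have eq: "?c (u' @ w') = ?c (u @ w)" if "u' \<in> ?c u" "w' \<in> ?c w" for u' w'
  proof -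
    have u: "(u, u') \<in> pres_cong X R" and w: "(w, w') \<in> pres_cong X R"
      using that by simp_all
    have "(u @ w, u' @ w') \<in> pres_cong X R"
      using pres_cong.trans[OF pres_cong_append_right[OF u assms(2)]
          pres_cong_append_left[OF w]] pres_cong_words[OF u] by blast
    then show ?thesis
      using equiv_class_eq[OF equiv_pres_cong] by metis
  qed
  have "u \<in> ?c u" "w \<in> ?c w"
    using assms by (simp_all add: pres_cong.refl)
  then have "(\<Union>u'\<in>?c u. \<Union>w'\<in>?c w. ?c (u' @ w')) = ?c (u @ w)"
    using eq by blast
  then show ?thesis
    by (simp add: presented_group_def)
qed

definition inv_word :: "'x word \<Rightarrow> 'x word" where
  "inv_word u = rev (map (\<lambda>(x, b). (x, \<not> b)) u)"

lemma inv_word_words: "u \<in> words X \<Longrightarrow> inv_word u \<in> words X"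
  by (induction u) (auto simp: inv_word_def)

lemma inv_word_cancel:
  "u \<in> words X \<Longrightarrow> (inv_word u @ u, []) \<in> pres_cong X R"
proof (induction u)
  case Nil
  then show ?case by (simp add: inv_word_def pres_cong.refl)
next
  case (Cons a u)
  obtain x b where a: "a = (x, b)" by (cases a)
  have "(inv_word u @ [(x, \<not> b), (x, \<not> \<not> b)] @ u, inv_word u @ u) \<in> pres_cong X R"
    using Cons.prems a by (intro pres_cong.cancel inv_word_words) auto
  then have "(inv_word (a # u) @ a # u, inv_word u @ u) \<in> pres_cong X R"
    by (simp add: a inv_word_def)
  moreover have "(inv_word u @ u, []) \<in> pres_cong X R"
    using Cons by simp
  ultimately show ?case by (rule pres_cong.trans)
qed

theorem group_presented_group: "group (presented_group X R)"
proof (rule groupI)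
  let ?G = "presented_group X R"
  have carrier: "carrier ?G = words X // pres_cong X R"
    and one: "\<one>\<^bsub>?G\<^esub> = pres_cong X R `` {[]}"
    by (simp_all add: presented_group_def)
  show "\<one>\<^bsub>?G\<^esub> \<in> carrier ?G"
    by (simp add: carrier one quotientI)
  show "A \<otimes>\<^bsub>?G\<^esub> B \<in> carrier ?G" if "A \<in> carrier ?G" "B \<in> carrier ?G" for A B
    using that by (auto simp: carrier presented_mult_class quotientI elim!: quotientE)
  show "A \<otimes>\<^bsub>?G\<^esub> B \<otimes>\<^bsub>?G\<^esub> C = A \<otimes>\<^bsub>?G\<^esub> (B \<otimes>\<^bsub>?G\<^esub> C)"
    if "A \<in> carrier ?G" "B \<in> carrier ?G" "C \<in> carrier ?G" for A B C
    using that by (auto simp: carrier presented_mult_class elim!: quotientE)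
  show "\<one>\<^bsub>?G\<^esub> \<otimes>\<^bsub>?G\<^esub> A = A" if "A \<in> carrier ?G" for A
    using that by (auto simp: carrier one presented_mult_class elim!: quotientE)
  show "\<exists>B\<in>carrier ?G. B \<otimes>\<^bsub>?G\<^esub> A = \<one>\<^bsub>?G\<^esub>" if A: "A \<in> carrier ?G" for A
  proof -
    from A obtain u where u: "u \<in> words X" "A = pres_cong X R `` {u}"
      by (auto simp: carrier elim!: quotientE)
    then have "pres_cong X R `` {inv_word u} \<otimes>\<^bsub>?G\<^esub> A = \<one>\<^bsub>?G\<^esub>"
      using equiv_class_eq[OF equiv_pres_cong inv_word_cancel]
      by (metis inv_word_words one presented_mult_class)
    moreover have "pres_cong X R `` {inv_word u} \<in> carrier ?G"
      by (simp add: carrier u inv_word_words quotientI)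
    ultimately show ?thesis by blast
  qed
qed

definition triangle_group :: "'p set \<Rightarrow> ('p \<times> 'p \<times> 'p) set \<Rightarrow> 'p word set monoid" where
  "triangle_group P T =
     presented_group P {[(x, True), (y, True), (z, True)] | x y z. (x, y, z) \<in> T}"

definition generator :: "'p set \<Rightarrow> ('p \<times> 'p \<times> 'p) set \<Rightarrow> 'p \<Rightarrow> 'p word set" where
  "generator P T x =
     pres_cong P {[(x, True), (y, True), (z, True)] | x y z. (x, y, z) \<in> T} `` {[(x, True)]}"

definition chambers :: "'p set \<Rightarrow> ('p \<times> 'p \<times> 'p) set \<Rightarrow> 'p word set set set" where
  "chambers P T =
     {{g, g \<otimes>\<^bsub>triangle_group P T\<^esub> inv\<^bsub>triangle_group P T\<^esub> (generator P T x),
       g \<otimes>\<^bsub>triangle_group P T\<^esub> generator P T y} | g x y z.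
       g \<in> carrier (triangle_group P T) \<and> (x, y, z) \<in> T}"

definition oriented_edge ::
    "'p set \<Rightarrow> ('p \<times> 'p \<times> 'p) set \<Rightarrow> 'p word set \<Rightarrow> 'p word set \<Rightarrow> bool" where
  "oriented_edge P T g h \<longleftrightarrow>
     g \<in> carrier (triangle_group P T) \<and>
     (\<exists>x\<in>P. h = g \<otimes>\<^bsub>triangle_group P T\<^esub> generator P T x)"

text \<open>A simplicial complex is represented by the set of its nonempty simplices.\<close>

definition complex_of :: "'a set set \<Rightarrow> 'a set set" where
  "complex_of C = {s. s \<noteq> {} \<and> (\<exists>c\<in>C. s \<subseteq> c)}"

definition building :: "'p set \<Rightarrow> ('p \<times> 'p \<times> 'p) set \<Rightarrow> 'p word set set set" where
  "building P T = complex_of (chambers P T)"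

text \<open>
  The Coxeter complex of affine type \<open>A\<^sub>2\<close>: the tessellation of the plane by equilateral
  triangles, where \<open>(i, j)\<close> stands for the point \<open>i e\<^sub>1 + j e\<^sub>2\<close> and \<open>e\<^sub>1\<close>, \<open>e\<^sub>2\<close> are unit
  vectors at an angle of 60 degrees.
\<close>

definition coxeter_chambers :: "(int \<times> int) set set" where
  "coxeter_chambers =
     {{(i, j), (i + 1, j), (i, j + 1)} | i j. True} \<union>
     {{(i + 1, j), (i, j + 1), (i + 1, j + 1)} | i j. True}"

definition coxeter_complex :: "(int \<times> int) set set" where
  "coxeter_complex = complex_of coxeter_chambers"

text \<open>The half-planes bounded by the walls, which have the three directions
  \<open>e\<^sub>1\<close>, \<open>e\<^sub>2\<close> and \<open>e\<^sub>1 - e\<^sub>2\<close>.\<close>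

definition coxeter_half_planes :: "(int \<times> int) set set" where
  "coxeter_half_planes =
     (\<Union>c. {{(i, j). i \<ge> c}, {(i, j). i \<le> c},
           {(i, j). j \<ge> c}, {(i, j). j \<le> c},
           {(i, j). i + j \<ge> c}, {(i, j). i + j \<le> c}})"

text \<open>
  A chamber \<open>{p, a, b}\<close> of the plane spans the cone with apex \<open>p\<close> and the two bounding rays
  through \<open>a\<close> and \<open>b\<close>. The six chambers around \<open>p\<close> yield the six cones based at \<open>p\<close>. The
  vertices of the cone are the points \<open>p + m (a - p) + n (b - p)\<close>.
\<close>

definition cone_point ::
    "int \<times> int \<Rightarrow> int \<times> int \<Rightarrow> int \<times> int \<Rightarrow> nat \<Rightarrow> nat \<Rightarrow> int \<times> int" where
  "cone_point p a b m n =
     (fst p + int m * (fst a - fst p) + int n * (fst b - fst p),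
      snd p + int m * (snd a - snd p) + int n * (snd b - snd p))"

definition cone :: "int \<times> int \<Rightarrow> int \<times> int \<Rightarrow> int \<times> int \<Rightarrow> (int \<times> int) set" where
  "cone p a b = {cone_point p a b m n | m n. True}"

text \<open>
  An apartment is a subcomplex isomorphic to the Coxeter complex. It is handled through such an
  isomorphism \<open>\<phi>\<close>, given on vertices; the apartment is then the subcomplex
  \<open>(`) \<phi> ` coxeter_complex\<close>.
\<close>

definition apartment_chart :: "'a set set \<Rightarrow> (int \<times> int \<Rightarrow> 'a) \<Rightarrow> bool" where
  "apartment_chart D \<phi> \<longleftrightarrow> inj \<phi> \<and> (`) \<phi> ` coxeter_complex \<subseteq> D"

definition half_apartments :: "'a set set \<Rightarrow> 'a set set set" where
  "half_apartments D =
     {(`) \<phi> ` (coxeter_complex \<inter> Pow H) | \<phi> H.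
       apartment_chart D \<phi> \<and> H \<in> coxeter_half_planes}"

text \<open>
  The convex hull of a set \<open>X\<close> of simplices lying in an apartment is the intersection of the
  half-apartments of that apartment which contain \<open>X\<close>. In an affine building this does not
  depend on the apartment (for \<open>X\<close> containing a chamber), so the half-apartments of all
  apartments may be used.
\<close>

definition convex_hull_complex :: "'a set set \<Rightarrow> 'a set set \<Rightarrow> 'a set set" where
  "convex_hull_complex D X = \<Inter>{H \<in> half_apartments D. X \<subseteq> H}"

definition sectors_at :: "'a set set \<Rightarrow> 'a \<Rightarrow> 'a set set set" where
  "sectors_at D v =
     {(`) \<phi> ` (coxeter_complex \<inter> Pow (cone p a b)) | \<phi> p a b.
       apartment_chart D \<phi> \<and> {p, a, b} \<in> coxeter_chambers \<and> \<phi> p = v}"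

definition sectors :: "'a set set \<Rightarrow> 'a set set set" where
  "sectors D = (\<Union>v. sectors_at D v)"

definition sector_equiv :: "'a set set \<Rightarrow> ('a set set \<times> 'a set set) set" where
  "sector_equiv D =
     {(S, S'). S \<in> sectors D \<and> S' \<in> sectors D \<and>
       (\<exists>S''\<in>sectors D. S'' \<subseteq> S \<and> S'' \<subseteq> S')}"

definition boundary :: "'a set set \<Rightarrow> 'a set set set set" where
  "boundary D = sectors D // sector_equiv D"

definition sector_from :: "'a set set \<Rightarrow> 'a \<Rightarrow> 'a set set set \<Rightarrow> 'a set set" where
  "sector_from D v \<omega> = (THE S. S \<in> \<omega> \<and> S \<in> sectors_at D v)"

text \<open>The chamber of a sector \<open>S\<close> that contains the base vertex \<open>v\<close>. The chambers of a
  complex of triangles are the simplices with three vertices.\<close>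

definition base_chamber :: "'a set set \<Rightarrow> 'a \<Rightarrow> 'a set" where
  "base_chamber S v = (THE c. c \<in> S \<and> card c = 3 \<and> v \<in> c)"

definition hull_toward :: "'a set set \<Rightarrow> 'a \<Rightarrow> 'a \<Rightarrow> 'a set set set \<Rightarrow> 'a set set" where
  "hull_toward D v u \<omega> =
     convex_hull_complex D {{u}, base_chamber (sector_from D v \<omega>) v}"

definition boundary_topology :: "'a set set \<Rightarrow> 'a set set set topology" where
  "boundary_topology D =
     topology_generated_by
       {{\<omega>' \<in> boundary D. hull_toward D v u \<omega> \<subseteq> sector_from D v \<omega>'} | v u \<omega>.
          {v} \<in> D \<and> \<omega> \<in> boundary D \<and> {u} \<in> sector_from D v \<omega>}"

definition boundary_action ::
    "('a, 'm) monoid_scheme \<Rightarrow> 'a \<Rightarrow> 'a set set set \<Rightarrow> 'a set set set" where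
  "boundary_action G g \<omega> = (`) ((`) ((`) (\<lambda>h. g \<otimes>\<^bsub>G\<^esub> h))) \<omega>"

text \<open>
  The set of all vertices \<open>a\<^sub>m\<^sub>,\<^sub>n\<close> of sectors based at \<open>v\<close>. The bounding ray through \<open>\<phi> a\<close> has
  its edges oriented away from \<open>v\<close>, the one through \<open>\<phi> b\<close> towards \<open>v\<close>.
\<close>

definition vertices_at ::
    "'p set \<Rightarrow> ('p \<times> 'p \<times> 'p) set \<Rightarrow> 'p word set \<Rightarrow> nat \<Rightarrow> nat \<Rightarrow> 'p word set set" where
  "vertices_at P T v m n =
     {\<phi> (cone_point p a b m n) | \<phi> p a b.
       apartment_chart (building P T) \<phi> \<and> {p, a, b} \<in> coxeter_chambers \<and> \<phi> p = v \<and>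
       (\<forall>k. oriented_edge P T (\<phi> (cone_point p a b k 0)) (\<phi> (cone_point p a b (Suc k) 0))) \<and>
       (\<forall>k. oriented_edge P T (\<phi> (cone_point p a b 0 (Suc k))) (\<phi> (cone_point p a b 0 k)))}"

definition boundary_through :: "'a set set \<Rightarrow> 'a \<Rightarrow> 'a \<Rightarrow> 'a set set set set" where
  "boundary_through D v u = {\<omega> \<in> boundary D. {u} \<in> sector_from D v \<omega>}"

text \<open>\<open>M\<close> is the measure \<open>\<nu>\<^sub>v\<close>; the sigma-algebra consists of the Borel sets of the boundary.\<close>

definition is_boundary_measure ::
    "'p set \<Rightarrow> ('p \<times> 'p \<times> 'p) set \<Rightarrow> 'p word set \<Rightarrow> 'p word set set set set measure \<Rightarrow> bool" where
  "is_boundary_measure P T v M \<longleftrightarrow>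
     prob_space M \<and>
     space M = boundary (building P T) \<and>
     sets M = sigma_sets (boundary (building P T))
       {U. openin (boundary_topology (building P T)) U} \<and>
     (\<forall>m n. \<forall>u \<in> vertices_at P T v m n. \<forall>u' \<in> vertices_at P T v m n.
        emeasure M (boundary_through (building P T) v u) =
        emeasure M (boundary_through (building P T) v u'))"

end

theory Submission
  imports Defs
begin

text \<open>
  A sector based at a vertex is recorded by the labels of its edges, a tiling of the quadrant by
  triangles of \<open>T\<close> in which adjacent triangles are distinct. Moving the base point along an edge
  of the Cayley graph drops or adds a row or a column of the tiling, so the generators act on
  tilings with a displacement in the lattice, and the relations of the group act trivially.
  Convexity of the displacement shows that a vertex determines its coordinates \<open>(m, n)\<close> and the
  whole parallelogram spanned from the base point; hence every tiling is a sector of an apartment,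
  and each boundary point has exactly one tiling at each base point.

  If \<open>g\<close> fixes \<open>\<omega>\<close>, then far out \<open>g\<close> translates the tiling of \<open>\<omega>\<close> by a fixed vector \<open>(k, l)\<close>, which is
  nonzero because the group acts freely on vertices. The labels are then eventually periodic. When
  the parallelogram up to column \<open>m\<close> is known, the equidistribution of \<open>\<nu>\<^sub>v\<close> gives every
  prescribed label in the next column conditional probability at most one half, so periodicity in
  a direction with \<open>k \<noteq> 0\<close> has probability zero. The case \<open>k = 0\<close> follows by duality,
  which exchanges rows with columns.
\<close>

text \<open>Only the presentation of the group is given, so the existence and uniqueness of sectors
  in a class, and even the distinctness of vertices, have to be extracted from the triples. The
  action on tilings replaces a normal form: a word with a nonzero displacement on some tiling cannot
  represent the identity.

  The one half arises as follows. Equidistribution speaks of whole parallelograms only, and a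
  parallelogram is prolonged by a column as soon as its top row is prolonged by one label; a plane
  of order q offers q^2 such labels, all equally likely. A label prescribed in a lower row
  propagates upwards along the known column and confines the top label to one line, hence to q
  values. The quotient 1 / q is at most one half because q is at least 2.

  The place from which \<open>g\<close> acts as a translation depends on the boundary point. The set
  of fixed points is therefore split into countably many events, one for each pair of
  positions.\<close>

definition adj :: "('p \<times> 'p \<times> 'p) set \<Rightarrow> 'p \<Rightarrow> 'p \<Rightarrow> bool" where
  "adj T x y \<longleftrightarrow> (\<exists>z. (x, y, z) \<in> T)"

definition flip :: "('p \<times> 'p \<times> 'p) set \<Rightarrow> ('p \<times> 'p \<times> 'p) set" where
  "flip T = {(x, y, z). (z, y, x) \<in> T}"

lemma flip_iff [simp]: "(x, y, z) \<in> flip T \<longleftrightarrow> (z, y, x) \<in> T"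
  by (simp add: flip_def)

lemma flip_flip [simp]: "flip (flip T) = T"
  by (auto simp: flip_def)

text \<open>
  \<open>al m n\<close>, \<open>ga m n\<close> and \<open>be m n\<close> label the edges from \<open>(m, n)\<close> to \<open>(m + 1, n)\<close>, from there to
  \<open>(m, n + 1)\<close>, and from there back to \<open>(m, n)\<close>.
\<close>

datatype 'p tiling =
  Tiling (al: "nat \<Rightarrow> nat \<Rightarrow> 'p") (be: "nat \<Rightarrow> nat \<Rightarrow> 'p") (ga: "nat \<Rightarrow> nat \<Rightarrow> 'p")

lemma tiling_eqI:
  assumes "\<And>m n. al s m n = al t m n" "\<And>m n. be s m n = be t m n" "\<And>m n. ga s m n = ga t m n"
  shows "s = t"
  using assms by (intro tiling.expand) (auto intro!: ext)

definition shift :: "nat \<Rightarrow> nat \<Rightarrow> 'p tiling \<Rightarrow> 'p tiling" where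
  "shift i j s = Tiling (\<lambda>m n. al s (i + m) (j + n)) (\<lambda>m n. be s (i + m) (j + n))
     (\<lambda>m n. ga s (i + m) (j + n))"

lemma shift_sel [simp]:
  "al (shift i j s) m n = al s (i + m) (j + n)"
  "be (shift i j s) m n = be s (i + m) (j + n)"
  "ga (shift i j s) m n = ga s (i + m) (j + n)"
  by (simp_all add: shift_def)

lemma shift_0 [simp]: "shift 0 0 s = s"
  by (rule tiling_eqI) simp_all

lemma shift_shift [simp]: "shift i j (shift k l s) = shift (k + i) (l + j) s"
  by (rule tiling_eqI) (simp_all add: add_ac)

text \<open>Reflection in the diagonal of the quadrant. It exchanges the two bounding rays, reverses
  all edges, and so turns triples of \<open>T\<close> into triples of \<open>flip T\<close>.\<close>

definition transp :: "'p tiling \<Rightarrow> 'p tiling" where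
  "transp s = Tiling (\<lambda>m n. be s n m) (\<lambda>m n. al s n m) (\<lambda>m n. ga s n m)"

lemma transp_sel [simp]:
  "al (transp s) m n = be s n m" "be (transp s) m n = al s n m" "ga (transp s) m n = ga s n m"
  by (simp_all add: transp_def)

lemma transp_transp [simp]: "transp (transp s) = s"
  by (rule tiling_eqI) simp_all

lemma transp_shift: "transp (shift i j s) = shift j i (transp s)"
  by (rule tiling_eqI) simp_all

lemma transp_eq_iff [simp]: "transp s = transp t \<longleftrightarrow> s = t"
  by (metis transp_transp)

text \<open>
  The columns \<open>b'\<close> and \<open>b\<close> bound the strip, \<open>y\<close> labels its horizontal and \<open>c\<close> its diagonal edges.
  The inequalities say that the two triangles at an inner edge are distinct.
\<close>

definition strip ::
    "('p \<times> 'p \<times> 'p) set \<Rightarrow> (nat \<Rightarrow> 'p) \<Rightarrow> (nat \<Rightarrow> 'p) \<Rightarrow> (nat \<Rightarrow> 'p) \<Rightarrow> (nat \<Rightarrow> 'p) \<Rightarrow> bool" where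
  "strip T b' y c b \<longleftrightarrow> (\<forall>j. (y j, c j, b' j) \<in> T \<and> (c j, y (Suc j), b j) \<in> T \<and>
     b' j \<noteq> y (Suc j) \<and> c (Suc j) \<noteq> b j)"

definition tiling :: "('p \<times> 'p \<times> 'p) set \<Rightarrow> 'p tiling \<Rightarrow> bool" where
  "tiling T s \<longleftrightarrow> (\<forall>m. strip T (be s m) (al s m) (ga s m) (be s (Suc m))) \<and>
     (\<forall>m n. al s (Suc m) n \<noteq> ga s m n)"

text \<open>Columns are indexed upwards while their edges point downwards, so
  \<open>b (Suc j)\<close> is traversed before \<open>b j\<close>. The condition says that two
  consecutive edges do not lie in a common triangle.\<close>

definition straight :: "('p \<times> 'p \<times> 'p) set \<Rightarrow> (nat \<Rightarrow> 'p) \<Rightarrow> bool" where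
  "straight T b \<longleftrightarrow> (\<forall>j. \<not> adj T (b (Suc j)) (b j))"

text \<open>
  The relation \<open>adj T x y\<close> says that the point \<open>y\<close> lies on the line \<open>\<lambda>(x)\<close>. In terms of this
  relation the axioms are invariant under reversing all triples, which exchanges points and lines.
\<close>

locale triangle_system =
  fixes P :: "'p set" and T :: "('p \<times> 'p \<times> 'p) set" and q :: nat
  assumes T_in: "(x, y, z) \<in> T \<Longrightarrow> x \<in> P \<and> y \<in> P \<and> z \<in> P"
    and cyc: "(x, y, z) \<in> T \<Longrightarrow> (y, z, x) \<in> T"
    and third: "(x, y, z) \<in> T \<Longrightarrow> (x, y, z') \<in> T \<Longrightarrow> z = z'"
    and fin: "finite P"
    and ne: "P \<noteq> {}"
    and q2: "q \<ge> 2"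
    and ex_right: "x \<in> P \<Longrightarrow> x' \<in> P \<Longrightarrow> \<exists>y. adj T x y \<and> adj T x' y"
    and ex_left: "y \<in> P \<Longrightarrow> y' \<in> P \<Longrightarrow> \<exists>x. adj T x y \<and> adj T x y'"
    and uniq: "adj T x y \<Longrightarrow> adj T x' y \<Longrightarrow> adj T x y' \<Longrightarrow> adj T x' y' \<Longrightarrow> x = x' \<or> y = y'"
    and card_right: "x \<in> P \<Longrightarrow> card {y. adj T x y} = q + 1"
    and card_left: "y \<in> P \<Longrightarrow> card {x. adj T x y} = q + 1"
    and nonadj_right: "x \<in> P \<Longrightarrow> \<exists>y\<in>P. \<not> adj T x y"
    and nonadj_left: "y \<in> P \<Longrightarrow> \<exists>x\<in>P. \<not> adj T x y"
begin

section \<open>Incidence of labels and duality\<close>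

abbreviation A :: "'p \<Rightarrow> 'p \<Rightarrow> bool" where "A \<equiv> adj T"

lemma A_in: "A x y \<Longrightarrow> x \<in> P" "A x y \<Longrightarrow> y \<in> P"
  using T_in by (auto simp: adj_def)

lemma A_T: "(x, y, z) \<in> T \<Longrightarrow> A x y" "(x, y, z) \<in> T \<Longrightarrow> A y z" "(x, y, z) \<in> T \<Longrightarrow> A z x"
  unfolding adj_def using cyc by blast+

lemma third': "(x, y, z) \<in> T \<Longrightarrow> (x', y, z) \<in> T \<Longrightarrow> x = x'"
  "(x, y, z) \<in> T \<Longrightarrow> (x, y', z) \<in> T \<Longrightarrow> y = y'"
  using cyc third by metis+

lemma flip_adj [simp]: "adj (flip T) x y \<longleftrightarrow> A y x"
  unfolding adj_def flip_iff using cyc by blast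

lemma dual: "triangle_system P (flip T) q"
proof
  show "card {y. adj (flip T) x y} = q + 1" "card {y. adj (flip T) y x} = q + 1" if "x \<in> P" for x
    using card_left[OF that] card_right[OF that] by simp_all
  show "x = x' \<or> y = y'" if "adj (flip T) x y" "adj (flip T) x' y" "adj (flip T) x y'"
    "adj (flip T) x' y'" for x x' y y' using that uniq by auto
qed (use T_in cyc third' fin ne q2 ex_left ex_right nonadj_left nonadj_right in \<open>auto dest: third'\<close>)

lemma finite_A: "finite {y. A x y}" "finite {x. A x y}"
  using fin A_in by (auto intro: rev_finite_subset[OF fin])

lemma other_right: assumes "x \<in> P" shows "\<exists>y'. A x y' \<and> y' \<noteq> y"
proof (rule ccontr)
  assume "\<not> ?thesis"
  then have "{y. A x y} \<subseteq> {y}" by auto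
  then have "card {y. A x y} \<le> 1" using card_mono[of "{y}"] by fastforce
  then show False using card_right[OF assms] q2 by simp
qed

subsection \<open>Strips\<close>

text \<open>The inequalities derived here are those of \<open>strip\<close> seen from another edge:
  two triangles with a common edge coincide as soon as they share a second label in the same cyclic
  position.\<close>

lemma stripD:
  assumes "strip T b' y c b"
  shows "(y j, c j, b' j) \<in> T" "(c j, y (Suc j), b j) \<in> T" "b' j \<noteq> y (Suc j)" "c (Suc j) \<noteq> b j"
    "y j \<noteq> b j" "b' (Suc j) \<noteq> c j"
    "A (y j) (c j)" "A (c j) (b' j)" "A (b' j) (y j)"
    "A (c j) (y (Suc j))" "A (y (Suc j)) (b j)" "A (b j) (c j)"
proof -
  show *: "(y j, c j, b' j) \<in> T" "(c j, y (Suc j), b j) \<in> T" "b' j \<noteq> y (Suc j)"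
    and **: "c (Suc j) \<noteq> b j" for j
    using assms by (auto simp: strip_def)
  show "y j \<noteq> b j" using *[of j] by (metis cyc third)
  show "b' (Suc j) \<noteq> c j"
    using *(1)[of "Suc j"] *(2)[of j] **[of j] by (metis cyc third)
  show "A (y j) (c j)" "A (c j) (b' j)" "A (b' j) (y j)"
    "A (c j) (y (Suc j))" "A (y (Suc j)) (b j)" "A (b j) (c j)"
    using *[of j] A_T by blast+
qed

text \<open>If two consecutive edges of a column lay in a common triangle, two distinct points would
  lie on two common lines, and \<open>uniq\<close> would identify two labels that a strip keeps
  apart.\<close>

lemma strip_straight:
  assumes "strip T b' y c b"
  shows "straight T b'" "straight T b"
proof -
  note D = stripD[OF assms]
  show "straight T b'" unfolding straight_def
  proof (intro allI notI)
    fix j assume "A (b' (Suc j)) (b' j)"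
    then have "c j = b' (Suc j)"
      using uniq[of "c j" "b' j" "b' (Suc j)" "y (Suc j)"] D(3)[of j] D(8,10)[of j] D(9)[of "Suc j"]
      by blast
    then show False using D(6) by metis
  qed
  show "straight T b" unfolding straight_def
  proof (intro allI notI)
    fix j assume "A (b (Suc j)) (b j)"
    then have "y (Suc j) = b (Suc j)"
      using uniq[of "y (Suc j)" "b j" "b (Suc j)" "c (Suc j)"] D(4)[of j] D(11)[of j] D(7)[of "Suc j"]
        D(12)[of "Suc j"] by auto
    then show False using D(5) by metis
  qed
qed

text \<open>Distinctness of the triangles along a common column spreads upwards, so it is imposed at
  the bottom only. An equality at height \<open>Suc j\<close> puts the lines of \<open>c1 j\<close>
  and \<open>y (Suc j)\<close> through the same two points, which carries the coincidence down to
  height \<open>j\<close>.\<close>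

lemma strip_glue:
  assumes "strip T b' y c b" "strip T b y1 c1 b1" "y1 0 \<noteq> c 0"
  shows "y1 j \<noteq> c j"
proof (induction j)
  case (Suc j)
  note D = stripD[OF assms(1)] and E = stripD[OF assms(2)]
  show ?case
  proof
    assume eq: "y1 (Suc j) = c (Suc j)"
    have "c1 j = y (Suc j)"
      using uniq[of "c1 j" "b j" "y (Suc j)" "c (Suc j)"] D(4)[of j] D(11)[of j] D(7)[of "Suc j"]
        E(8)[of j] E(10)[of j] eq by auto
    then show False using D(2)[of j] E(1)[of j] Suc third' cyc by metis
  qed
qed (use assms in simp)

text \<open>The diagonal label \<open>c j\<close> is the only common point of the lines of
  \<open>y j\<close> and \<open>b j\<close>, which are distinct labels; the triples then yield
  \<open>y (Suc j)\<close> and \<open>b' j\<close>.\<close>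

lemma strip_unique_upto:
  assumes "strip T b' y c b" "strip T d' z e d" "y 0 = z 0" "\<And>j. j < n \<Longrightarrow> b j = d j"
  shows "\<And>j. j \<le> n \<Longrightarrow> y j = z j" "\<And>j. j < n \<Longrightarrow> c j = e j" "\<And>j. j < n \<Longrightarrow> b' j = d' j"
proof -
  note D = stripD[OF assms(1)] and E = stripD[OF assms(2)]
  have ce: "c j = e j" if "y j = z j" "j < n" for j
    using uniq[of "y j" "c j" "b j" "e j"] D(5,7,12)[of j] E(5,7,12)[of j] that assms(4)[of j] by auto
  have yz: "y j = z j" if "j \<le> n" for j
    using that
  proof (induction j)
    case (Suc j)
    then have "c j = e j" using ce by simp
    then show ?case using D(2)[of j] E(2)[of j] Suc.prems assms(4)[of j] third' by (metis Suc_le_lessD)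
  qed (use assms in simp)
  then show "\<And>j. j \<le> n \<Longrightarrow> y j = z j" by simp
  show "\<And>j. j < n \<Longrightarrow> c j = e j" using ce yz by simp
  then show "\<And>j. j < n \<Longrightarrow> b' j = d' j" using yz D(1) E(1) third by (metis less_imp_le)
qed

text \<open>The same recursion used as a construction. Straightness of \<open>b\<close> keeps each
  new horizontal label different from the next label of \<open>b\<close>, so that the recursion can
  go on.\<close>

lemma strip_fill_left:
  assumes "straight T b" "\<And>j. b j \<in> P" "y0 \<in> P" "y0 \<noteq> b 0"
  shows "\<exists>b' y c. strip T b' y c b \<and> y 0 = y0"
proof -
  have "\<exists>y. y 0 = y0 \<and> (\<forall>j. y j \<in> P \<and> y j \<noteq> b j \<and> (\<exists>c. A (y j) c \<and> (c, y (Suc j), b j) \<in> T))"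
  proof -
    have "\<exists>y. \<forall>j. (y j \<in> P \<and> y j \<noteq> b j \<and> (j = 0 \<longrightarrow> y j = y0)) \<and>
        (\<exists>c. A (y j) c \<and> (c, y (Suc j), b j) \<in> T)"
    proof (rule dependent_nat_choice)
      fix x n assume x: "x \<in> P \<and> x \<noteq> b n \<and> (n = 0 \<longrightarrow> x = y0)"
      obtain c where c: "A x c" "A (b n) c" using ex_right assms(2) x by blast
      then obtain y where y: "(b n, c, y) \<in> T" by (auto simp: adj_def)
      then have "(c, y, b n) \<in> T" "A y (b n)" using cyc A_T by blast+
      moreover have "y \<noteq> b (Suc n)" using assms(1) \<open>A y (b n)\<close> by (auto simp: straight_def)
      ultimately show "\<exists>y. (y \<in> P \<and> y \<noteq> b (Suc n) \<and> (Suc n = 0 \<longrightarrow> y = y0)) \<and>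
          (\<exists>c. A x c \<and> (c, y, b n) \<in> T)" using c A_in by blast
    qed (use assms in auto)
    then show ?thesis by blast
  qed
  then obtain y where y: "y 0 = y0" "\<And>j. y j \<noteq> b j"
      "\<forall>j. \<exists>c. A (y j) c \<and> (c, y (Suc j), b j) \<in> T" by blast
  then obtain c where c: "\<And>j. A (y j) (c j)" "\<And>j. (c j, y (Suc j), b j) \<in> T"
    using choice[of "\<lambda>j c. A (y j) c \<and> (c, y (Suc j), b j) \<in> T"] by blast
  then obtain b' where b': "\<And>j. (y j, c j, b' j) \<in> T"
    using choice[of "\<lambda>j b. (y j, c j, b) \<in> T"] by (auto simp: adj_def)
  have "b' j \<noteq> y (Suc j)" for j
    using c(2)[of j] b'[of j] y(2)[of j] by (metis cyc third)
  moreover have "c (Suc j) \<noteq> b j" for j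
    using assms(1) A_T(3)[OF cyc[OF cyc[OF c(2)[of "Suc j"]]]] A_T[OF c(2)[of "Suc j"]]
    by (auto simp: straight_def)
  ultimately show ?thesis using b' c y(1) unfolding strip_def by blast
qed

text \<open>From the left column, \<open>c\<close> is forced by a triple, and the next horizontal
  label is a common point of the lines of \<open>c\<close> and \<open>b' (Suc j)\<close>.
  Straightness excludes the folded case \<open>y (Suc j) = b' j\<close>.\<close>

lemma strip_fill_right:
  assumes "straight T b'" "\<And>j. b' j \<in> P" "A (b' 0) y0"
  shows "\<exists>y c b. strip T b' y c b \<and> y 0 = y0"
proof -
  have "\<exists>y. \<forall>j. (A (b' j) (y j) \<and> (j = 0 \<longrightarrow> y j = y0)) \<and>
      (\<exists>c. (y j, c, b' j) \<in> T \<and> A c (y (Suc j)))"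
  proof (rule dependent_nat_choice)
    fix x n assume x: "A (b' n) x \<and> (n = 0 \<longrightarrow> x = y0)"
    then obtain c where c: "(b' n, x, c) \<in> T" by (auto simp: adj_def)
    obtain y where "A c y" "A (b' (Suc n)) y"
      using ex_right[of c "b' (Suc n)"] assms(2) T_in[OF c] by blast
    then show "\<exists>y. (A (b' (Suc n)) y \<and> (Suc n = 0 \<longrightarrow> y = y0)) \<and> (\<exists>c. (x, c, b' n) \<in> T \<and> A c y)"
      using cyc[OF c] by blast
  qed (use assms in auto)
  then obtain y where y: "y 0 = y0" "\<And>j. A (b' j) (y j)"
    "\<forall>j. \<exists>c. (y j, c, b' j) \<in> T \<and> A c (y (Suc j))" by blast
  then obtain c where c: "\<And>j. (y j, c j, b' j) \<in> T" "\<And>j. A (c j) (y (Suc j))"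
    using choice[of "\<lambda>j c. (y j, c, b' j) \<in> T \<and> A c (y (Suc j))"] by blast
  then obtain b where b: "\<And>j. (c j, y (Suc j), b j) \<in> T"
    using choice[of "\<lambda>j b. (c j, y (Suc j), b) \<in> T"] by (auto simp: adj_def)
  have ne: "b' j \<noteq> y (Suc j)" for j
    using assms(1) y(2)[of "Suc j"] by (metis straight_def)
  moreover have "c (Suc j) \<noteq> b j" for j
  proof
    assume "c (Suc j) = b j"
    then have "c j = b' (Suc j)"
      using c(1)[of "Suc j"] b[of j] by (metis cyc third)
    then show False using assms(1) A_T(2)[OF c(1)[of j]] by (auto simp: straight_def)
  qed
  ultimately show ?thesis using b c y(1) unfolding strip_def by blast
qed

subsection \<open>Tilings\<close>

lemma tilingD:
  assumes "tiling T s"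
  shows "strip T (be s m) (al s m) (ga s m) (be s (Suc m))" "al s (Suc m) n \<noteq> ga s m n"
    "(al s m n, ga s m n, be s m n) \<in> T" "(ga s m n, al s m (Suc n), be s (Suc m) n) \<in> T"
    "be s m n \<noteq> al s m (Suc n)" "ga s m (Suc n) \<noteq> be s (Suc m) n"
    "\<not> A (be s m (Suc n)) (be s m n)" "al s m n \<noteq> be s (Suc m) n"
    "be s m (Suc n) \<noteq> ga s m n" "ga s (Suc m) n \<noteq> al s m (Suc n)"
proof -
  show S: "strip T (be s m) (al s m) (ga s m) (be s (Suc m))" and N: "al s (Suc m) n \<noteq> ga s m n"
    for m n
    using assms by (auto simp: tiling_def)
  show "ga s (Suc m) n \<noteq> al s m (Suc n)"
    using stripD(1)[OF S, of "Suc m" n] stripD(2)[OF S, of m n] N[of m n] by (metis cyc third)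
  show "(al s m n, ga s m n, be s m n) \<in> T" "(ga s m n, al s m (Suc n), be s (Suc m) n) \<in> T"
    "be s m n \<noteq> al s m (Suc n)" "ga s m (Suc n) \<noteq> be s (Suc m) n" "al s m n \<noteq> be s (Suc m) n"
    "be s m (Suc n) \<noteq> ga s m n"
    using stripD[OF S] by blast+
  show "\<not> A (be s m (Suc n)) (be s m n)"
    using strip_straight[OF S] by (auto simp: straight_def)
qed

lemma tiling_in [simp]:
  assumes "tiling T s"
  shows "al s m n \<in> P" "be s m n \<in> P" "ga s m n \<in> P"
  using tilingD(3)[OF assms] T_in by blast+

lemma tilingI:
  assumes "\<And>m n. (al s m n, ga s m n, be s m n) \<in> T"
    "\<And>m n. (ga s m n, al s m (Suc n), be s (Suc m) n) \<in> T"
    "\<And>m n. be s m n \<noteq> al s m (Suc n)" "\<And>m n. al s (Suc m) n \<noteq> ga s m n"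
    "\<And>m n. ga s m (Suc n) \<noteq> be s (Suc m) n"
  shows "tiling T s"
  using assms by (simp add: tiling_def strip_def)

lemma tiling_transp:
  assumes "tiling T s"
  shows "tiling (flip T) (transp s)"
proof (rule triangle_system.tilingI[OF dual])
  fix m n
  note D = tilingD[OF assms]
  show "(al (transp s) m n, ga (transp s) m n, be (transp s) m n) \<in> flip T"
    "(ga (transp s) m n, al (transp s) m (Suc n), be (transp s) (Suc m) n) \<in> flip T"
    using D(3)[of n m] cyc[OF D(4)[of n m]] by simp_all
  show "be (transp s) m n \<noteq> al (transp s) m (Suc n)" "al (transp s) (Suc m) n \<noteq> ga (transp s) m n"
    "ga (transp s) m (Suc n) \<noteq> be (transp s) (Suc m) n"
    using D(8-10) by (simp_all add: eq_commute)
qed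

lemma al_straight: "tiling T s \<Longrightarrow> \<not> A (al s m n) (al s (Suc m) n)"
  using triangle_system.tilingD(7)[OF dual tiling_transp] by fastforce

lemma tiling_shift [simp]: "tiling T s \<Longrightarrow> tiling T (shift i j s)"
  using tilingD by (intro tilingI) auto

text \<open>The new diagonal label \<open>c 0\<close> lies on the line of \<open>y\<close> and
  \<open>al s 0 0\<close> does not, so the triangles on the two sides of the old left column differ
  at the bottom; \<open>strip_glue\<close> gives the other heights.\<close>

lemma add_col:
  assumes s: "tiling T s" and y: "y \<in> P" "\<not> A y (al s 0 0)"
  shows "\<exists>s'. tiling T s' \<and> shift 1 0 s' = s \<and> al s' 0 0 = y"
proof -
  have b: "straight T (be s 0)" using tilingD(7)[OF s] by (simp add: straight_def)
  have "A (be s 0 0) (al s 0 0)" using A_T tilingD(3)[OF s] by blast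
  then have "y \<noteq> be s 0 0" using y by auto
  then obtain b' z c where S: "strip T b' z c (be s 0)" and z: "z 0 = y"
    using strip_fill_left[OF b _ y(1)] s by auto
  let ?s = "Tiling (\<lambda>m. case m of 0 \<Rightarrow> z | Suc k \<Rightarrow> al s k) (\<lambda>m. case m of 0 \<Rightarrow> b' | Suc k \<Rightarrow> be s k)
    (\<lambda>m. case m of 0 \<Rightarrow> c | Suc k \<Rightarrow> ga s k)"
  have "A y (c 0)" using stripD(7)[OF S, of 0] z by simp
  then have g: "al s 0 n \<noteq> c n" for n
    using strip_glue[OF S tilingD(1)[OF s]] y by metis
  have "tiling T ?s"
    unfolding tiling_def using S g tilingD(1,2)[OF s] by (auto split: nat.split)
  moreover have "shift 1 0 ?s = s" by (rule tiling_eqI) auto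
  ultimately show ?thesis using z by fastforce
qed

lemma add_col_unique:
  assumes "tiling T s" "tiling T t" "shift 1 0 s = shift 1 0 t" "al s 0 0 = al t 0 0"
  shows "s = t"
proof -
  have eq: "al s (Suc m) n = al t (Suc m) n" "be s (Suc m) n = be t (Suc m) n"
    "ga s (Suc m) n = ga t (Suc m) n" for m n
    using arg_cong[OF assms(3), of "\<lambda>s. al s m n"] arg_cong[OF assms(3), of "\<lambda>s. be s m n"]
      arg_cong[OF assms(3), of "\<lambda>s. ga s m n"] by simp_all
  have "al s 0 n = al t 0 n" "be s 0 n = be t 0 n" "ga s 0 n = ga t 0 n" for n
    using strip_unique_upto[OF tilingD(1)[OF assms(1), of 0] tilingD(1)[OF assms(2), of 0],
        where n = "Suc n" and j = n] assms(4) eq(2) by auto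
  then show ?thesis
    using eq by (intro tiling_eqI) (metis not0_implies_Suc)+
qed

lemma add_row:
  assumes s: "tiling T s" and y: "y \<in> P" "\<not> A (be s 0 0) y"
  shows "\<exists>s'. tiling T s' \<and> shift 0 1 s' = s \<and> be s' 0 0 = y"
proof -
  obtain t where t: "tiling (flip T) t" "shift 1 0 t = transp s" "al t 0 0 = y"
    using triangle_system.add_col[OF dual tiling_transp[OF s]] y by auto
  then have "shift 0 1 (transp t) = s" by (metis transp_shift transp_transp)
  then show ?thesis using triangle_system.tiling_transp[OF dual t(1)] t(3) by (intro exI[of _ "transp t"]) simp
qed

lemma add_row_unique:
  assumes "tiling T s" "tiling T t" "shift 0 1 s = shift 0 1 t" "be s 0 0 = be t 0 0"
  shows "s = t"
  using triangle_system.add_col_unique[OF dual tiling_transp[OF assms(1)] tiling_transp[OF assms(2)]] assms(3,4)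
  by (metis transp_eq_iff transp_sel(1) transp_shift)

text \<open>A straight left column is chosen first, then strips are appended to its right. Each new
  bottom label only has to avoid the bottom diagonal label of the preceding strip, and a line has
  more than one point.\<close>

lemma tiling_exists:
  assumes "A b0 y0"
  shows "\<exists>s. tiling T s \<and> al s 0 0 = y0 \<and> be s 0 0 = b0"
proof -
  have "\<exists>b. \<forall>j::nat. (b j \<in> P \<and> (j = 0 \<longrightarrow> b j = b0)) \<and> \<not> A (b (Suc j)) (b j)"
    by (rule dependent_nat_choice) (use assms A_in nonadj_left in \<open>simp, blast?\<close>)+
  then obtain b where b: "straight T b" "\<And>j. b j \<in> P" "b 0 = b0" by (auto simp: straight_def)
  \<comment> \<open>A state is a strip with its two columns; successive states share a column and
    have distinct triangles at its lowest edge.\<close>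
  let ?I = "\<lambda>(b', y, c, b). strip T b' y c b"
  let ?R = "\<lambda>x x'. fst x' = snd (snd (snd x)) \<and> fst (snd x') 0 \<noteq> fst (snd (snd x)) 0"
  have "\<exists>S. \<forall>m::nat. (?I (S m) \<and> (m = 0 \<longrightarrow> fst (S m) = b \<and> fst (snd (S m)) 0 = y0)) \<and>
      ?R (S m) (S (Suc m))"
  proof (rule dependent_nat_choice)
    obtain y c b1 where "strip T b y c b1" "y 0 = y0"
      using strip_fill_right[OF b(1,2), of y0] b(3) assms by blast
    then show "\<exists>x. ?I x \<and> ((0::nat) = 0 \<longrightarrow> fst x = b \<and> fst (snd x) 0 = y0)"
      by (intro exI[of _ "(b, y, c, b1)"]) simp
  next
    fix x and n :: nat
    assume x: "?I x \<and> (n = 0 \<longrightarrow> fst x = b \<and> fst (snd x) 0 = y0)"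
    obtain b' y c d where xe: "x = (b', y, c, d)" by (cases x)
    with x have I: "strip T b' y c d" by simp
    have d: "\<And>j. d j \<in> P" using stripD(2)[OF I] T_in by blast
    obtain z where "A (d 0) z" "z \<noteq> c 0" using other_right[OF d] by blast
    then obtain y' c' d' where "strip T d y' c' d'" "y' 0 = z"
      using strip_fill_right[OF strip_straight(2)[OF I] d] by blast
    then show "\<exists>y. (?I y \<and> (Suc n = 0 \<longrightarrow> fst y = b \<and> fst (snd y) 0 = y0)) \<and>
        fst y = snd (snd (snd x)) \<and> fst (snd y) 0 \<noteq> fst (snd (snd x)) 0"
      using \<open>z \<noteq> c 0\<close> by (intro exI[of _ "(d, y', c', d')"]) (simp add: xe)
  qed
  then obtain S where "\<forall>m. (?I (S m) \<and> (m = 0 \<longrightarrow> fst (S m) = b \<and> fst (snd (S m)) 0 = y0)) \<and>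
      ?R (S m) (S (Suc m))" ..
  then have S: "\<And>m. ?I (S m)" "fst (S 0) = b" "fst (snd (S 0)) 0 = y0"
    "\<And>m. ?R (S m) (S (Suc m))" by simp_all
  let ?s = "Tiling (\<lambda>m. fst (snd (S m))) (\<lambda>m. fst (S m)) (\<lambda>m. fst (snd (snd (S m))))"
  have st: "strip T (fst (S m)) (fst (snd (S m))) (fst (snd (snd (S m)))) (fst (S (Suc m)))" for m
    using S(1)[of m] S(4)[of m] by (simp add: case_prod_beta)
  have "tiling T ?s"
    unfolding tiling_def using st strip_glue[OF st st] S(4) by simp
  moreover have "al ?s 0 0 = y0" "be ?s 0 0 = b0" using S(2,3) b(3) by simp_all
  ultimately show ?thesis by blast
qed

end

subsection \<open>Change of base point\<close>

text \<open>
  \<open>step T x s t d\<close> means that moving the base point of \<open>s\<close> along its outgoing edge with label \<open>x\<close>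
  turns \<open>s\<close> into \<open>t\<close>, and that the new base point has the coordinates \<open>d\<close> with respect to \<open>s\<close>.
\<close>

inductive step ::
    "('p \<times> 'p \<times> 'p) set \<Rightarrow> 'p \<Rightarrow> 'p tiling \<Rightarrow> 'p tiling \<Rightarrow> int \<times> int \<Rightarrow> bool"
  for T :: "('p \<times> 'p \<times> 'p) set" where
  right: "tiling T s \<Longrightarrow> step T (al s 0 0) s (shift 1 0 s) (1, 0)"
| down: "tiling T t \<Longrightarrow> step T (be t 0 0) (shift 0 1 t) t (0, -1)"
| diag: "tiling T s \<Longrightarrow> tiling T t \<Longrightarrow> shift 1 0 t = shift 0 1 s \<Longrightarrow>
    (x, al t 0 0, be s 0 0) \<in> T \<Longrightarrow> x \<noteq> al s 0 0 \<Longrightarrow> step T x s t (-1, 1)"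

lemma shift_eq_sel:
  assumes "shift i j s = shift k l t"
  shows "al s (i + m) (j + n) = al t (k + m) (l + n)" "be s (i + m) (j + n) = be t (k + m) (l + n)"
    "ga s (i + m) (j + n) = ga t (k + m) (l + n)"
  using assms by (metis shift_sel)+

definition letter ::
    "('p \<times> 'p \<times> 'p) set \<Rightarrow> 'p \<times> bool \<Rightarrow> 'p tiling \<Rightarrow> 'p tiling \<Rightarrow> int \<times> int \<Rightarrow> bool" where
  "letter T a s t d \<longleftrightarrow> (if snd a then step T (fst a) s t d else step T (fst a) t s (- d))"

primrec moves ::
    "('p \<times> 'p \<times> 'p) set \<Rightarrow> 'p word \<Rightarrow> 'p tiling \<Rightarrow> 'p tiling \<Rightarrow> int \<times> int \<Rightarrow> bool" where
  "moves T [] s t d \<longleftrightarrow> t = s \<and> d = 0"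
| "moves T (a # w) s t d \<longleftrightarrow> (\<exists>u e. letter T a s u e \<and> moves T w u t (d - e))"

definition relators :: "('p \<times> 'p \<times> 'p) set \<Rightarrow> 'p word set" where
  "relators T = {[(x, True), (y, True), (z, True)] | x y z. (x, y, z) \<in> T}"

lemma moves_Cons:
  "letter T a s u e \<Longrightarrow> moves T w u t f \<Longrightarrow> d = e + f \<Longrightarrow> moves T (a # w) s t d"
  unfolding moves.simps by (metis add_diff_cancel_left')

context triangle_system
begin

lemma step_tiling: "step T x s t d \<Longrightarrow> tiling T s \<and> tiling T t"
  by (induction rule: step.induct) auto

lemma step_in: "step T x s t d \<Longrightarrow> x \<in> P"
  by (induction rule: step.induct) (use T_in in auto)

text \<open>In a diagonal step the two base points and the apex of the common sector
  \<open>shift 1 0 t = shift 0 1 s\<close> span a triangle. \<open>step\<close> requires it to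
  differ from the triangle of \<open>s\<close> at \<open>be s 0 0\<close>; here it is found to
  differ from the triangle of \<open>t\<close> at \<open>al t 0 0\<close>, which makes the clause
  self-dual.\<close>

lemma diag_ne:
  assumes "tiling T s" "tiling T t" "shift 1 0 t = shift 0 1 s" "(x, al t 0 0, be s 0 0) \<in> T"
  shows "x \<noteq> be t 0 0"
proof
  assume "x = be t 0 0"
  then have "ga t 0 0 = be s 0 0"
    using assms(4) tilingD(3)[OF assms(2), of 0 0] third cyc by metis
  moreover have "be t 1 0 = be s 0 1" using shift_eq_sel(2)[OF assms(3), of 0 0] by simp
  moreover have "A (be t 1 0) (ga t 0 0)"
    using stripD(12)[OF tilingD(1)[OF assms(2), of 0], of 0] by simp
  ultimately show False using tilingD(7)[OF assms(1), of 0 0] by simp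
qed

text \<open>Transposition reverses edges, hence exchanges source and target. Running a step
  backwards thus becomes running a step forwards in the dual system.\<close>

lemma step_transp:
  assumes "step T x s t d"
  shows "step (flip T) x (transp t) (transp s) (- snd d, - fst d)"
  using assms
proof cases
  case right
  then show ?thesis
    using step.down[OF tiling_transp[OF right(4)]] by (simp add: transp_shift)
next
  case down
  then show ?thesis
    using step.right[OF tiling_transp[OF down(4)]] by (simp add: transp_shift)
next
  case diag
  have "step (flip T) x (transp t) (transp s) (-1, 1)"
  proof (rule step.diag)
    show "shift 1 0 (transp s) = shift 0 1 (transp t)"
      using diag(4) by (metis transp_shift)
    show "(x, al (transp s) 0 0, be (transp t) 0 0) \<in> flip T"
      using diag(5) cyc by simp
    show "x \<noteq> al (transp t) 0 0"
      using diag_ne diag by simp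
  qed (use diag tiling_transp in auto)
  then show ?thesis using diag by simp
qed

text \<open>An outgoing edge at the apex is the edge \<open>al s 0 0\<close> of the sector, or
  continues the left column straight, or spans another triangle with the lowest edge of that column.
  These are the three clauses of \<open>step\<close>.\<close>

lemma step_total:
  assumes s: "tiling T s" and x: "x \<in> P"
  shows "\<exists>t d. step T x s t d"
proof -
  consider "x = al s 0 0" | "\<not> A (be s 0 0) x" | "x \<noteq> al s 0 0" "A (be s 0 0) x" by blast
  then show ?thesis
  proof cases
    case 1
    then show ?thesis using right[OF s] by blast
  next
    case 2
    then obtain t where "tiling T t" "shift 0 1 t = s" "be t 0 0 = x" using add_row[OF s x] by blast
    then show ?thesis using down by blast
  next
    case 3
    then obtain w where w: "(be s 0 0, x, w) \<in> T" by (auto simp: adj_def)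
    \<comment> \<open>The bottom row of the tiling to be built has to be straight at its first
      vertex; otherwise \<open>w\<close> would be the diagonal label of \<open>s\<close> and
      \<open>x\<close> would be \<open>al s 0 0\<close>.\<close>
    have "\<not> A w (al s 0 1)"
    proof
      assume "A w (al s 0 1)"
      then have "w = ga s 0 0"
        using uniq[of w "be s 0 0" "ga s 0 0" "al s 0 1"] A_T[OF w] A_T[OF tilingD(3)[OF s, of 0 0]]
          A_T[OF tilingD(4)[OF s, of 0 0]] tilingD(5)[OF s, of 0 0] by auto
      then show False using w tilingD(3)[OF s, of 0 0] 3(1) third' cyc by metis
    qed
    then obtain t where "tiling T t" "shift 1 0 t = shift 0 1 s" "al t 0 0 = w"
      using add_col[of "shift 0 1 s" w] s T_in[OF w] by auto
    then show ?thesis using diag[OF s, of t x] w cyc 3(1) by blast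
  qed
qed

text \<open>The clause can be read off from \<open>x\<close>: the relation
  \<open>A (be s 0 0) x\<close> fails exactly for the downward clause, and
  \<open>x = al s 0 0\<close> separates the other two.\<close>

lemma step_unique:
  assumes "step T x s t d" "step T x s t' d'"
  shows "t = t' \<and> d = d'"
proof -
  have A1: "A (be s 0 0) x" if "step T x s t d" "d \<noteq> (0, -1)" for t d
    using that(1) by cases (use that(2) A_T tilingD(3) in blast)+
  have A2: "\<not> A (be s 0 0) x" if "step T x s t (0, -1)" for t
    using that by cases (use tilingD(7)[of t 0 0] in auto)
  have A3: "x = al s 0 0 \<longleftrightarrow> d = (1, 0)" if "step T x s t d" for t d
    using that by cases (use tilingD(7)[of t 0 0] A_T(3)[OF tilingD(3)[of s 0 0]] in auto)
  have "d = d'"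
  proof -
    have "e \<in> {(1, 0), (0, -1), (-1, 1)}" if "step T x s u e" for u e
      using that by cases auto
    then show ?thesis using assms A1 A2 A3 by (metis empty_iff insert_iff)
  qed
  moreover have "t = t'"
    using assms(1)
  proof cases
    case right
    show ?thesis using assms(2) by cases (use right \<open>d = d'\<close> in auto)
  next
    case down
    show ?thesis using assms(2)
      by cases (use down \<open>d = d'\<close> add_row_unique[of t t'] in auto)
  next
    case diag
    show ?thesis using assms(2)
    proof cases
      case d2: diag
      show ?thesis using add_col_unique[of t t'] d2 diag third' by metis
    qed (use diag \<open>d = d'\<close> in auto)
  qed
  ultimately show ?thesis by simp
qed

lemma step_back_total:
  assumes "tiling T t" "x \<in> P"
  shows "\<exists>s d. step T x s t d"
proof -
  obtain u d where "step (flip T) x (transp t) u d"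
    using triangle_system.step_total[OF dual tiling_transp[OF assms(1)] assms(2)] by blast
  from triangle_system.step_transp[OF dual this] show ?thesis by auto
qed

lemma step_back_unique:
  assumes "step T x s t d" "step T x s' t d'"
  shows "s = s' \<and> d = d'"
  using triangle_system.step_unique[OF dual step_transp[OF assms(1)] step_transp[OF assms(2)]]
  by (auto simp: prod_eq_iff)

text \<open>Two successive steps of the same kind would be straight, against \<open>A x y\<close>.
  In the six mixed cases the triple forces \<open>z\<close> to perform the step of the remaining
  kind, which leads back to \<open>s\<close>.\<close>

lemma step_triangle:
  assumes "step T x s u d" "step T y u t e" "(x, y, z) \<in> T"
  shows "step T z t s (- d - e)"
  using assms(1)
proof cases
  case s: right
  note D = tilingD[OF s(4)]
  show ?thesis using assms(2)
  proof cases
    case right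
    then show ?thesis using al_straight[OF s(4), of 0 0] A_T(1)[OF assms(3)] s by simp
  next
    case down
    have "z \<noteq> be s 0 0"
    proof
      assume "z = be s 0 0"
      then have "y = ga s 0 0" using assms(3) D(3)[of 0 0] s third' by metis
      moreover have "be s 1 0 = be t 0 1" using shift_eq_sel(2)[of 1 0 s 0 1 t 0 0] s down by simp
      ultimately show False
        using tilingD(7)[OF down(4), of 0 0] stripD(12)[OF D(1)[of 0], of 0] down by simp
    qed
    moreover have "z \<noteq> al t 0 0 \<Longrightarrow> step T z t s (-1, 1)"
      using diag[OF down(4) s(4), of z] s down cyc assms(3) by metis
    moreover have "z \<noteq> al t 0 0"
    proof
      assume "z = al t 0 0"
      then have "x = ga t 0 0" using assms(3) tilingD(3)[OF down(4), of 0 0] down cyc third' by metis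
      moreover have "al s 1 0 = al t 0 1" using shift_eq_sel(1)[of 1 0 s 0 1 t 0 0] s down by simp
      ultimately show False
        using al_straight[OF s(4), of 0 0] A_T(1)[OF tilingD(4)[OF down(4), of 0 0]] s by simp
    qed
    ultimately show ?thesis using s down by simp
  next
    case diag
    have "A (be s 1 0) y" using A_T diag(5) s by fastforce
    moreover have "A (be s 1 0) (ga s 0 0)" "A x (ga s 0 0)"
      using stripD(7,12)[OF D(1)[of 0], of 0] s by simp_all
    moreover have "x \<noteq> be s 1 0" using D(8)[of 0 0] s by simp
    ultimately have y: "y = ga s 0 0" using uniq A_T(1)[OF assms(3)] by blast
    then have z: "z = be s 0 0" using assms(3) D(3)[of 0 0] s third by metis
    have "al t 0 0 = al s 0 1" using y diag(5) D(4)[of 0 0] s third' by auto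
    then have "t = shift 0 1 s"
      using add_col_unique[of t "shift 0 1 s"] diag s by simp
    then show ?thesis using step.down[OF s(4)] z s diag by simp
  qed
next
  case s: down
  note D = tilingD[OF s(4)]
  show ?thesis using assms(2)
  proof cases
    case right
    have z: "z = ga u 0 0" using assms(3) D(3)[of 0 0] s right cyc third by metis
    have "step T z t s (-1, 1)"
    proof (rule step.diag)
      show "(z, al s 0 0, be t 0 0) \<in> T" using D(4)[of 0 0] z s right by simp
      show "z \<noteq> al t 0 0" using z right D(2)[of 0 0] by auto
    qed (use s right in auto)
    then show ?thesis using s right by simp
  next
    case down
    then show ?thesis using tilingD(7)[OF down(4), of 0 0] A_T(1)[OF assms(3)] s by simp
  next
    case diag
    then have "z = al t 0 0" using assms(3) s third cyc by metis
    moreover have "s = shift 1 0 t" using s diag by simp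
    ultimately show ?thesis using step.right[OF diag(3)] s diag by simp
  qed
next
  case s: diag
  show ?thesis using assms(2)
  proof cases
    case right
    have "z = be s 0 0" using assms(3) s(5) right third by metis
    then show ?thesis using step.down[OF s(2)] s right by simp
  next
    case down
    note D = tilingD[OF down(4)]
    have u: "al u 0 0 = al t 0 1" using down by simp
    have "A (ga t 0 0) (al t 0 1)" "A (ga t 0 0) y" "al t 0 1 \<noteq> y"
      using stripD(8,10)[OF D(1)[of 0], of 0] D(5)[of 0 0] down by auto
    then have x: "x = ga t 0 0"
      using uniq[of x y "ga t 0 0" "al t 0 1"] A_T(1)[OF assms(3)] A_T(1)[OF s(5)] u by auto
    then have z: "z = al t 0 0" using assms(3) D(3)[of 0 0] down cyc third by metis
    have "be t 1 0 = be s 0 0" using s(5) D(4)[of 0 0] x u third by auto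
    then have "shift 1 0 t = s"
      using add_row_unique[of "shift 1 0 t" s] s down by simp
    then show ?thesis using step.right[OF down(4)] s down z by simp
  next
    case diag
    have "x \<noteq> be u 0 0" using diag_ne s by blast
    moreover have "A (be u 0 0) y" "A x (al u 0 0)" using A_T diag(5) s(5) by blast+
    moreover have "A (be u 0 0) (al u 0 0)" using A_T tilingD(3)[OF s(3)] by blast
    ultimately show ?thesis using uniq A_T(1)[OF assms(3)] diag(6) by metis
  qed
qed

lemma step_disp:
  "step T x s t d \<Longrightarrow> d \<in> {(1, 0), (0, -1), (-1, 1)}"
  by (induction rule: step.induct) auto

lemma letter_tiling: "letter T a s t d \<Longrightarrow> tiling T s \<and> tiling T t"
  using step_tiling by (auto simp: letter_def split: if_splits)

lemma letter_total: "tiling T s \<Longrightarrow> fst a \<in> P \<Longrightarrow> \<exists>t d. letter T a s t d"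
  using step_total[of s "fst a"] step_back_total[of s "fst a"]
  by (auto simp: letter_def) (metis minus_minus)

lemma letter_unique: "letter T a s t d \<Longrightarrow> letter T a s t' d' \<Longrightarrow> t = t' \<and> d = d'"
  using step_unique step_back_unique by (fastforce simp: letter_def split: if_splits)

lemma letter_inv: "letter T (x, b) s t d \<Longrightarrow> letter T (x, \<not> b) t s (- d)"
  by (auto simp: letter_def split: if_splits)

lemma moves_tiling: "moves T w s t d \<Longrightarrow> tiling T s \<Longrightarrow> tiling T t"
  by (induction w arbitrary: s d) (use letter_tiling in auto)

lemma moves_append:
  "moves T (v @ w) s t d \<longleftrightarrow> (\<exists>u e. moves T v s u e \<and> moves T w u t (d - e))"
proof (induction v arbitrary: s d)
  case (Cons a v)
  show ?case (is "?L \<longleftrightarrow> ?R")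
  proof
    assume ?L
    then obtain u e u' e' where "letter T a s u e" "moves T v u u' e'" "moves T w u' t (d - e - e')"
      unfolding append_Cons moves.simps Cons by blast
    moreover have "e + e' - e = e'" "d - (e + e') = d - e - e'" by simp_all
    ultimately show ?R unfolding moves.simps by metis
  next
    assume ?R
    then obtain u e u' e' where "letter T a s u e" "moves T v u u' (e' - e)" "moves T w u' t (d - e')"
      unfolding moves.simps by blast
    then show ?L unfolding append_Cons moves.simps Cons
      by (intro exI[of _ u] exI[of _ e] conjI exI[of _ u'] exI[of _ "e' - e"]) simp_all
  qed
qed simp

lemma moves_unique: "moves T w s t d \<Longrightarrow> moves T w s t' d' \<Longrightarrow> t = t' \<and> d = d'"
proof (induction w arbitrary: s d d')
  case (Cons a w)
  then obtain u e u' e' where "letter T a s u e" "moves T w u t (d - e)"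
    "letter T a s u' e'" "moves T w u' t' (d' - e')" by auto
  moreover from this have "u = u'" "e = e'" using letter_unique by blast+
  ultimately have "t = t' \<and> d - e = d' - e" using Cons.IH by blast
  then show ?case by simp
qed simp

lemma moves_null:
  assumes "r \<in> words P" "\<And>s. tiling T s \<Longrightarrow> moves T r s s 0" "w \<in> words P" "tiling T s"
  shows "moves T (r @ w) s t d \<longleftrightarrow> moves T w s t d"
proof
  assume "moves T (r @ w) s t d"
  then obtain u e where "moves T r s u e" "moves T w u t (d - e)" unfolding moves_append by blast
  then show "moves T w s t d" using moves_unique[OF assms(2)[OF assms(4)]] by fastforce
next
  assume "moves T w s t d"
  then show "moves T (r @ w) s t d"
    unfolding moves_append using assms(2)[OF assms(4)] by (intro exI[of _ s] exI[of _ 0]) simp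
qed

lemma moves_null_middle:
  assumes "r \<in> words P" "\<And>s. tiling T s \<Longrightarrow> moves T r s s 0" "u \<in> words P" "w \<in> words P" "tiling T s"
  shows "moves T (u @ r @ w) s t d \<longleftrightarrow> moves T (u @ w) s t d"
  using moves_null[OF assms(1,2,4)] moves_tiling[OF _ assms(5)]
  unfolding moves_append[of u] by blast

text \<open>Cancelling pairs and relators act as the identity with displacement zero. Hence
  different displacements or different images certify different group elements.\<close>

lemma moves_cong:
  "(u, w) \<in> pres_cong P (relators T) \<Longrightarrow> tiling T s \<Longrightarrow> moves T u s t d \<longleftrightarrow> moves T w s t d"
proof (induction arbitrary: s t d rule: pres_cong.induct)
  case (cancel u w x b)
  have null: "moves T [(x, b), (x, \<not> b)] s s 0" if st: "tiling T s" for s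
  proof -
    obtain t d where "letter T (x, b) s t d" using letter_total[OF st, of "(x, b)"] cancel by auto
    from this letter_inv[OF this] show ?thesis
      by (rule moves_Cons[where f = "- d", OF _ moves_Cons[where f = 0]]) (simp_all add: prod_eq_iff)
  qed
  show ?case by (rule moves_null_middle[OF _ null]) (use cancel in simp_all)
next
  case (relator u w r)
  then obtain x y z where r: "r = [(x, True), (y, True), (z, True)]" and T: "(x, y, z) \<in> T"
    by (auto simp: relators_def)
  have null: "moves T r s s 0" if st: "tiling T s" for s
  proof -
    obtain t d t' d' where 1: "step T x s t d" and 2: "step T y t t' d'"
      using step_total step_tiling st T_in[OF T] by meson
    have "letter T (x, True) s t d" "letter T (y, True) t t' d'" "letter T (z, True) t' s (- d - d')"
      using 1 2 step_triangle[OF 1 2 T] by (simp_all add: letter_def)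
    then show ?thesis
      unfolding r by (rule moves_Cons[where f = "- d", OF _
          moves_Cons[where f = "- d - d'", OF _ moves_Cons[where f = 0]]]) (simp_all add: prod_eq_iff)
  qed
  show ?case by (rule moves_null_middle[OF _ null]) (use relator in simp_all)
qed auto

end

subsection \<open>Prolongation of parallelograms\<close>

text \<open>The bounds differ because the parallelogram has \<open>m\<close> edges in each of its
  \<open>n + 1\<close> rows and \<open>n\<close> edges in each of its \<open>m + 1\<close>
  columns.\<close>

definition agree :: "nat \<Rightarrow> nat \<Rightarrow> 'p tiling \<Rightarrow> 'p tiling \<Rightarrow> bool" where
  "agree m n s t \<longleftrightarrow> (\<forall>i<m. \<forall>j\<le>n. al s i j = al t i j) \<and> (\<forall>i\<le>m. \<forall>j<n. be s i j = be t i j) \<and>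
     (\<forall>i<m. \<forall>j<n. ga s i j = ga t i j)"

lemma agree_refl [simp]: "agree m n s s"
  by (simp add: agree_def)

lemma agree_sym: "agree m n s t \<Longrightarrow> agree m n t s"
  by (simp add: agree_def)

lemma agree_trans: "agree m n s t \<Longrightarrow> agree m n t u \<Longrightarrow> agree m n s u"
  by (simp add: agree_def)

lemma agree_mono: "agree m n s t \<Longrightarrow> m' \<le> m \<Longrightarrow> n' \<le> n \<Longrightarrow> agree m' n' s t"
  by (simp add: agree_def)

lemma agree_transp: "agree m n (transp s) (transp t) \<longleftrightarrow> agree n m s t"
  by (auto simp: agree_def)

context triangle_system
begin

lemma glue_rows:
  assumes "tiling T s" "tiling T r" "n \<ge> 1 \<Longrightarrow> \<not> A (be r 0 0) (be s 0 (n - 1))"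
  shows "\<exists>t. tiling T t \<and> shift 0 n t = r \<and> agree 0 n s t"
  using assms
proof (induction n arbitrary: s)
  case 0
  then show ?case by (intro exI[of _ r]) (simp add: agree_def)
next
  case (Suc n)
  have "\<exists>t. tiling T t \<and> shift 0 n t = r \<and> agree 0 n (shift 0 1 s) t"
    by (rule Suc.IH) (use Suc.prems in \<open>auto split: nat_diff_split\<close>)
  then obtain t where t: "tiling T t" "shift 0 n t = r" "agree 0 n (shift 0 1 s) t" by blast
  have "\<not> A (be t 0 0) (be s 0 0)"
  proof (cases n)
    case 0
    then show ?thesis using Suc t by auto
  next
    case (Suc k)
    then show ?thesis using t(3) tilingD(7)[OF \<open>tiling T s\<close>, of 0 0] by (simp add: agree_def)
  qed
  then obtain u where u: "tiling T u" "shift 0 1 u = t" "be u 0 0 = be s 0 0"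
    using add_row[OF t(1), of "be s 0 0"] Suc.prems by auto
  have "be s 0 j = be u 0 j" if "j < Suc n" for j
    using t(3) u(2,3) that by (cases j) (auto simp: agree_def)
  then show ?case using u t(2) by (intro exI[of _ u]) (auto simp: agree_def)
qed

text \<open>The columns of \<open>s\<close> are put in front of \<open>r\<close> one at a time.
  \<open>add_col\<close> asks for straightness in the bottom row, whereas the hypothesis concerns
  row \<open>n\<close>, so straightness has to be transported downwards.\<close>

lemma glue:
  assumes "tiling T s" "tiling T r"
    "m \<ge> 1 \<Longrightarrow> \<not> A (al s (m - 1) n) (al r 0 0)"
    "n \<ge> 1 \<Longrightarrow> \<not> A (be r 0 0) (be s m (n - 1))"
  shows "\<exists>t. tiling T t \<and> shift m n t = r \<and> agree m n s t"
  using assms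
proof (induction m arbitrary: s)
  case 0
  then show ?case using glue_rows by simp
next
  case (Suc m)
  note s = Suc.prems(1)
  have "\<exists>t. tiling T t \<and> shift m n t = r \<and> agree m n (shift 1 0 s) t"
    by (rule Suc.IH) (use Suc.prems in \<open>auto split: nat_diff_split\<close>)
  then obtain t where t: "tiling T t" "shift m n t = r" "agree m n (shift 1 0 s) t" by blast
  have be: "be t 0 j = be s 1 j" if "j < n" for j using t(3) that by (simp add: agree_def)
  have "\<not> A (al s 0 0) (al t 0 0)"
  \<comment> \<open>For positive \<open>m\<close> the next horizontal label comes from
    \<open>s\<close> itself. Only the column adjacent to \<open>r\<close> needs the transport: a
    bend at height \<open>j\<close> makes two diagonal labels agree with horizontal ones and
    reappears at height \<open>Suc j\<close>.\<close>
  proof (cases m)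
    case 0
    have "\<not> A (al s 0 j) (al t 0 j)" if "j \<le> n" for j
      using that
    proof (induction rule: inc_induct)
      case base
      then show ?case using t(2) Suc.prems 0 by auto
    next
      case (step j)
      note S = tilingD(1)[OF s, of 0] and D = tilingD[OF t(1)]
      show ?case
      proof
        assume *: "A (al s 0 j) (al t 0 j)"
        have b: "be t 0 j = be s 1 j" using be step by simp
        have "ga s 0 j = al t 0 j"
          using uniq[OF stripD(7)[OF S] stripD(12)[OF S] *] stripD(5)[OF S, of j]
            A_T(3)[OF D(3)[of 0 j]] b by auto
        then have "ga t 0 j = al s 0 (Suc j)"
          using tilingD(4)[OF s, of 0 j] D(3)[of 0 j] b third cyc by (metis One_nat_def)
        then show False using step A_T(1)[OF D(4)[of 0 j]] by simp
      qed
    qed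
    then show ?thesis by simp
  next
    case (Suc k)
    then show ?thesis using t(3) al_straight[OF s, of 0 0] by (simp add: agree_def)
  qed
  then obtain u where u: "tiling T u" "shift 1 0 u = t" "al u 0 0 = al s 0 0"
    using add_col[OF t(1), of "al s 0 0"] s by auto
  have col: "be u (Suc i) j = be t i j" "al u (Suc i) j = al t i j" "ga u (Suc i) j = ga t i j" for i j
    using u(2) by auto
  have "al s 0 j = al u 0 j" if "j \<le> n" for j
    by (rule strip_unique_upto(1)[OF tilingD(1)[OF s] tilingD(1)[OF u(1)], where n = n])
      (use be col that u in auto)
  moreover have "ga s 0 j = ga u 0 j" "be s 0 j = be u 0 j" if "j < n" for j
    by (rule strip_unique_upto(2,3)[OF tilingD(1)[OF s] tilingD(1)[OF u(1)], where n = n];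
      use be col that u in auto)+
  moreover have "al s (Suc i) j = al t i j" if "i < m" "j \<le> n" for i j
    using t(3) that by (simp add: agree_def)
  moreover have "be s (Suc i) j = be t i j" if "i \<le> m" "j < n" for i j
    using t(3) that by (simp add: agree_def)
  moreover have "ga s (Suc i) j = ga t i j" if "i < m" "j < n" for i j
    using t(3) that by (simp add: agree_def)
  ultimately have "agree (Suc m) n s u"
    using col unfolding agree_def by (metis Suc_le_mono Suc_less_eq not0_implies_Suc)
  moreover have "shift (Suc m) n u = r" using u(2) t(2) by auto
  ultimately show ?case using u(1) by blast
qed

section \<open>Labels admissible in the next column\<close>

text \<open>The sector attached by \<open>glue\<close> must begin with \<open>x\<close> and continue
  the right column of \<open>s\<close> straight. Its first vertical label \<open>l\<close> has to
  have a line through \<open>x\<close> that misses \<open>b\<close>, which excludes only the line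
  joining \<open>x\<close> and \<open>b\<close>.\<close>

lemma extend_right:
  assumes "tiling T s" "x \<in> P" "\<not> A (al s m (Suc n)) x"
  shows "\<exists>t. tiling T t \<and> agree (Suc m) (Suc n) s t \<and> al t (Suc m) (Suc n) = x"
proof -
  define b where "b = be s (Suc m) n"
  have bP: "b \<in> P" and xb: "x \<noteq> b"
    using assms(3) A_T(2)[OF tilingD(4)[OF assms(1), of m n]] assms(1) by (auto simp: b_def)
  obtain l0 where l0: "A l0 x" "A l0 b" using ex_left assms(2) bP by blast
  obtain l where l: "A l x" "l \<noteq> l0" using triangle_system.other_right[OF dual assms(2)] by auto
  have "\<not> A l b" using uniq l0 l xb by blast
  moreover obtain r where r: "tiling T r" "al r 0 0 = x" "be r 0 0 = l"
    using tiling_exists[OF l(1)] by blast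
  ultimately obtain t where t: "tiling T t" "shift (Suc m) (Suc n) t = r" "agree (Suc m) (Suc n) s t"
    using glue[OF assms(1) r(1), of "Suc m" "Suc n"] assms(3) by (auto simp: b_def)
  then show ?thesis using r(2) by (intro exI[of _ t]) auto
qed

text \<open>Downwards a column is determined by its top label: the line of \<open>ga s m j\<close>
  joins the distinct points \<open>be s m j\<close> and \<open>al s m (Suc j)\<close>.\<close>

lemma agree_Suc:
  assumes "tiling T s" "tiling T t" "agree m n s t" "al s m n = al t m n"
  shows "agree (Suc m) n s t"
proof -
  have be: "be s m j = be t m j" if "j < n" for j using assms(3) that by (simp add: agree_def)
  note S = tilingD[OF assms(1)] and D = tilingD[OF assms(2)]
  have ga: "ga s m j = ga t m j" if "al s m (Suc j) = al t m (Suc j)" "j < n" for j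
    using uniq[of "ga s m j" "be s m j" "ga t m j" "al s m (Suc j)"] that be[of j] S(5)[of m j]
      A_T[OF S(3)[of m j]] A_T[OF D(3)[of m j]] A_T[OF S(4)[of m j]] A_T[OF D(4)[of m j]] by auto
  have al: "al s m j = al t m j" if "j \<le> n" for j
    using that
  proof (induction rule: inc_induct)
    case (step j)
    then show ?case using ga[of j] be[of j] S(3)[of m j] D(3)[of m j] third' by metis
  qed (use assms in simp)
  have "be s (Suc m) j = be t (Suc m) j" if "j < n" for j
    using al[of "Suc j"] ga[of j] that S(4)[of m j] D(4)[of m j] third by (metis Suc_leI)
  then show ?thesis
    using assms(3) al ga unfolding agree_def by (auto simp: less_Suc_eq le_Suc_eq)
qed

text \<open>Upwards, \<open>al s m (Suc j)\<close> is the intersection of the lines of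
  \<open>ga s m j\<close> and \<open>be s m (Suc j)\<close>. The recursion ends with
  \<open>ga s m n\<close>, since the next vertical label lies above the parallelogram; the top
  horizontal label is only confined to a line.\<close>

lemma agree_ga_top:
  assumes "tiling T s" "tiling T t" "agree m (Suc n) s t" "al s m r = al t m r" "r \<le> n"
  shows "ga s m n = ga t m n"
proof -
  have be: "be s m j = be t m j" if "j \<le> n" for j using assms(3) that by (simp add: agree_def)
  note S = tilingD[OF assms(1)] and D = tilingD[OF assms(2)]
  have ga: "ga s m j = ga t m j" if "al s m j = al t m j" "j \<le> n" for j
    using that be[of j] S(3)[of m j] D(3)[of m j] third' by metis
  have "al s m j = al t m j" if "r \<le> j" "j \<le> n" for j
    using that
  proof (induction rule: dec_induct)
    case (step j)
    then have "ga s m j = ga t m j" "be s m (Suc j) = be t m (Suc j)" using ga be by simp_all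
    then show ?case
      using uniq[of "ga s m j" "al s m (Suc j)" "be s m (Suc j)" "al t m (Suc j)"] S(9)[of m j]
        A_T[OF S(3)[of m "Suc j"]] A_T[OF D(3)[of m "Suc j"]] A_T[OF S(4)[of m j]] A_T[OF D(4)[of m j]]
      by auto
  qed (use assms in simp)
  then show ?thesis using ga assms by simp
qed

text \<open>In a plane of order q the number is q^2. The bound comes from two further lines through
  a point \<open>b\<close> of the line of \<open>x0\<close>, each with q points besides
  \<open>b\<close>; they exist because q is at least 2.\<close>

lemma card_nonadj:
  assumes "x0 \<in> P"
  shows "card {x \<in> P. \<not> A x0 x} \<ge> 2 * q"
proof -
  obtain b where b: "A x0 b" using other_right[OF assms] by blast
  have "card ({l. A l b} - {x0}) \<ge> 2"
    using card_left[OF A_in(2)[OF b]] q2 b by (simp add: card_Diff_singleton)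
  then obtain l1 l2 where l: "A l1 b" "A l2 b" "l1 \<noteq> l2" "l1 \<noteq> x0" "l2 \<noteq> x0"
    by (auto simp: numeral_2_eq_2 card_le_Suc_iff)
  let ?B = "\<lambda>l. {x. A l x} - {b}"
  have c: "card (?B l) = q" if "A l b" for l
    using card_right[OF A_in(1)[OF that]] that by (simp add: card_Diff_singleton)
  have sub: "?B l \<subseteq> {x \<in> P. \<not> A x0 x}" if "A l b" "l \<noteq> x0" for l
    using that b A_in uniq by blast
  have "?B l1 \<inter> ?B l2 = {}" using l uniq by blast
  then have "2 * q = card (?B l1 \<union> ?B l2)"
    using c l finite_A by (subst card_Un_disjoint) simp_all
  also have "\<dots> \<le> card {x \<in> P. \<not> A x0 x}"
    by (rule card_mono) (use fin sub l in auto)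
  finally show ?thesis .
qed

end

subsection \<open>Random tilings\<close>

text \<open>Only the law of the labels seen from one base point is retained. Leaving
  \<open>F\<close> abstract makes the transposed tilings an instance over the dual system.\<close>

locale tiling_process = triangle_system P T q + prob_space M
  for P :: "'p set" and T :: "('p \<times> 'p \<times> 'p) set" and q :: nat and M :: "'w measure" +
  fixes F :: "'w \<Rightarrow> 'p tiling"
  assumes F_tiling: "\<omega> \<in> space M \<Longrightarrow> tiling T (F \<omega>)"
    and cyl_sets: "tiling T s \<Longrightarrow> {\<omega> \<in> space M. agree m n s (F \<omega>)} \<in> sets M"
    and cyl_eq: "tiling T s \<Longrightarrow> tiling T t \<Longrightarrow>
      prob {\<omega> \<in> space M. agree m n s (F \<omega>)} = prob {\<omega> \<in> space M. agree m n t (F \<omega>)}"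
begin

definition cyl :: "nat \<Rightarrow> nat \<Rightarrow> 'p tiling \<Rightarrow> 'w set" where
  "cyl m n s = {\<omega> \<in> space M. agree m n s (F \<omega>)}"

lemma cyl_in_sets: "tiling T s \<Longrightarrow> cyl m n s \<in> sets M"
  using cyl_sets by (simp add: cyl_def)

lemma cyl_cong: "agree m n s t \<Longrightarrow> cyl m n s = cyl m n t"
  using agree_sym agree_trans unfolding cyl_def by blast

lemma finite_cyls: "finite (cyl m n ` {s. tiling T s})"
proof -
  define sig where "sig s = restrict (\<lambda>(i, j). (al s i j, be s i j, ga s i j)) ({..m} \<times> {..n})"
    for s :: "'p tiling"
  have "sig ` {s. tiling T s} \<subseteq> ({..m} \<times> {..n}) \<rightarrow>\<^sub>E (P \<times> P \<times> P)"
    by (auto simp: sig_def split: if_splits)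
  then have fin_sig: "finite (sig ` {s. tiling T s})"
    by (rule finite_subset) (auto intro!: finite_PiE fin)
  have "cyl m n s = cyl m n t" if "sig s = sig t" for s t
  proof (rule cyl_cong)
    have "al s i j = al t i j \<and> be s i j = be t i j \<and> ga s i j = ga t i j" if "i \<le> m" "j \<le> n" for i j
      using fun_cong[OF \<open>sig s = sig t\<close>, of "(i, j)"] that by (simp add: sig_def)
    then show "agree m n s t" by (simp add: agree_def)
  qed
  then have "cyl m n ` {s. tiling T s} \<subseteq>
      (\<lambda>x. cyl m n (inv_into {s. tiling T s} sig x)) ` sig ` {s. tiling T s}"
    by (smt (verit, best) f_inv_into_f image_iff subsetI)
  then show ?thesis using fin_sig by (meson finite_imageI finite_subset)
qed

text \<open>
  At least \<open>2 q\<close> labels prolong the top row, and they are equally likely; the value \<open>a\<close> fixes the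
  diagonal edge below the top row, whose line contains at most \<open>q\<close> of them.
\<close>

lemma cyl_half:
  assumes s: "tiling T s" and r: "r \<le> n"
    and B: "B \<subseteq> {\<omega> \<in> cyl (Suc m) (Suc n) s. al (F \<omega>) (Suc m) r = a}"
  shows "prob B \<le> prob (cyl (Suc m) (Suc n) s) / 2"
proof -
  let ?C = "cyl (Suc m) (Suc n) s"
  \<comment> \<open>The cylinder is split by the top label of the next column. By
    \<open>agree_Suc\<close> each nonempty part is again a cylinder, so all nonempty parts have the
    same probability \<open>c\<close>.\<close>
  define D where "D x = {\<omega> \<in> ?C. al (F \<omega>) (Suc m) (Suc n) = x}" for x
  define c where "c = prob (cyl (Suc (Suc m)) (Suc n) s)"
  have D_cyl: "D x = cyl (Suc (Suc m)) (Suc n) t"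
    if "tiling T t" "agree (Suc m) (Suc n) s t" "al t (Suc m) (Suc n) = x" for t x
  proof (intro equalityI subsetI)
    fix \<omega> assume *: "\<omega> \<in> D x"
    then have "agree (Suc m) (Suc n) t (F \<omega>)" "\<omega> \<in> space M"
      using agree_trans[OF agree_sym[OF that(2)]] by (auto simp: cyl_def D_def)
    then show "\<omega> \<in> cyl (Suc (Suc m)) (Suc n) t"
      using agree_Suc[OF that(1) F_tiling] that(3) * by (auto simp: cyl_def D_def)
  next
    fix \<omega> assume "\<omega> \<in> cyl (Suc (Suc m)) (Suc n) t"
    then have *: "agree (Suc (Suc m)) (Suc n) t (F \<omega>)" "\<omega> \<in> space M" by (auto simp: cyl_def D_def)
    then have "agree (Suc m) (Suc n) t (F \<omega>)" by (auto intro: agree_mono)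
    then show "\<omega> \<in> D x"
      using agree_trans[OF that(2)] * that(3) by (auto simp: cyl_def agree_def D_def)
  qed
  have D2: "D x \<in> sets M \<and> (D x = {} \<or> prob (D x) = c)" for x
  proof (cases "D x = {}")
    case False
    then obtain \<omega> where \<omega>: "\<omega> \<in> space M" "agree (Suc m) (Suc n) s (F \<omega>)" "al (F \<omega>) (Suc m) (Suc n) = x"
      by (auto simp: cyl_def D_def)
    show ?thesis
      using D_cyl[OF F_tiling[OF \<omega>(1)] \<omega>(2,3)] cyl_in_sets[OF F_tiling[OF \<omega>(1)]]
        cyl_eq[OF s F_tiling[OF \<omega>(1)], of "Suc (Suc m)" "Suc n"] by (simp add: c_def cyl_def)
  next
    case True
    then show ?thesis by simp
  qed
  have c0: "c \<ge> 0" by (simp add: c_def)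
  have Dc: "prob (D x) \<le> c" for x
  proof -
    consider "D x = {}" | "prob (D x) = c" using D2 by blast
    then show ?thesis by cases (use c0 in simp_all)
  qed
  let ?X = "{x \<in> P. \<not> A (al s m (Suc n)) x}"
  have X: "prob (D x) = c" if "x \<in> ?X" for x
  proof -
    from that obtain t where t: "tiling T t" "agree (Suc m) (Suc n) s t" "al t (Suc m) (Suc n) = x"
      using extend_right[OF s] by blast
    show ?thesis using D_cyl[OF t] cyl_eq[OF s t(1)] by (simp add: c_def cyl_def)
  qed
  let ?G = "{x. B \<inter> D x \<noteq> {}}"
  have G: "card ?G \<le> q \<and> finite ?G"
  proof (cases "B = {}")
    case False
    then obtain \<omega> where \<omega>: "\<omega> \<in> B" by blast
    \<comment> \<open>The line of \<open>e\<close> has q + 1 points; \<open>b\<close> is one of them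
      and cannot be the top label, which leaves q.\<close>
    define e where "e = ga (F \<omega>) (Suc m) n"
    define b where "b = be s (Suc m) n"
    have b: "be (F \<omega>') (Suc m) n = b" if "\<omega>' \<in> ?C" for \<omega>'
      using that by (auto simp: cyl_def agree_def b_def)
    have t\<omega>: "tiling T (F \<omega>)" using \<omega> B F_tiling by (auto simp: cyl_def)
    have eb: "A e b" using A_T(2)[OF tilingD(3)[OF t\<omega>]] b[of \<omega>] \<omega> B by (auto simp: e_def)
    have "A e x \<and> x \<noteq> b" if "x \<in> ?G" for x
    proof -
      from that obtain \<omega>' where \<omega>': "\<omega>' \<in> B" "al (F \<omega>') (Suc m) (Suc n) = x" by (auto simp: D_def)
      have t: "tiling T (F \<omega>')" using \<omega>' B F_tiling by (auto simp: cyl_def)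
      have "agree (Suc m) (Suc n) (F \<omega>) (F \<omega>')"
        using \<omega> \<omega>' B agree_sym agree_trans unfolding cyl_def by blast
      moreover have "al (F \<omega>) (Suc m) r = al (F \<omega>') (Suc m) r" using \<omega> \<omega>'(1) B by blast
      ultimately have "ga (F \<omega>') (Suc m) n = e"
        using agree_ga_top[OF t\<omega> t _ _ r] by (simp add: e_def)
      then show ?thesis
        using A_T(1)[OF tilingD(4)[OF t, of "Suc m" n]] tilingD(5)[OF t, of "Suc m" n] b[of \<omega>'] \<omega>' B by auto
    qed
    then have "?G \<subseteq> {x. A e x} - {b}" by blast
    moreover have "card ({x. A e x} - {b}) = q"
      using card_right[OF A_in(1)[OF eb]] eb by (simp add: card_Diff_singleton)
    moreover have "finite ({x. A e x} - {b})" using finite_A by simp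
    ultimately show ?thesis by (metis (no_types, lifting) card_mono finite_subset)
  qed auto
  have "B \<subseteq> (\<Union>x\<in>?G. D x)" using B by (auto simp: D_def)
  then have "prob B \<le> prob (\<Union>x\<in>?G. D x)"
    by (rule finite_measure_mono) (use D2 G in \<open>auto intro!: sets.finite_UN\<close>)
  also have "\<dots> \<le> (\<Sum>x\<in>?G. prob (D x))"
    by (rule finite_measure_subadditive_finite) (use D2 G in auto)
  also have "\<dots> \<le> (\<Sum>x\<in>?G. c)"
    by (rule sum_mono) (rule Dc)
  also have "\<dots> \<le> q * c" using G c0 by (simp add: mult_right_mono)
  finally have 1: "prob B \<le> q * c" .
  have fX: "finite ?X" using fin by simp
  have "real (2 * q) * c \<le> card ?X * c"
    using card_nonadj[of "al s m (Suc n)"] s c0 by (intro mult_right_mono) simp_all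
  also have "\<dots> = (\<Sum>x\<in>?X. prob (D x))" using X by simp
  also have "\<dots> = prob (\<Union>x\<in>?X. D x)"
    by (rule finite_measure_finite_Union[symmetric]) (use D2 fX in \<open>auto simp: disjoint_family_on_def D_def\<close>)
  also have "\<dots> \<le> prob ?C"
    by (rule finite_measure_mono) (use cyl_in_sets s in \<open>auto simp: D_def\<close>)
  finally show ?thesis using 1 by simp
qed

text \<open>The label in column \<open>i' + m\<close> is prescribed by one in the earlier column
  \<open>i + m\<close>, already known at that stage. Each column costs a factor of at least
  two.\<close>

lemma periodic_null:
  assumes E: "E \<in> sets M" "\<And>\<omega> m. \<omega> \<in> E \<Longrightarrow> al (F \<omega>) (i + m) j = al (F \<omega>) (i' + m) j'"
    and "i < i'"
  shows "E \<in> null_sets M"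
proof -
  \<comment> \<open>Both rows have index at most \<open>n\<close>, and the cylinders below have
    height \<open>Suc n\<close>; row \<open>j'\<close> thus stays strictly below the top row, as
    \<open>cyl_half\<close> requires.\<close>
  define n where "n = j + j'"
  define H where "H J = {\<omega> \<in> space M. \<forall>m<J. al (F \<omega>) (i + m) j = al (F \<omega>) (i' + m) j'}" for J
  let ?c = "\<lambda>J \<omega>. cyl (i' + J) (Suc n) (F \<omega>)"
  have H_cong: "\<omega>' \<in> H J" if "\<omega> \<in> H J" "\<omega>' \<in> ?c J \<omega>" for \<omega> \<omega>' J
    using that assms(3) unfolding H_def cyl_def agree_def by (auto simp: n_def)
  \<comment> \<open>\<open>H J\<close> depends only on the parallelogram of width
    \<open>i' + J\<close>, so it is a finite disjoint union of cylinders, to each of which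
    \<open>cyl_half\<close> applies.\<close>
  have H_Un: "H J = \<Union>(?c J ` H J)" for J
    using H_cong by (auto simp: cyl_def H_def)
  have H_fin: "finite (?c J ` H J)" for J
    by (rule finite_subset[OF _ finite_cyls]) (use F_tiling in \<open>auto simp: H_def\<close>)
  have c_sets: "?c J \<omega> \<in> sets M" if "\<omega> \<in> H J" for \<omega> J
    using that F_tiling cyl_in_sets by (auto simp: H_def)
  have H_sets: "H J \<in> sets M" for J
    by (subst H_Un, rule sets.finite_Union[OF H_fin]) (use c_sets in auto)
  have disj: "C \<inter> C' = {}" if CC: "C \<in> ?c J ` H J" "C' \<in> ?c J ` H J" "C \<noteq> C'" for C C' J
  proof (rule ccontr)
    assume "C \<inter> C' \<noteq> {}"
    moreover obtain \<omega>1 \<omega>2 where C: "C = ?c J \<omega>1" "C' = ?c J \<omega>2" using CC(1,2) by blast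
    ultimately obtain \<omega> where "\<omega> \<in> ?c J \<omega>1" "\<omega> \<in> ?c J \<omega>2" by blast
    then have "?c J \<omega>1 = ?c J \<omega>" "?c J \<omega>2 = ?c J \<omega>" using cyl_cong unfolding cyl_def by blast+
    then show False using C CC(3) by simp
  qed
  have half: "prob (H (Suc J)) \<le> prob (H J) / 2" for J
  proof -
    have part: "prob (H (Suc J) \<inter> C) \<le> prob C / 2" if "C \<in> ?c J ` H J" for C
    proof -
      from that obtain \<omega> where \<omega>: "\<omega> \<in> H J" "C = ?c J \<omega>" by blast
      have t: "tiling T (F \<omega>)" using \<omega> F_tiling by (simp add: H_def)
      \<comment> \<open>\<open>cyl_half\<close> needs a column to the left of the new one;
        \<open>i < i'\<close> provides it.\<close>
      obtain k where k: "i' + J = Suc k" using assms(3) by (cases "i' + J") auto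
      have "H (Suc J) \<inter> C \<subseteq> {\<omega>' \<in> C. al (F \<omega>') (i' + J) j' = al (F \<omega>) (i + J) j}"
      proof
        fix \<omega>' assume *: "\<omega>' \<in> H (Suc J) \<inter> C"
        then have "al (F \<omega>') (i + J) j = al (F \<omega>) (i + J) j"
          using assms(3) by (auto simp: \<omega> cyl_def agree_def n_def)
        then show "\<omega>' \<in> {\<omega>' \<in> C. al (F \<omega>') (i' + J) j' = al (F \<omega>) (i + J) j}"
          using * by (auto simp: H_def)
      qed
      then show ?thesis
        using cyl_half[OF t, of j' n "H (Suc J) \<inter> C" k] unfolding \<omega> k by (simp add: n_def)
    qed
    have "H (Suc J) \<subseteq> H J" by (auto simp: H_def)
    then have "H (Suc J) = (\<Union>C\<in>?c J ` H J. H (Suc J) \<inter> C)" using H_Un[of J] by blast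
    then have "prob (H (Suc J)) = prob (\<Union>C\<in>?c J ` H J. H (Suc J) \<inter> C)" by simp
    also have "\<dots> \<le> (\<Sum>C\<in>?c J ` H J. prob (H (Suc J) \<inter> C))"
      by (rule finite_measure_subadditive_finite[OF H_fin]) (use H_sets c_sets in auto)
    also have "\<dots> \<le> (\<Sum>C\<in>?c J ` H J. prob C / 2)" by (rule sum_mono) (rule part)
    also have "\<dots> = (\<Sum>C\<in>?c J ` H J. prob C) / 2" by (simp add: sum_divide_distrib)
    also have "(\<Sum>C\<in>?c J ` H J. prob C) = prob (\<Union>C\<in>?c J ` H J. C)"
      by (rule finite_measure_finite_Union[symmetric, OF H_fin])
        (use c_sets disj in \<open>auto simp: disjoint_family_on_def\<close>)
    also have "(\<Union>C\<in>?c J ` H J. C) = H J" using H_Un[of J] by simp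
    finally show ?thesis .
  qed
  have "prob (H J) \<le> (1 / 2) ^ J" for J
  proof (induction J)
    case (Suc J)
    then show ?case using half[of J] by simp
  qed simp
  moreover have "E \<subseteq> H J" for J using E sets.sets_into_space[OF E(1)] by (auto simp: H_def)
  ultimately have "prob E \<le> (1 / 2) ^ J" for J
    using finite_measure_mono[OF _ H_sets] by (meson order_trans)
  moreover have "(\<lambda>J. (1 / 2 :: real) ^ J) \<longlonglongrightarrow> 0" by (rule LIMSEQ_realpow_zero) simp_all
  ultimately have "prob E \<le> 0" by (intro LIMSEQ_le_const) auto
  then have "prob E = 0" using measure_nonneg[of M E] by linarith
  then show ?thesis using E(1) by (simp add: null_sets_def emeasure_eq_measure)
qed

end

subsection \<open>Words along a tiling\<close>

definition route :: "'p list \<Rightarrow> 'p list \<Rightarrow> 'p word" where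
  "route as bs = map (\<lambda>x. (x, True)) as @ map (\<lambda>x. (x, False)) bs"

text \<open>The path along the bottom row to column \<open>m\<close> and then up this column,
  against the orientation of its edges; hence the negative letters at the end.\<close>

definition corner :: "'p tiling \<Rightarrow> nat \<Rightarrow> nat \<Rightarrow> 'p word" where
  "corner s m n = route (map (\<lambda>i. al s i 0) [0..<m]) (map (be s m) [0..<n])"

declare moves.simps(2) [simp del]

lemma moves_single [simp]: "moves T [a] s t d \<longleftrightarrow> letter T a s t d"
  unfolding moves.simps by (metis right_minus_eq)

lemma moves_route_Cons:
  "moves T (route (a # as) bs) s t d \<longleftrightarrow>
    (\<exists>u e. letter T (a, True) s u e \<and> moves T (route as bs) u t (d - e))"
  "moves T (route [] (b # bs)) s t d \<longleftrightarrow>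
    (\<exists>u e. letter T (b, False) s u e \<and> moves T (route [] bs) u t (d - e))"
  by (simp_all add: route_def moves.simps(2) del: split_paired_Ex)

context triangle_system
begin

lemma corner_words [simp]: "tiling T s \<Longrightarrow> corner s m n \<in> words P"
  by (auto simp: corner_def route_def words_def)

lemma moves_snoc:
  "moves T w s u e \<Longrightarrow> letter T a u t d \<Longrightarrow> moves T (w @ [a]) s t (e + d)"
  unfolding moves_append by (intro exI[of _ u] exI[of _ e]) simp

lemma letter_al: "tiling T s \<Longrightarrow> letter T (al s 0 0, True) s (shift 1 0 s) (1, 0)"
  by (simp add: letter_def step.right[simplified])

lemma letter_be: "tiling T s \<Longrightarrow> letter T (be s 0 0, False) s (shift 0 1 s) (0, 1)"
  using step.down[of T s] by (simp add: letter_def)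

lemma moves_corner:
  assumes "tiling T s"
  shows "moves T (corner s m n) s (shift m n s) (int m, int n)"
proof (induction n)
  case 0
  show ?case
  proof (induction m)
    case 0
    show ?case by (simp add: corner_def route_def zero_prod_def)
  next
    case (Suc m)
    from moves_snoc[OF this letter_al[of "shift m 0 s"]] assms show ?case
      by (simp add: corner_def route_def add.commute)
  qed
next
  case (Suc n)
  from moves_snoc[OF this letter_be[of "shift m n s"]] assms show ?case
    by (simp add: corner_def route_def add.commute)
qed

lemma letter_disp:
  assumes "letter T (x, b) s t d"
  shows "b \<Longrightarrow> d \<in> {(1, 0), (0, -1), (-1, 1)}" "\<not> b \<Longrightarrow> d \<in> {(-1, 0), (0, 1), (1, -1)}"
proof -
  assume "b"
  then show "d \<in> {(1, 0), (0, -1), (-1, 1)}" using assms step_disp by (simp add: letter_def)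
next
  assume "\<not> b"
  then show "d \<in> {(-1, 0), (0, 1), (1, -1)}"
    using assms step_disp[of x t s "- d"] by (cases d) (simp add: letter_def)
qed

lemma letter_alD:
  assumes "letter T (x, True) s t (1, 0)"
  shows "x = al s 0 0 \<and> t = shift 1 0 s"
  using assms by (auto simp: letter_def elim: step.cases)

lemma letter_beD:
  assumes "letter T (x, False) s t (0, 1)"
  shows "x = be s 0 0 \<and> t = shift 0 1 s"
  using assms by (auto simp: letter_def elim: step.cases)

text \<open>The displacement of a move lies in the convex hull of the Weyl orbit of the pair of letter
  counts; both inequalities are equalities only along an unfolded path.\<close>

lemma moves_bound:
  "moves T w s t d \<Longrightarrow>
    2 * fst d + snd d \<le> 2 * int (length (filter snd w)) + int (length (filter (Not \<circ> snd) w)) \<and>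
    fst d + 2 * snd d \<le> int (length (filter snd w)) + 2 * int (length (filter (Not \<circ> snd) w))"
proof (induction w arbitrary: s d)
  case (Cons a w)
  then obtain u e where ue: "letter T a s u e" "moves T w u t (d - e)" unfolding moves.simps by blast
  obtain x b where a: "a = (x, b)" by (cases a)
  show ?case using Cons.IH[OF ue(2)] letter_disp[OF ue(1)[unfolded a]] by (cases b) (auto simp: a)
qed simp

lemma moves_route_bound:
  "moves T (route as bs) s t d \<Longrightarrow>
    2 * fst d + snd d \<le> 2 * int (length as) + int (length bs) \<and>
    fst d + 2 * snd d \<le> int (length as) + 2 * int (length bs)"
  by (drule moves_bound) (simp add: route_def filter_map o_def)

text \<open>As the bound is attained, every positive letter contributes (1, 0) and every negative
  one (0, 1). Letters with these displacements are labels of the tiling itself.\<close>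

lemma moves_route_max:
  assumes "moves T (route as bs) s t (int (length as), int (length bs))" "tiling T s"
  shows "(\<forall>i<length as. as ! i = al s i 0) \<and> (\<forall>j<length bs. bs ! j = be s (length as) j)"
  using assms
proof (induction as arbitrary: s)
  case Nil
  then show ?case
  proof (induction bs arbitrary: s)
    case (Cons b bs)
    then obtain u e where ue: "letter T (b, False) s u e"
      "moves T (route [] bs) u t ((0, int (Suc (length bs))) - e)"
      unfolding moves_route_Cons by auto
    then have "e = (0, 1)"
      using letter_disp(2)[OF ue(1)] moves_route_bound[OF ue(2)] by auto
    then have "b = be s 0 0" "u = shift 0 1 s" "moves T (route [] bs) u t (0, int (length bs))"
      using ue letter_beD by auto
    then show ?case using Cons.IH[of u] Cons.prems by (auto simp: less_Suc_eq_0_disj)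
  qed simp
next
  case (Cons a as)
  then obtain u e where ue: "letter T (a, True) s u e"
      "moves T (route as bs) u t ((int (Suc (length as)), int (length bs)) - e)"
    unfolding moves_route_Cons by auto
  then have "e = (1, 0)"
    using letter_disp(1)[OF ue(1)] moves_route_bound[OF ue(2)] by auto
  then have "a = al s 0 0" "u = shift 1 0 s"
    "moves T (route as bs) u t (int (length as), int (length bs))"
    using ue letter_alD by auto
  then show ?case using Cons.IH[of u] Cons.prems by (auto simp: less_Suc_eq_0_disj)
qed

text \<open>The columns are recovered from right to left: the right column and the bottom label of a
  strip determine the strip.\<close>

lemma agree_of_corner:
  assumes "tiling T s" "tiling T t" "\<And>i. i < m \<Longrightarrow> al s i 0 = al t i 0"
    "\<And>j. j < n \<Longrightarrow> be s m j = be t m j"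
  shows "agree m n s t"
proof -
  have be: "\<forall>j<n. be s i j = be t i j" if "i \<le> m" for i
    using that
  proof (induction rule: inc_induct)
    case (step i)
    then show ?case
      using strip_unique_upto(3)[OF tilingD(1)[OF assms(1), of i] tilingD(1)[OF assms(2), of i],
          where n = n] assms(3)[of i] by simp
  qed (use assms in simp)
  have "al s i j = al t i j" if "i < m" "j \<le> n" for i j
    by (rule strip_unique_upto(1)[OF tilingD(1)[OF assms(1)] tilingD(1)[OF assms(2)], where n = n])
      (use that assms(3) be[of "Suc i"] in auto)
  moreover have "ga s i j = ga t i j" if "i < m" "j < n" for i j
    by (rule strip_unique_upto(2)[OF tilingD(1)[OF assms(1)] tilingD(1)[OF assms(2)], where n = n])
      (use that assms(3) be[of "Suc i"] in auto)
  ultimately show ?thesis using be by (simp add: agree_def)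
qed

subsection \<open>Vertices of the building\<close>

abbreviation "G \<equiv> triangle_group P T"
abbreviation "gen \<equiv> generator P T"

definition cls :: "'p word \<Rightarrow> 'p word set" where
  "cls w = pres_cong P (relators T) `` {w}"

lemma G_eq: "G = presented_group P (relators T)"
  by (simp add: triangle_group_def relators_def)

sublocale G: group "triangle_group P T"
  unfolding G_eq by (rule group_presented_group)

lemma gen_eq: "gen x = cls [(x, True)]"
  by (simp add: generator_def cls_def relators_def)

lemma cls_mult: "u \<in> words P \<Longrightarrow> w \<in> words P \<Longrightarrow> cls u \<otimes>\<^bsub>G\<^esub> cls w = cls (u @ w)"
  by (simp add: G_eq cls_def presented_mult_class)

lemma one_eq: "\<one>\<^bsub>G\<^esub> = cls []"
  by (simp add: G_eq presented_group_def cls_def)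

lemma carrier_iff: "g \<in> carrier G \<longleftrightarrow> (\<exists>w\<in>words P. g = cls w)"
  by (auto simp: G_eq presented_group_def cls_def quotient_def)

lemma cls_carrier [simp]: "w \<in> words P \<Longrightarrow> cls w \<in> carrier G"
  by (auto simp: carrier_iff)

lemma gen_carrier [simp]: "x \<in> P \<Longrightarrow> gen x \<in> carrier G"
  by (simp add: gen_eq)

lemma cls_eq_iff:
  "u \<in> words P \<Longrightarrow> w \<in> words P \<Longrightarrow> cls u = cls w \<longleftrightarrow> (u, w) \<in> pres_cong P (relators T)"
  unfolding cls_def by (rule eq_equiv_class_iff[OF equiv_pres_cong])

lemma cls_moves:
  "cls u = cls w \<Longrightarrow> u \<in> words P \<Longrightarrow> w \<in> words P \<Longrightarrow> tiling T s \<Longrightarrow>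
    moves T u s t d \<longleftrightarrow> moves T w s t d"
  using cls_eq_iff moves_cong by blast

lemma gen_inv: "x \<in> P \<Longrightarrow> inv\<^bsub>G\<^esub> gen x = cls [(x, False)]"
proof (rule G.inv_equality)
  assume x: "x \<in> P"
  have "cls [(x, False), (x, True)] = cls []"
    using pres_cong.cancel[of "[]" P "[]" x False "relators T"] x by (simp add: cls_eq_iff)
  then show "cls [(x, False)] \<otimes>\<^bsub>G\<^esub> gen x = \<one>\<^bsub>G\<^esub>"
    using x by (simp add: gen_eq cls_mult one_eq)
qed simp_all

lemma gen_relation: "(x, y, z) \<in> T \<Longrightarrow> gen x \<otimes>\<^bsub>G\<^esub> gen y \<otimes>\<^bsub>G\<^esub> gen z = \<one>\<^bsub>G\<^esub>"
proof -
  assume T: "(x, y, z) \<in> T"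
  note P = T_in[OF T]
  have "[(x, True), (y, True), (z, True)] \<in> relators T" using T by (auto simp: relators_def)
  then have "cls [(x, True), (y, True), (z, True)] = cls []"
    using pres_cong.relator[of "[]" P "[]" "[(x, True), (y, True), (z, True)]" "relators T"] P
    by (simp add: cls_eq_iff)
  then show ?thesis using P by (simp add: gen_eq cls_mult one_eq)
qed

lemma triangle_mult:
  assumes "(x, y, z) \<in> T" "g \<in> carrier G"
  shows "g \<otimes>\<^bsub>G\<^esub> gen x \<otimes>\<^bsub>G\<^esub> gen y = g \<otimes>\<^bsub>G\<^esub> inv\<^bsub>G\<^esub> gen z"
    "g \<otimes>\<^bsub>G\<^esub> gen x \<otimes>\<^bsub>G\<^esub> gen y \<otimes>\<^bsub>G\<^esub> gen z = g"
proof -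
  note P = T_in[OF assms(1)]
  have "gen x \<otimes>\<^bsub>G\<^esub> gen y = inv\<^bsub>G\<^esub> gen z"
    using gen_relation[OF assms(1)] P by (metis G.inv_equality G.m_closed G.inv_inv gen_carrier G.inv_closed)
  then show "g \<otimes>\<^bsub>G\<^esub> gen x \<otimes>\<^bsub>G\<^esub> gen y = g \<otimes>\<^bsub>G\<^esub> inv\<^bsub>G\<^esub> gen z"
    using P assms(2) by (simp add: G.m_assoc)
  then show "g \<otimes>\<^bsub>G\<^esub> gen x \<otimes>\<^bsub>G\<^esub> gen y \<otimes>\<^bsub>G\<^esub> gen z = g"
    using P assms(2) by (simp add: G.m_assoc)
qed

text \<open>Every label is the first horizontal label of some tiling and moves it by (1, 0); no
  other positive letter does so.\<close>

lemma gen_inject: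
  assumes "gen x = gen y" "x \<in> P" "y \<in> P"
  shows "x = y"
proof -
  obtain b where "A b x" using ex_left assms(2) by blast
  then obtain s where s: "tiling T s" "al s 0 0 = x" using tiling_exists by blast
  then have "moves T [(x, True)] s (shift 1 0 s) (1, 0)"
    using letter_al[OF s(1)] by simp
  then have "moves T [(y, True)] s (shift 1 0 s) (1, 0)"
    using cls_moves[of "[(x, True)]" "[(y, True)]"] assms s by (simp add: gen_eq)
  then have "letter T (y, True) s (shift 1 0 s) (1, 0)" by auto
  then show ?thesis using letter_alD s(2) by blast
qed

lemma ex_tiling: "\<exists>s. tiling T s"
proof -
  obtain x b where "A b x" using ne ex_left by blast
  then show ?thesis using tiling_exists by blast
qed

lemma gen_ne_one: "x \<in> P \<Longrightarrow> gen x \<noteq> \<one>\<^bsub>G\<^esub>"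
proof
  assume x: "x \<in> P" and "gen x = \<one>\<^bsub>G\<^esub>"
  obtain s where s: "tiling T s" using ex_tiling by blast
  have "moves T [(x, True)] s s 0 \<longleftrightarrow> moves T [] s s 0"
    by (rule cls_moves) (use x \<open>gen x = _\<close> s in \<open>simp_all add: gen_eq one_eq\<close>)
  then show False using letter_disp(1)[of x True s s 0] by (auto simp: zero_prod_def)
qed

text \<open>Two displacements of positive letters never add up to zero. This is why no edge of the
  building is oriented both ways.\<close>

lemma gen_gen_ne_one: "x \<in> P \<Longrightarrow> y \<in> P \<Longrightarrow> gen x \<otimes>\<^bsub>G\<^esub> gen y \<noteq> \<one>\<^bsub>G\<^esub>"
proof
  assume x: "x \<in> P" "y \<in> P" and "gen x \<otimes>\<^bsub>G\<^esub> gen y = \<one>\<^bsub>G\<^esub>"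
  obtain s where s: "tiling T s" using ex_tiling by blast
  have "moves T [(x, True), (y, True)] s s 0 \<longleftrightarrow> moves T [] s s 0"
    by (rule cls_moves) (use x \<open>_ = \<one>\<^bsub>G\<^esub>\<close> s in \<open>simp_all add: gen_eq one_eq cls_mult\<close>)
  then obtain t d where "letter T (x, True) s t d" "letter T (y, True) t s (- d)"
    unfolding moves.simps by (metis diff_0 right_minus_eq)
  from letter_disp(1)[OF this(1)] letter_disp(1)[OF this(2)] show False by auto
qed

definition vert :: "'p word set \<Rightarrow> 'p tiling \<Rightarrow> nat \<Rightarrow> nat \<Rightarrow> 'p word set" where
  "vert v s m n = v \<otimes>\<^bsub>G\<^esub> cls (corner s m n)"

lemma vert_carrier [simp]: "v \<in> carrier G \<Longrightarrow> tiling T s \<Longrightarrow> vert v s m n \<in> carrier G"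
  by (simp add: vert_def)

lemma vert_0 [simp]: "v \<in> carrier G \<Longrightarrow> vert v s 0 0 = v"
  by (simp add: vert_def corner_def route_def one_eq[symmetric])

lemma vert_be':
  assumes "v \<in> carrier G" "tiling T s"
  shows "vert v s m (Suc n) = vert v s m n \<otimes>\<^bsub>G\<^esub> inv\<^bsub>G\<^esub> gen (be s m n)"
proof -
  have "corner s m (Suc n) = corner s m n @ [(be s m n, False)]"
    by (simp add: corner_def route_def)
  then show ?thesis using assms by (simp add: vert_def cls_mult[symmetric] gen_inv G.m_assoc)
qed

text \<open>A vertex is defined through one path only. The other edges are reached by climbing: the
  upper triangle of a cell turns the diagonal into the next horizontal edge.\<close>

lemma vert_edges:
  assumes "v \<in> carrier G" "tiling T s"
  shows "vert v s (Suc m) n = vert v s m n \<otimes>\<^bsub>G\<^esub> gen (al s m n)"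
    "vert v s m (Suc n) = vert v s (Suc m) n \<otimes>\<^bsub>G\<^esub> gen (ga s m n)"
    "vert v s m n = vert v s m (Suc n) \<otimes>\<^bsub>G\<^esub> gen (be s m n)"
proof -
  note D = tilingD(3,4)[OF assms(2)]
  show "vert v s m n = vert v s m (Suc n) \<otimes>\<^bsub>G\<^esub> gen (be s m n)" for m n
    using assms by (simp add: vert_be' G.m_assoc)
  have ga: "vert v s m (Suc n) = vert v s (Suc m) n \<otimes>\<^bsub>G\<^esub> gen (ga s m n)"
    if "vert v s (Suc m) n = vert v s m n \<otimes>\<^bsub>G\<^esub> gen (al s m n)" for n
    using that triangle_mult(1)[OF D(1)[of m n], of "vert v s m n"] assms by (simp add: vert_be')
  show al: "vert v s (Suc m) n = vert v s m n \<otimes>\<^bsub>G\<^esub> gen (al s m n)" for n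
  proof (induction n)
    case 0
    have "corner s (Suc m) 0 = corner s m 0 @ [(al s m 0, True)]"
      by (simp add: corner_def route_def)
    then show ?case using assms by (simp add: vert_def cls_mult[symmetric] gen_eq G.m_assoc)
  next
    case (Suc n)
    from ga[OF this] show ?case
      using triangle_mult(1)[OF D(2)[of m n], of "vert v s (Suc m) n"] assms by (simp add: vert_be')
  qed
  then show "vert v s m (Suc n) = vert v s (Suc m) n \<otimes>\<^bsub>G\<^esub> gen (ga s m n)" using ga by blast
qed

lemma vert_eqI:
  assumes "v \<in> carrier G" "tiling T s" "f 0 0 = v"
    "\<And>m. f (Suc m) 0 = f m 0 \<otimes>\<^bsub>G\<^esub> gen (al s m 0)"
    "\<And>m n. f m n = f m (Suc n) \<otimes>\<^bsub>G\<^esub> gen (be s m n)"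
    "\<And>m n. f m n \<in> carrier G"
  shows "f m n = vert v s m n"
proof (induction n)
  case 0
  show ?case by (induction m) (use assms(1-4) vert_edges(1)[OF assms(1,2)] in auto)
next
  case (Suc n)
  then have "f m (Suc n) \<otimes>\<^bsub>G\<^esub> gen (be s m n) = vert v s m (Suc n) \<otimes>\<^bsub>G\<^esub> gen (be s m n)"
    using assms(5)[of m n] vert_edges(3)[OF assms(1,2), of m n] by simp
  then show ?case using assms(1,2,6) by simp
qed

lemma vert_shift:
  assumes "v \<in> carrier G" "tiling T s"
  shows "vert (vert v s i j) (shift i j s) m n = vert v s (i + m) (j + n)"
proof (rule vert_eqI[symmetric, where f = "\<lambda>m n. vert v s (i + m) (j + n)"])
  show "vert v s (i + m) (j + n) =
      vert v s (i + m) (j + Suc n) \<otimes>\<^bsub>G\<^esub> gen (be (shift i j s) m n)" for m n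
    using vert_edges(3)[OF assms, of "i + m" "j + n"] by simp
qed (use vert_edges(1)[OF assms] assms in simp_all)

lemma vert_left_mult:
  assumes "v \<in> carrier G" "tiling T s" "g \<in> carrier G"
  shows "vert (g \<otimes>\<^bsub>G\<^esub> v) s m n = g \<otimes>\<^bsub>G\<^esub> vert v s m n"
  using assms by (simp add: vert_def G.m_assoc)

text \<open>Both words represent the same element, so each may be applied to the other tiling; the
  bounds in both directions give equal coordinates. The bound is then attained, so the word of
  \<open>s\<close> spells the bottom row and right column of \<open>t\<close>, which fix the
  parallelogram.\<close>

lemma vert_unique:
  assumes "v \<in> carrier G" "tiling T s" "tiling T t" "vert v s m n = vert v t m' n'"
  shows "m = m' \<and> n = n' \<and> agree m n s t"
proof -
  have c: "cls (corner s m n) = cls (corner t m' n')"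
    using assms by (simp add: vert_def)
  have 1: "moves T (corner s m n) t (shift m' n' t) (int m', int n')"
    using cls_moves[OF c corner_words[OF assms(2)] corner_words[OF assms(3)] assms(3)]
      moves_corner[OF assms(3)] by blast
  have 2: "moves T (corner t m' n') s (shift m n s) (int m, int n)"
    using cls_moves[OF c corner_words[OF assms(2)] corner_words[OF assms(3)] assms(2)]
      moves_corner[OF assms(2)] by blast
  have eq: "m = m'" "n = n'"
    using moves_route_bound[OF 1[unfolded corner_def]] moves_route_bound[OF 2[unfolded corner_def]]
    by auto
  have "(\<forall>i<m. al s i 0 = al t i 0) \<and> (\<forall>j<n. be s m j = be t m j)"
    using moves_route_max[of "map (\<lambda>i. al s i 0) [0..<m]" "map (be s m) [0..<n]" t] 1 assms(3)
    by (simp add: corner_def eq)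
  then show ?thesis using eq agree_of_corner assms by blast
qed

subsection \<open>Tails of tilings\<close>

text \<open>Equivalence of sectors in terms of labels: a common subsector is a common vertex from
  which both tilings look the same.\<close>

definition tail_eq :: "'p word set \<Rightarrow> 'p tiling \<Rightarrow> 'p word set \<Rightarrow> 'p tiling \<Rightarrow> bool" where
  "tail_eq v s w t \<longleftrightarrow> (\<exists>i j i' j'. vert v s i j = vert w t i' j' \<and> shift i j s = shift i' j' t)"

lemma tail_eq_refl: "tail_eq v s v s"
  by (auto simp: tail_eq_def)

lemma tail_eq_sym: "tail_eq v s w t \<Longrightarrow> tail_eq w t v s"
  unfolding tail_eq_def by metis

lemma tail_shift:
  assumes "v \<in> carrier G" "w \<in> carrier G" "tiling T s" "tiling T t"
    "vert v s i j = vert w t i' j'" "shift i j s = shift i' j' t"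
  shows "vert v s (i + m) (j + n) = vert w t (i' + m) (j' + n)"
    "shift (i + m) (j + n) s = shift (i' + m) (j' + n) t"
proof -
  show "vert v s (i + m) (j + n) = vert w t (i' + m) (j' + n)"
    using vert_shift[OF assms(1,3), of i j m n] vert_shift[OF assms(2,4), of i' j' m n] assms(5,6)
    by simp
  show "shift (i + m) (j + n) s = shift (i' + m) (j' + n) t"
    using arg_cong[OF assms(6), of "shift m n"] by simp
qed

lemma tail_eq_trans:
  assumes "v \<in> carrier G" "w \<in> carrier G" "u \<in> carrier G" "tiling T s" "tiling T t" "tiling T r"
    "tail_eq v s w t" "tail_eq w t u r"
  shows "tail_eq v s u r"
proof -
  from assms(7) obtain i j i' j' where 1: "vert v s i j = vert w t i' j'" "shift i j s = shift i' j' t"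
    by (auto simp: tail_eq_def)
  from assms(8) obtain k l k' l' where 2: "vert w t k l = vert u r k' l'" "shift k l t = shift k' l' r"
    by (auto simp: tail_eq_def)
  \<comment> \<open>Both common subsectors are pushed to the same position
    \<open>(i' + k, j' + l)\<close> of \<open>t\<close>.\<close>
  have "vert v s (i + k) (j + l) = vert u r (k' + i') (l' + j')"
    "shift (i + k) (j + l) s = shift (k' + i') (l' + j') r"
    using tail_shift[OF assms(1,2,4,5) 1, of k l] tail_shift[OF assms(2,3,5,6) 2, of i' j']
    by (simp_all add: add.commute)
  then show ?thesis unfolding tail_eq_def by blast
qed

lemma agree_all_eq:
  assumes "\<And>m n. agree m n s t"
  shows "s = t"
proof -
  have "al s m n = al t m n \<and> be s m n = be t m n \<and> ga s m n = ga t m n" for m n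
    using assms[of "Suc m" "Suc n"] by (simp add: agree_def)
  then show ?thesis by (intro tiling_eqI) simp_all
qed

text \<open>The vertices of the common tail determine, by \<open>vert_unique\<close>, arbitrarily
  large parallelograms at \<open>v\<close>.\<close>

lemma tail_eq_unique:
  assumes "v \<in> carrier G" "tiling T s" "tiling T t" "tail_eq v s v t"
  shows "s = t"
proof -
  from assms(4) obtain i j i' j' where 1: "vert v s i j = vert v t i' j'" "shift i j s = shift i' j' t"
    by (auto simp: tail_eq_def)
  have ag: "agree (i + m) (j + n) s t" for m n
    using vert_unique[OF assms(1-3) tail_shift(1)[OF assms(1,1,2,3) 1]] by blast
  have "agree m n s t" for m n by (rule agree_mono[OF ag[of m n]]) simp_all
  then show ?thesis by (rule agree_all_eq)
qed

lemma tail_eq_step: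
  assumes "v \<in> carrier G" "step T x s t d"
  shows "tail_eq v s (v \<otimes>\<^bsub>G\<^esub> gen x) t"
proof -
  have x: "x \<in> P" using step_in[OF assms(2)] .
  show ?thesis using assms(2)
  proof cases
    case right
    have "vert v s 1 0 = vert (v \<otimes>\<^bsub>G\<^esub> gen x) t 0 0"
      using vert_edges(1)[OF assms(1) right(4), of 0 0] assms(1) x right(1) by simp
    then show ?thesis unfolding tail_eq_def using right by (metis shift_0)
  next
    case down
    have "vert v s 0 0 = vert (v \<otimes>\<^bsub>G\<^esub> gen x) t 0 1"
      using vert_be'[OF _ down(4), of "v \<otimes>\<^bsub>G\<^esub> gen x" 0 0] assms(1) x down(1) by (simp add: G.m_assoc)
    then show ?thesis unfolding tail_eq_def using down by (metis shift_0)
  next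
    case diag
    have "vert v s 0 1 = vert (v \<otimes>\<^bsub>G\<^esub> gen x) t 1 0"
      using vert_be'[OF assms(1) diag(2), of 0 0] vert_edges(1)[OF _ diag(3), of "v \<otimes>\<^bsub>G\<^esub> gen x" 0 0]
        triangle_mult(1)[OF diag(5) assms(1)] assms(1) x by simp
    then show ?thesis unfolding tail_eq_def using diag(4) by metis
  qed
qed

lemma tail_eq_letter:
  assumes "v \<in> carrier G" "fst a \<in> P" "tiling T s"
  shows "\<exists>t. tiling T t \<and> tail_eq v s (v \<otimes>\<^bsub>G\<^esub> cls [a]) t"
proof -
  obtain x b where a: "a = (x, b)" by (cases a)
  obtain t d where td: "letter T a s t d" using letter_total[OF assms(3,2)] by blast
  have t: "tiling T t" using letter_tiling[OF td] by simp
  show ?thesis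
  proof (cases b)
    case True
    then show ?thesis using tail_eq_step[OF assms(1), of x s t d] td t by (auto simp: a letter_def gen_eq)
  next
    case False
    then have "step T x t s (- d)" using td by (simp add: a letter_def)
    from tail_eq_step[OF _ this, of "v \<otimes>\<^bsub>G\<^esub> cls [a]"] show ?thesis
      using t False assms by (auto simp: a gen_inv[symmetric] G.m_assoc intro: tail_eq_sym)
  qed
qed

text \<open>The base point is moved along a word for the inverse of \<open>v\<close> times
  \<open>w\<close>, one letter at a time; a single step keeps the tail.\<close>

lemma rebase:
  assumes "v \<in> carrier G" "w \<in> carrier G" "tiling T s"
  shows "\<exists>t. tiling T t \<and> tail_eq v s w t"
proof -
  have "\<exists>t. tiling T t \<and> tail_eq v s (v \<otimes>\<^bsub>G\<^esub> cls u) t" if "u \<in> words P" "v \<in> carrier G" "tiling T s" for u v s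
    using that
  proof (induction u arbitrary: v s)
    case Nil
    then show ?case using tail_eq_refl by (auto simp: one_eq[symmetric])
  next
    case (Cons a u)
    have a: "fst a \<in> P" "u \<in> words P" using Cons.prems by simp_all
    then obtain t where t: "tiling T t" "tail_eq v s (v \<otimes>\<^bsub>G\<^esub> cls [a]) t" using tail_eq_letter Cons.prems by blast
    have c: "v \<otimes>\<^bsub>G\<^esub> cls [a] \<in> carrier G" using a Cons.prems by simp
    obtain r where r: "tiling T r" "tail_eq (v \<otimes>\<^bsub>G\<^esub> cls [a]) t (v \<otimes>\<^bsub>G\<^esub> cls [a] \<otimes>\<^bsub>G\<^esub> cls u) r"
      using Cons.IH[OF a(2) c t(1)] by blast
    have "v \<otimes>\<^bsub>G\<^esub> cls [a] \<otimes>\<^bsub>G\<^esub> cls u = v \<otimes>\<^bsub>G\<^esub> cls (a # u)"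
      using a Cons.prems cls_mult[of "[a]" u] by (simp add: G.m_assoc)
    moreover have "v \<otimes>\<^bsub>G\<^esub> cls (a # u) \<in> carrier G" using Cons.prems by simp
    ultimately show ?case
      using tail_eq_trans[OF _ c _ _ t(1) r(1) t(2)] r Cons.prems by auto
  qed
  moreover obtain u where "u \<in> words P" "inv\<^bsub>G\<^esub> v \<otimes>\<^bsub>G\<^esub> w = cls u"
    using assms carrier_iff[of "inv\<^bsub>G\<^esub> v \<otimes>\<^bsub>G\<^esub> w"] by auto
  moreover from this have "v \<otimes>\<^bsub>G\<^esub> cls u = w"
    using assms by (metis G.inv_solve_left G.inv_closed G.m_closed)
  ultimately show ?thesis using assms by metis
qed

end

subsection \<open>The Coxeter complex\<close>

text \<open>The ordered pairs of unit vectors that span a chamber, as quadruples of coordinates.\<close>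

definition unit_pairs :: "(int \<times> int \<times> int \<times> int) set" where
  "unit_pairs = {(1, 0, 0, 1), (0, 1, 1, 0), (-1, 0, -1, 1), (-1, 1, -1, 0), (0, -1, 1, -1),
     (1, -1, 0, -1), (-1, 1, 0, 1), (0, 1, -1, 1), (1, -1, 1, 0), (1, 0, 1, -1), (0, -1, -1, 0),
     (-1, 0, 0, -1)}"

lemma unit_pairs_chamber:
  assumes "(a1, a2, b1, b2) \<in> unit_pairs"
  shows "{(i, j), (i + a1, j + a2), (i + b1, j + b2)} \<in> coxeter_chambers"
proof -
  have U: "{(i, j), (i + 1, j), (i, j + 1)} \<in> coxeter_chambers" for i j
    unfolding coxeter_chambers_def by blast
  have V: "{(i + 1, j), (i, j + 1), (i + 1, j + 1)} \<in> coxeter_chambers" for i j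
    unfolding coxeter_chambers_def by blast
  show ?thesis
    using assms U[of i j] U[of "i - 1" j] U[of i "j - 1"] V[of "i - 1" j] V[of i "j - 1"]
      V[of "i - 1" "j - 1"]
    unfolding unit_pairs_def by (auto simp: insert_commute)
qed

lemma triple_eq:
  assumes "{p, a, b} = {x, y, z}" "x \<noteq> y" "y \<noteq> z" "x \<noteq> z"
  shows "p = x \<and> a = y \<and> b = z \<or> p = x \<and> a = z \<and> b = y \<or> p = y \<and> a = x \<and> b = z \<or>
    p = y \<and> a = z \<and> b = x \<or> p = z \<and> a = x \<and> b = y \<or> p = z \<and> a = y \<and> b = x"
proof -
  have "p \<in> {x, y, z}" "a \<in> {x, y, z}" "b \<in> {x, y, z}" "x \<in> {p, a, b}" "y \<in> {p, a, b}" "z \<in> {p, a, b}"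
    using assms(1) by blast+
  then show ?thesis using assms(2-4) unfolding insert_iff empty_iff by metis
qed

lemma chamber_unit_pairs:
  assumes "{(p1, p2), (a1, a2), (b1, b2)} \<in> coxeter_chambers"
  shows "(a1 - p1, a2 - p2, b1 - p1, b2 - p2) \<in> unit_pairs"
proof -
  from assms obtain i j where
    "{(p1, p2), (a1, a2), (b1, b2)} = {(i, j), (i + 1, j), (i, j + 1)} \<or>
     {(p1, p2), (a1, a2), (b1, b2)} = {(i + 1, j), (i, j + 1), (i + 1, j + 1)}"
    unfolding coxeter_chambers_def by blast
  then show ?thesis
  proof
    assume "{(p1, p2), (a1, a2), (b1, b2)} = {(i, j), (i + 1, j), (i, j + 1)}"
    from triple_eq[OF this, simplified] show ?thesis unfolding unit_pairs_def by (elim disjE) simp_all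
  next
    assume "{(p1, p2), (a1, a2), (b1, b2)} = {(i + 1, j), (i, j + 1), (i + 1, j + 1)}"
    from triple_eq[OF this, simplified] show ?thesis unfolding unit_pairs_def by (elim disjE) simp_all
  qed
qed

text \<open>The affine map that sends the origin to \<open>p\<close> and the basis vectors to
  \<open>p + a\<close> and \<open>p + b\<close>. For pairs from \<open>unit_pairs\<close> these are
  symmetries of the tessellation.\<close>

definition aff :: "int \<times> int \<Rightarrow> int \<times> int \<Rightarrow> int \<times> int \<Rightarrow> int \<times> int \<Rightarrow> int \<times> int" where
  "aff p a b x = (fst p + fst x * fst a + snd x * fst b, snd p + fst x * snd a + snd x * snd b)"

text \<open>The second kind of triangle is viewed from its vertex \<open>(i + 1, j + 1)\<close> with
  both vectors negated; \<open>unit_pairs\<close> is closed under this.\<close>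

lemma aff_chamber:
  assumes "(a1, a2, b1, b2) \<in> unit_pairs" "c \<in> coxeter_chambers"
  shows "aff p (a1, a2) (b1, b2) ` c \<in> coxeter_chambers"
proof -
  let ?A = "aff p (a1, a2) (b1, b2)"
  have neg: "(- a1, - a2, - b1, - b2) \<in> unit_pairs" using assms(1) unfolding unit_pairs_def by auto
  from assms(2) obtain i j where
    "c = {(i, j), (i + 1, j), (i, j + 1)} \<or> c = {(i + 1, j), (i, j + 1), (i + 1, j + 1)}"
    unfolding coxeter_chambers_def by blast
  then show ?thesis
  proof
    assume "c = {(i, j), (i + 1, j), (i, j + 1)}"
    then have "?A ` c = {(fst (?A (i, j)), snd (?A (i, j))),
        (fst (?A (i, j)) + a1, snd (?A (i, j)) + a2), (fst (?A (i, j)) + b1, snd (?A (i, j)) + b2)}"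
      by (simp add: aff_def algebra_simps)
    then show ?thesis using unit_pairs_chamber[OF assms(1)] by metis
  next
    let ?q = "?A (i + 1, j + 1)"
    assume "c = {(i + 1, j), (i, j + 1), (i + 1, j + 1)}"
    then have "?A ` c = {(fst ?q, snd ?q), (fst ?q + - a1, snd ?q + - a2), (fst ?q + - b1, snd ?q + - b2)}"
      by (auto simp: aff_def algebra_simps)
    then show ?thesis using unit_pairs_chamber[OF neg] by metis
  qed
qed

lemma coxeter_complex_image:
  assumes "\<And>c. c \<in> coxeter_chambers \<Longrightarrow> h ` c \<in> coxeter_chambers" "\<sigma> \<in> coxeter_complex"
  shows "h ` \<sigma> \<in> coxeter_complex"
  using assms unfolding coxeter_complex_def complex_of_def by (blast intro: image_mono)

lemma aff_complex:
  assumes "(a1, a2, b1, b2) \<in> unit_pairs"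
  shows "aff p (a1, a2) (b1, b2) ` \<sigma> \<in> coxeter_complex \<longleftrightarrow> \<sigma> \<in> coxeter_complex"
proof
  let ?A = "aff p (a1, a2) (b1, b2)"
  define e where "e = a1 * b2 - a2 * b1"
  \<comment> \<open>The inverse matrix. Its determinant is 1 or -1, so multiplication by
    \<open>e\<close> stands for division by it.\<close>
  define c1 c2 d1 d2 where "c1 = e * b2" "c2 = - e * a2" "d1 = - e * b1" "d2 = e * a1"
  have cd: "(c1, c2, d1, d2) \<in> unit_pairs" and e2: "e = 1 \<or> e = -1"
    using assms unfolding unit_pairs_def insert_iff empty_iff
    by (elim disjE FalseE; simp add: c1_c2_d1_d2_def e_def)+
  define r where "r = (- (fst p * c1 + snd p * d1), - (fst p * c2 + snd p * d2))"
  let ?B = "aff r (c1, c2) (d1, d2)"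
  have "e * e = 1" using e2 by auto
  have BA: "?B (?A x) = x" for x
  proof -
    have "fst (?B (?A x)) = e * e * fst x" "snd (?B (?A x)) = e * e * snd x"
      unfolding aff_def r_def c1_c2_d1_d2_def e_def by (simp_all add: algebra_simps)
    then show ?thesis using \<open>e * e = 1\<close> by (simp add: prod_eq_iff)
  qed
  show "\<sigma> \<in> coxeter_complex" if "?A ` \<sigma> \<in> coxeter_complex"
  proof -
    have "?B ` ?A ` \<sigma> \<in> coxeter_complex"
      by (rule coxeter_complex_image[OF _ that]) (rule aff_chamber[OF cd])
    then show ?thesis using BA by (simp add: image_image)
  qed
qed (rule coxeter_complex_image[OF aff_chamber[OF assms]])

definition quadrant :: "(int \<times> int) set" where
  "quadrant = {(i, j). 0 \<le> i \<and> 0 \<le> j}"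

text \<open>\<open>nat\<close> collapses points outside the quadrant, but \<open>sec\<close>
  evaluates the function on subsets of the quadrant only.\<close>

definition on_quadrant :: "(nat \<Rightarrow> nat \<Rightarrow> 'a) \<Rightarrow> int \<times> int \<Rightarrow> 'a" where
  "on_quadrant f x = f (nat (fst x)) (nat (snd x))"

definition sec :: "(nat \<Rightarrow> nat \<Rightarrow> 'a) \<Rightarrow> 'a set set" where
  "sec f = (`) (on_quadrant f) ` (coxeter_complex \<inter> Pow quadrant)"

lemma cone_sec:
  assumes "{p, a, b} \<in> coxeter_chambers"
  shows "(`) \<phi> ` (coxeter_complex \<inter> Pow (cone p a b)) = sec (\<lambda>m n. \<phi> (cone_point p a b m n))"
proof -
  define a1 a2 b1 b2 where d: "a1 = fst a - fst p" "a2 = snd a - snd p" "b1 = fst b - fst p"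
    "b2 = snd b - snd p"
  let ?A = "aff p (a1, a2) (b1, b2)"
  have u: "(a1, a2, b1, b2) \<in> unit_pairs"
    using chamber_unit_pairs[of "fst p" "snd p" "fst a" "snd a" "fst b" "snd b"] assms by (simp add: d)
  have A: "?A x = cone_point p a b (nat (fst x)) (nat (snd x))" if "x \<in> quadrant" for x
    using that by (auto simp: quadrant_def aff_def cone_point_def d)
  have cone: "cone p a b = ?A ` quadrant"
  proof
    show "cone p a b \<subseteq> ?A ` quadrant"
    proof
      fix x assume "x \<in> cone p a b"
      then obtain m n where "x = cone_point p a b m n" by (auto simp: cone_def)
      then have "x = ?A (int m, int n)" "(int m, int n) \<in> quadrant"
        using A[of "(int m, int n)"] by (auto simp: quadrant_def)
      then show "x \<in> ?A ` quadrant" by blast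
    qed
  qed (use A in \<open>auto simp: cone_def\<close>)
  have "coxeter_complex \<inter> Pow (cone p a b) = (`) ?A ` (coxeter_complex \<inter> Pow quadrant)"
  proof
    show "coxeter_complex \<inter> Pow (cone p a b) \<subseteq> (`) ?A ` (coxeter_complex \<inter> Pow quadrant)"
    proof
      fix \<sigma> assume \<sigma>: "\<sigma> \<in> coxeter_complex \<inter> Pow (cone p a b)"
      then obtain \<tau> where "\<tau> \<subseteq> quadrant" "\<sigma> = ?A ` \<tau>"
        unfolding cone by (auto simp: subset_image_iff)
      then show "\<sigma> \<in> (`) ?A ` (coxeter_complex \<inter> Pow quadrant)"
        using aff_complex[OF u] \<sigma> by auto
    qed
  qed (use aff_complex[OF u, of p] in \<open>auto simp: cone\<close>)
  then have "(`) \<phi> ` (coxeter_complex \<inter> Pow (cone p a b)) =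
      (\<lambda>\<sigma>. \<phi> ` ?A ` \<sigma>) ` (coxeter_complex \<inter> Pow quadrant)"
    by (simp add: image_image)
  also have "\<dots> = sec (\<lambda>m n. \<phi> (cone_point p a b m n))"
    unfolding sec_def
  proof (rule image_cong)
    fix \<sigma> assume "\<sigma> \<in> coxeter_complex \<inter> Pow quadrant"
    then have "\<sigma> \<subseteq> quadrant" by simp
    then show "\<phi> ` ?A ` \<sigma> = on_quadrant (\<lambda>m n. \<phi> (cone_point p a b m n)) ` \<sigma>"
      unfolding image_image by (intro image_cong) (auto simp: A on_quadrant_def)
  qed simp
  finally show ?thesis .
qed

lemma singleton_complex: "{x} \<in> coxeter_complex"
proof -
  have "{(fst x, snd x), (fst x + 1, snd x), (fst x, snd x + 1)} \<in> coxeter_chambers"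
    unfolding coxeter_chambers_def by blast
  then show ?thesis unfolding coxeter_complex_def complex_of_def by auto
qed

lemma singleton_sec: "{u} \<in> sec f \<longleftrightarrow> (\<exists>m n. u = f m n)"
proof
  assume "{u} \<in> sec f"
  then obtain \<sigma> where \<sigma>: "\<sigma> \<in> coxeter_complex" "{u} = on_quadrant f ` \<sigma>" by (auto simp: sec_def)
  then obtain x where "x \<in> \<sigma>" by blast
  then show "\<exists>m n. u = f m n" using \<sigma> unfolding on_quadrant_def by blast
next
  assume "\<exists>m n. u = f m n"
  then obtain m n where "u = f m n" by blast
  then have "{u} = on_quadrant f ` {(int m, int n)}" "{(int m, int n)} \<subseteq> quadrant"
    by (auto simp: on_quadrant_def quadrant_def)
  then show "{u} \<in> sec f" unfolding sec_def using singleton_complex by blast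
qed

lemma sec_image: "(`) ((`) h) (sec f) = sec (\<lambda>m n. h (f m n))"
  by (simp add: sec_def image_image on_quadrant_def)

lemma sec_shift: "sec (\<lambda>m n. f (i + m) (j + n)) \<subseteq> sec f"
proof
  let ?A = "aff (int i, int j) (1, 0) (0, 1)"
  fix x assume "x \<in> sec (\<lambda>m n. f (i + m) (j + n))"
  then obtain \<sigma> where \<sigma>: "\<sigma> \<in> coxeter_complex" "\<sigma> \<subseteq> quadrant"
      "x = on_quadrant (\<lambda>m n. f (i + m) (j + n)) ` \<sigma>"
    by (auto simp: sec_def)
  have "on_quadrant (\<lambda>m n. f (i + m) (j + n)) y = on_quadrant f (?A y)" if "y \<in> quadrant" for y
    using that by (auto simp: on_quadrant_def aff_def quadrant_def nat_add_distrib)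
  then have "x = on_quadrant f ` ?A ` \<sigma>"
    unfolding \<sigma>(3) image_image using \<sigma>(2) by (intro image_cong) auto
  moreover have "?A ` \<sigma> \<in> coxeter_complex"
    using aff_complex[of 1 0 0 1] \<sigma>(1) by (simp add: unit_pairs_def)
  moreover have "?A ` \<sigma> \<subseteq> quadrant" using \<sigma>(2) by (auto simp: quadrant_def aff_def)
  ultimately show "x \<in> sec f" unfolding sec_def by blast
qed

context triangle_system
begin

abbreviation "D \<equiv> building P T"

subsection \<open>Apartments and tilings\<close>

lemma chambers_eq:
  "chambers P T = {{g, g \<otimes>\<^bsub>G\<^esub> gen x, g \<otimes>\<^bsub>G\<^esub> gen x \<otimes>\<^bsub>G\<^esub> gen y} | g x y z.
     g \<in> carrier G \<and> (x, y, z) \<in> T}" (is "_ = ?R")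
proof
  show "chambers P T \<subseteq> ?R"
  proof
    fix c assume "c \<in> chambers P T"
    then obtain g x y z where g: "g \<in> carrier G" "(x, y, z) \<in> T"
      and c: "c = {g, g \<otimes>\<^bsub>G\<^esub> inv\<^bsub>G\<^esub> gen x, g \<otimes>\<^bsub>G\<^esub> gen y}"
      unfolding chambers_def by blast
    have "c = {g, g \<otimes>\<^bsub>G\<^esub> gen y, g \<otimes>\<^bsub>G\<^esub> gen y \<otimes>\<^bsub>G\<^esub> gen z}"
      using triangle_mult(1)[OF cyc[OF g(2)] g(1)] c by auto
    moreover have "(y, z, x) \<in> T" using g(2) cyc by blast
    ultimately show "c \<in> ?R" using g(1) by blast
  qed
  show "?R \<subseteq> chambers P T"
  proof
    fix c assume "c \<in> ?R"
    then obtain g x y z where g: "g \<in> carrier G" "(x, y, z) \<in> T"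
      and c: "c = {g, g \<otimes>\<^bsub>G\<^esub> gen x, g \<otimes>\<^bsub>G\<^esub> gen x \<otimes>\<^bsub>G\<^esub> gen y}" by blast
    have "c = {g, g \<otimes>\<^bsub>G\<^esub> inv\<^bsub>G\<^esub> gen z, g \<otimes>\<^bsub>G\<^esub> gen x}"
      using triangle_mult(1)[OF g(2,1)] c by auto
    moreover have "(z, x, y) \<in> T" using g(2) cyc by blast
    ultimately show "c \<in> chambers P T" unfolding chambers_def using g(1) by blast
  qed
qed

lemma chamberE:
  assumes "c \<in> chambers P T"
  obtains g x y z where "g \<in> carrier G" "(x, y, z) \<in> T"
    "c = {g, g \<otimes>\<^bsub>G\<^esub> gen x, g \<otimes>\<^bsub>G\<^esub> gen x \<otimes>\<^bsub>G\<^esub> gen y}"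
  using assms unfolding chambers_eq by blast

text \<open>A chamber carries one cyclic orientation, fixed by any of its oriented edges. Of the six
  positions of the pair \<open>u\<close>, \<open>v\<close>, three follow the cycle; the other three
  orient an edge both ways, which \<open>gen_gen_ne_one\<close> forbids.\<close>

lemma chamber_oriented:
  assumes "{u, v, w} \<in> chambers P T" "u \<noteq> v" "v \<noteq> w" "u \<noteq> w" "v = u \<otimes>\<^bsub>G\<^esub> gen x" "x \<in> P"
    "u \<in> carrier G"
  shows "\<exists>y z. (x, y, z) \<in> T \<and> w = v \<otimes>\<^bsub>G\<^esub> gen y \<and> u = w \<otimes>\<^bsub>G\<^esub> gen z"
proof -
  obtain g x1 y1 z1 where g: "g \<in> carrier G" "(x1, y1, z1) \<in> T"
    and c: "{u, v, w} = {g, g \<otimes>\<^bsub>G\<^esub> gen x1, g \<otimes>\<^bsub>G\<^esub> gen x1 \<otimes>\<^bsub>G\<^esub> gen y1}"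
    using chamberE[OF assms(1)] .
  define g1 g2 where gd: "g1 = g \<otimes>\<^bsub>G\<^esub> gen x1" "g2 = g1 \<otimes>\<^bsub>G\<^esub> gen y1"
  note X = T_in[OF g(2)]
  have g12: "g1 \<in> carrier G" "g2 \<in> carrier G" using g X by (simp_all add: gd)
  have g0: "g = g2 \<otimes>\<^bsub>G\<^esub> gen z1" using triangle_mult(2)[OF g(2,1)] by (simp add: gd)
  have c': "{u, v, w} = {g, g1, g2}" using c gd by simp
  have nb: "\<not> (b = a \<otimes>\<^bsub>G\<^esub> gen x \<and> a = b \<otimes>\<^bsub>G\<^esub> gen y)" if "a \<in> carrier G" "b \<in> carrier G" "y \<in> P" for a b y
  proof
    assume "b = a \<otimes>\<^bsub>G\<^esub> gen x \<and> a = b \<otimes>\<^bsub>G\<^esub> gen y"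
    then have "a \<otimes>\<^bsub>G\<^esub> (gen x \<otimes>\<^bsub>G\<^esub> gen y) = a" using that assms(6) by (metis G.m_assoc gen_carrier)
    then have "gen x \<otimes>\<^bsub>G\<^esub> gen y = \<one>\<^bsub>G\<^esub>" using that assms(6) by simp
    then show False using gen_gen_ne_one assms(6) that by blast
  qed
  have lab: "x = x'" if "a \<in> carrier G" "a \<otimes>\<^bsub>G\<^esub> gen x = a \<otimes>\<^bsub>G\<^esub> gen x'" "x' \<in> P" for a x'
    using that assms(6) gen_inject by simp
  have main: "\<exists>y z. (x, y, z) \<in> T \<and> w = v \<otimes>\<^bsub>G\<^esub> gen y \<and> u = w \<otimes>\<^bsub>G\<^esub> gen z"
    if "u = a" "v = b" "{u, v, w} = {a, b, d}" "b = a \<otimes>\<^bsub>G\<^esub> gen x'" "d = b \<otimes>\<^bsub>G\<^esub> gen y'"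
      "a = d \<otimes>\<^bsub>G\<^esub> gen z'" "(x', y', z') \<in> T" for a b d x' y' z'
  proof -
    have "w \<in> {a, b, d}" using that(3) by blast
    then have "w = d" using that(1,2) assms(3,4) by auto
    moreover have "x = x'" using lab[of u x'] that assms T_in by metis
    ultimately show ?thesis using that by blast
  qed
  have "u \<in> {g, g1, g2}" "v \<in> {g, g1, g2}" using c' by blast+
  then consider "u = g" "v = g1" | "u = g1" "v = g2" | "u = g2" "v = g"
    | "u = g1" "v = g" | "u = g2" "v = g1" | "u = g" "v = g2"
    using assms(2) by auto
  then show ?thesis
  proof cases
    case 1
    show ?thesis by (rule main[OF 1 _ gd g0 g(2)]) (rule c')
  next
    case 2
    show ?thesis by (rule main[OF 2 _ gd(2) g0 gd(1) cyc[OF g(2)]]) (simp add: c' insert_commute)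
  next
    case 3
    show ?thesis by (rule main[OF 3 _ g0 gd cyc[OF cyc[OF g(2)]]]) (simp add: c' insert_commute)
  next
    case 4
    then show ?thesis using nb[of g1 g x1] g g12 gd X assms(5) by simp
  next
    case 5
    then show ?thesis using nb[of g2 g1 y1] g g12 gd X assms(5) by simp
  next
    case 6
    then show ?thesis using nb[of g g2 z1] g g12 g0 X assms(5) by simp
  qed
qed

lemma chamber_carrier:
  assumes "c \<in> chambers P T"
  shows "c \<subseteq> carrier G"
proof -
  obtain g x y z where "g \<in> carrier G" "(x, y, z) \<in> T"
    "c = {g, g \<otimes>\<^bsub>G\<^esub> gen x, g \<otimes>\<^bsub>G\<^esub> gen x \<otimes>\<^bsub>G\<^esub> gen y}"
    using chamberE[OF assms] .
  then show ?thesis using T_in[of x y z] by simp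
qed

text \<open>A chart is only known to map simplices to simplices; by injectivity the image keeps
  three vertices and fills a chamber.\<close>

lemma chart_chamber:
  assumes "apartment_chart D \<phi>" "c \<in> coxeter_chambers"
  shows "\<phi> ` c \<in> chambers P T"
proof -
  have c: "card c = 3" using assms(2) unfolding coxeter_chambers_def by auto
  then have "c \<in> coxeter_complex"
    using assms(2) unfolding coxeter_complex_def complex_of_def by force
  then have "\<phi> ` c \<in> D" using assms(1) by (auto simp: apartment_chart_def)
  then obtain c' where c': "c' \<in> chambers P T" "\<phi> ` c \<subseteq> c'"
    unfolding building_def complex_of_def by blast
  have "card (\<phi> ` c) = 3"
    using assms(1) c by (metis apartment_chart_def card_image inj_on_subset subset_UNIV)
  moreover obtain x y z where "c' = {x, y, z}" using chamberE[OF c'(1)] by metis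
  then have "finite c'" "card c' \<le> 3" by (simp_all add: card_insert_if)
  ultimately show ?thesis using c' card_seteq[OF _ c'(2)] by simp
qed

lemma chart_carrier:
  assumes "apartment_chart D \<phi>"
  shows "\<phi> x \<in> carrier G"
proof -
  have "{(fst x, snd x), (fst x + 1, snd x), (fst x, snd x + 1)} \<in> coxeter_chambers"
    unfolding coxeter_chambers_def by blast
  from chamber_carrier[OF chart_chamber[OF assms this]] show ?thesis by simp
qed

lemma cone_chambers:
  assumes "{p, a, b} \<in> coxeter_chambers"
  shows "{cone_point p a b m n, cone_point p a b (Suc m) n, cone_point p a b m (Suc n)} \<in> coxeter_chambers"
    "{cone_point p a b (Suc m) n, cone_point p a b m (Suc n), cone_point p a b (Suc m) (Suc n)} \<in>
       coxeter_chambers"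
proof -
  define a1 a2 b1 b2 where d: "a1 = fst a - fst p" "a2 = snd a - snd p" "b1 = fst b - fst p"
    "b2 = snd b - snd p"
  let ?A = "aff p (a1, a2) (b1, b2)"
  have u: "(a1, a2, b1, b2) \<in> unit_pairs"
    using chamber_unit_pairs[of "fst p" "snd p" "fst a" "snd a" "fst b" "snd b"] assms by (simp add: d)
  have A: "cone_point p a b m n = ?A (int m, int n)" for m n
    by (simp add: aff_def cone_point_def d)
  have "{(int m, int n), (int m + 1, int n), (int m, int n + 1)} \<in> coxeter_chambers"
    "{(int m + 1, int n), (int m, int n + 1), (int m + 1, int n + 1)} \<in> coxeter_chambers"
    unfolding coxeter_chambers_def by blast+
  from this[THEN aff_chamber[OF u, of _ p]]
  show "{cone_point p a b m n, cone_point p a b (Suc m) n, cone_point p a b m (Suc n)} \<in> coxeter_chambers"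
    "{cone_point p a b (Suc m) n, cone_point p a b m (Suc n), cone_point p a b (Suc m) (Suc n)} \<in>
       coxeter_chambers"
    by (simp_all add: A add.commute)
qed

text \<open>One oriented edge orients its chamber, and adjacent chambers share an edge, so labels
  spread over the cone. The inequalities of a tiling come from the injectivity of the chart.\<close>

lemma chart_tiling:
  assumes \<phi>: "apartment_chart D \<phi>" and c: "{p, a, b} \<in> coxeter_chambers"
    and x: "x \<in> P" "\<phi> a = \<phi> p \<otimes>\<^bsub>G\<^esub> gen x"
  shows "\<exists>s. tiling T s \<and> (\<forall>m n. \<phi> (cone_point p a b m n) = vert (\<phi> p) s m n)"
proof -
  let ?f = "\<lambda>m n. \<phi> (cone_point p a b m n)"
  have car: "?f m n \<in> carrier G" for m n using chart_carrier[OF \<phi>] .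
  have f0: "?f 0 0 = \<phi> p" "?f 1 0 = \<phi> a" by (simp_all add: cone_point_def)
  have inj: "\<phi> y = \<phi> z \<longleftrightarrow> y = z" for y z
    using \<phi> by (auto simp: apartment_chart_def inj_eq)
  note C = cone_chambers[OF c, THEN chart_chamber[OF \<phi>], simplified]
  have cu: "(fst a - fst p, snd a - snd p, fst b - fst p, snd b - snd p) \<in> unit_pairs"
    using chamber_unit_pairs[of "fst p" "snd p" "fst a" "snd a" "fst b" "snd b"] c by simp
  have ne: "?f m n \<noteq> ?f (Suc m) n" "?f m n \<noteq> ?f m (Suc n)" "?f (Suc m) n \<noteq> ?f m (Suc n)"
    "?f m n \<noteq> ?f (Suc m) (Suc n)" "?f (Suc (Suc m)) n \<noteq> ?f m (Suc n)"
    "?f (Suc m) n \<noteq> ?f m (Suc (Suc n))" for m n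
    using cu unfolding inj unit_pairs_def by (auto simp: cone_point_def algebra_simps)
  have up: "\<exists>y z. (x, y, z) \<in> T \<and> ?f m (Suc n) = ?f (Suc m) n \<otimes>\<^bsub>G\<^esub> gen y \<and>
      ?f m n = ?f m (Suc n) \<otimes>\<^bsub>G\<^esub> gen z"
    if "?f (Suc m) n = ?f m n \<otimes>\<^bsub>G\<^esub> gen x" "x \<in> P" for m n x
    by (rule chamber_oriented[OF C(1) ne(1,3,2) that car])
  have down: "\<exists>x z. (y, x, z) \<in> T \<and> ?f (Suc m) (Suc n) = ?f m (Suc n) \<otimes>\<^bsub>G\<^esub> gen x \<and>
      ?f (Suc m) n = ?f (Suc m) (Suc n) \<otimes>\<^bsub>G\<^esub> gen z"
    if "?f m (Suc n) = ?f (Suc m) n \<otimes>\<^bsub>G\<^esub> gen y" "y \<in> P" for m n y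
    by (rule chamber_oriented[OF C(2) ne(3,1,2) that car])
  have right: "\<exists>x\<in>P. ?f (Suc (Suc m)) n = ?f (Suc m) n \<otimes>\<^bsub>G\<^esub> gen x"
    if "?f (Suc m) n = ?f (Suc m) (Suc n) \<otimes>\<^bsub>G\<^esub> gen z" "z \<in> P" for m n z
  proof -
    have "\<exists>x y. (z, x, y) \<in> T \<and> ?f (Suc (Suc m)) n = ?f (Suc m) n \<otimes>\<^bsub>G\<^esub> gen x \<and>
      ?f (Suc m) (Suc n) = ?f (Suc (Suc m)) n \<otimes>\<^bsub>G\<^esub> gen y"
      by (rule chamber_oriented[OF _ ne(2)[symmetric] ne(1) ne(3)[symmetric] that car])
        (use C(1)[of "Suc m" n] in \<open>simp add: insert_commute\<close>)
    then show ?thesis using T_in by blast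
  qed
  \<comment> \<open>The orientation of a horizontal edge passes through the two triangles above it
    to the next row, and through the vertical edge at its end to the right.\<close>
  have next_up: "\<exists>x\<in>P. ?f (Suc m) (Suc n) = ?f m (Suc n) \<otimes>\<^bsub>G\<^esub> gen x"
    and next_right: "\<exists>x\<in>P. ?f (Suc (Suc m)) n = ?f (Suc m) n \<otimes>\<^bsub>G\<^esub> gen x"
    if "\<exists>x\<in>P. ?f (Suc m) n = ?f m n \<otimes>\<^bsub>G\<^esub> gen x" for m n
  proof -
    from that up[of m n] obtain y where "?f m (Suc n) = ?f (Suc m) n \<otimes>\<^bsub>G\<^esub> gen y" "y \<in> P"
      using T_in by blast
    from down[OF this] obtain x z where "(y, x, z) \<in> T" "?f (Suc m) (Suc n) = ?f m (Suc n) \<otimes>\<^bsub>G\<^esub> gen x"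
      "?f (Suc m) n = ?f (Suc m) (Suc n) \<otimes>\<^bsub>G\<^esub> gen z" by blast
    then show "\<exists>x\<in>P. ?f (Suc m) (Suc n) = ?f m (Suc n) \<otimes>\<^bsub>G\<^esub> gen x"
      "\<exists>x\<in>P. ?f (Suc (Suc m)) n = ?f (Suc m) n \<otimes>\<^bsub>G\<^esub> gen x" using right T_in by blast+
  qed
  have row: "\<exists>x\<in>P. ?f (Suc m) 0 = ?f m 0 \<otimes>\<^bsub>G\<^esub> gen x" for m
    by (induction m) (use x f0 next_right in auto)
  have all: "\<exists>x\<in>P. ?f (Suc m) n = ?f m n \<otimes>\<^bsub>G\<^esub> gen x" for m n
    by (induction n) (use row next_up in auto)
  have "\<exists>x y z. (x, y, z) \<in> T \<and> ?f (Suc m) n = ?f m n \<otimes>\<^bsub>G\<^esub> gen x \<and>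
      ?f m (Suc n) = ?f (Suc m) n \<otimes>\<^bsub>G\<^esub> gen y \<and> ?f m n = ?f m (Suc n) \<otimes>\<^bsub>G\<^esub> gen z" for m n
    using all[of m n] up[of m n] by blast
  then obtain \<alpha> \<gamma> \<beta> where L: "\<And>m n. (\<alpha> m n, \<gamma> m n, \<beta> m n) \<in> T"
    "\<And>m n. ?f (Suc m) n = ?f m n \<otimes>\<^bsub>G\<^esub> gen (\<alpha> m n)"
    "\<And>m n. ?f m (Suc n) = ?f (Suc m) n \<otimes>\<^bsub>G\<^esub> gen (\<gamma> m n)"
    "\<And>m n. ?f m n = ?f m (Suc n) \<otimes>\<^bsub>G\<^esub> gen (\<beta> m n)"
    by metis
  have P: "\<alpha> m n \<in> P" "\<beta> m n \<in> P" "\<gamma> m n \<in> P" for m n using T_in[OF L(1)[of m n]] by simp_all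
  have lab: "x = y" if "g \<otimes>\<^bsub>G\<^esub> gen x = g \<otimes>\<^bsub>G\<^esub> gen y" "g \<in> carrier G" "x \<in> P" "y \<in> P" for g x y
    using that gen_inject by simp
  let ?s = "Tiling \<alpha> \<beta> \<gamma>"
  have s: "tiling T ?s"
  proof (rule tilingI)
    fix m n
    show "(al ?s m n, ga ?s m n, be ?s m n) \<in> T" using L(1) by simp
    from down[OF L(3) P(3)] obtain x z where xz: "(\<gamma> m n, x, z) \<in> T"
      "?f (Suc m) (Suc n) = ?f m (Suc n) \<otimes>\<^bsub>G\<^esub> gen x"
      "?f (Suc m) n = ?f (Suc m) (Suc n) \<otimes>\<^bsub>G\<^esub> gen z" by blast
    have "x = \<alpha> m (Suc n)" using lab[OF _ car[of m "Suc n"]] xz L(2)[of m "Suc n"] P T_in by metis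
    moreover have "z = \<beta> (Suc m) n"
      using lab[OF _ car[of "Suc m" "Suc n"]] xz L(4)[of "Suc m" n] P T_in by metis
    ultimately show "(ga ?s m n, al ?s m (Suc n), be ?s (Suc m) n) \<in> T" using xz by simp
    show "be ?s m n \<noteq> al ?s m (Suc n)"
      using ne(4)[of m n] L(4)[of m n] L(2)[of m "Suc n"] by auto
    show "al ?s (Suc m) n \<noteq> ga ?s m n"
      using ne(5)[of m n] L(2)[of "Suc m" n] L(3)[of m n] by auto
    show "ga ?s m (Suc n) \<noteq> be ?s (Suc m) n"
      using ne(6)[of m n] L(3)[of m "Suc n"] L(4)[of "Suc m" n] by auto
  qed
  have "?f m n = vert (\<phi> p) ?s m n" for m n
  proof (rule vert_eqI[OF _ s, where f = ?f])
    show "?f m n = ?f m (Suc n) \<otimes>\<^bsub>G\<^esub> gen (be ?s m n)" for m n using L(4)[of m n] by simp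
  qed (use L(2) car f0 chart_carrier[OF \<phi>] in simp_all)
  then show ?thesis using s by blast
qed


lemma vert_chambers:
  assumes "v \<in> carrier G" "tiling T s"
  shows "{vert v s m n, vert v s (Suc m) n, vert v s m (Suc n)} \<in> chambers P T"
    "{vert v s (Suc m) n, vert v s m (Suc n), vert v s (Suc m) (Suc n)} \<in> chambers P T"
proof -
  note E = vert_edges[OF assms] and D = tilingD(3,4)[OF assms(2)]
  have C: "{g, g \<otimes>\<^bsub>G\<^esub> gen x, g \<otimes>\<^bsub>G\<^esub> gen x \<otimes>\<^bsub>G\<^esub> gen y} \<in> chambers P T"
    if "(x, y, z) \<in> T" "g \<in> carrier G" for x y z g
    unfolding chambers_eq using that by blast
  show "{vert v s m n, vert v s (Suc m) n, vert v s m (Suc n)} \<in> chambers P T"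
    using C[OF D(1)[of m n], of "vert v s m n"] assms
    unfolding E(1)[of m n, symmetric] E(2)[of m n, symmetric] by simp
  show "{vert v s (Suc m) n, vert v s m (Suc n), vert v s (Suc m) (Suc n)} \<in> chambers P T"
    using C[OF D(2)[of m n], of "vert v s (Suc m) n"] assms
    unfolding E(2)[of m n, symmetric] E(1)[of m "Suc n", symmetric] by simp
qed

lemma tiling_extend_back:
  assumes "v \<in> carrier G" "tiling T s"
  shows "\<exists>w t. w \<in> carrier G \<and> tiling T t \<and> shift 1 1 t = s \<and> vert w t 1 1 = v"
proof -
  obtain y where "y \<in> P" "\<not> A y (al s 0 0)" using nonadj_left[of "al s 0 0"] assms by auto
  then obtain r where r: "tiling T r" "shift 1 0 r = s" using add_col[OF assms(2)] by blast
  obtain x where "x \<in> P" "\<not> A (be r 0 0) x" using nonadj_right[of "be r 0 0"] r by auto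
  then obtain t where t: "tiling T t" "shift 0 1 t = r" using add_row[OF r(1)] by blast
  let ?w = "v \<otimes>\<^bsub>G\<^esub> inv\<^bsub>G\<^esub> cls (corner t 1 1)"
  have "shift 1 1 t = s" using r(2) unfolding t(2)[symmetric] by simp
  moreover have "vert ?w t 1 1 = v" using t assms by (simp add: vert_def G.m_assoc)
  moreover have "?w \<in> carrier G" using t assms by simp
  ultimately show ?thesis using t(1) by blast
qed

text \<open>The sector is extended backwards by a row and a column again and again; the union of the
  increasing sectors is a plane, embedded by \<open>vert_unique\<close>.\<close>

lemma tiling_chart:
  assumes v: "v \<in> carrier G" and s: "tiling T s"
  shows "\<exists>\<phi>. apartment_chart D \<phi> \<and> (\<forall>m n. \<phi> (int m, int n) = vert v s m n)"
proof -
  have "\<exists>w. \<forall>k::nat. ((fst (w k) \<in> carrier G \<and> tiling T (snd (w k))) \<and> (k = 0 \<longrightarrow> w k = (v, s))) \<and>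
     shift 1 1 (snd (w (Suc k))) = snd (w k) \<and> vert (fst (w (Suc k))) (snd (w (Suc k))) 1 1 = fst (w k)"
  proof (rule dependent_nat_choice)
    show "\<exists>x. (fst x \<in> carrier G \<and> tiling T (snd x)) \<and> ((0::nat) = 0 \<longrightarrow> x = (v, s))"
      using v s by (intro exI[of _ "(v, s)"]) simp
  next
    fix x and n :: nat
    assume "(fst x \<in> carrier G \<and> tiling T (snd x)) \<and> (n = 0 \<longrightarrow> x = (v, s))"
    then obtain w t where "w \<in> carrier G" "tiling T t" "shift 1 1 t = snd x" "vert w t 1 1 = fst x"
      using tiling_extend_back by blast
    then show "\<exists>y. ((fst y \<in> carrier G \<and> tiling T (snd y)) \<and> (Suc n = 0 \<longrightarrow> y = (v, s))) \<and>
        shift 1 1 (snd y) = snd x \<and> vert (fst y) (snd y) 1 1 = fst x"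
      by (intro exI[of _ "(w, t)"]) simp
  qed
  then obtain w where w: "\<And>k. fst (w k) \<in> carrier G" "\<And>k. tiling T (snd (w k))" "w 0 = (v, s)"
    "\<And>k. shift 1 1 (snd (w (Suc k))) = snd (w k)"
    "\<And>k. vert (fst (w (Suc k))) (snd (w (Suc k))) 1 1 = fst (w k)"
    by blast
  define f where "f k m n = vert (fst (w k)) (snd (w k)) m n" for k m n
  have f1: "f (Suc k) (Suc m) (Suc n) = f k m n" for k m n
    using vert_shift[OF w(1)[of "Suc k"] w(2)[of "Suc k"], of 1 1 m n]
    unfolding w(4) w(5) by (simp add: f_def)
  have f2: "f (k + l) (m + l) (n + l) = f k m n" for k l m n
    by (induction l) (use f1 in simp_all)
  \<comment> \<open>\<open>K x\<close> backward extensions give \<open>x\<close> nonnegative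
    coordinates, and by \<open>f2\<close> further extensions do not change the value.\<close>
  define K where "K x = nat (\<bar>fst x\<bar> + \<bar>snd x\<bar>)" for x :: "int \<times> int"
  define \<phi> where "\<phi> x = f (K x) (nat (fst x + int (K x))) (nat (snd x + int (K x)))" for x
  have \<phi>: "\<phi> x = f k (nat (fst x + int k)) (nat (snd x + int k))" if "K x \<le> k" for x k
  proof -
    obtain l where l: "k = K x + l" using \<open>K x \<le> k\<close> le_Suc_ex by blast
    have "nat (fst x + int k) = nat (fst x + int (K x)) + l"
      "nat (snd x + int k) = nat (snd x + int (K x)) + l"
      unfolding l K_def by linarith+
    then show ?thesis unfolding \<phi>_def using f2[of "K x" l] by (simp add: l)
  qed
  have inj: "inj \<phi>"
  proof (rule injI)
    fix x y assume e: "\<phi> x = \<phi> y"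
    define k where "k = max (K x) (K y)"
    have "f k (nat (fst x + int k)) (nat (snd x + int k)) = f k (nat (fst y + int k)) (nat (snd y + int k))"
      using \<phi>[of x k] \<phi>[of y k] e by (simp add: k_def)
    then have "nat (fst x + int k) = nat (fst y + int k)" "nat (snd x + int k) = nat (snd y + int k)"
      unfolding f_def using vert_unique[OF w(1) w(2) w(2)] by blast+
    moreover have "0 \<le> fst x + int k" "0 \<le> fst y + int k" "0 \<le> snd x + int k" "0 \<le> snd y + int k"
      unfolding k_def K_def by linarith+
    ultimately show "x = y" unfolding prod_eq_iff by linarith
  qed
  have ch: "\<phi> ` c \<in> chambers P T" if "c \<in> coxeter_chambers" for c
  proof -
    from that obtain i j where
      "c = {(i, j), (i + 1, j), (i, j + 1)} \<or> c = {(i + 1, j), (i, j + 1), (i + 1, j + 1)}"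
      unfolding coxeter_chambers_def by blast
    \<comment> \<open>The summand 2 leaves room for the vertices with both coordinates increased by
      one.\<close>
    moreover define k where "k = nat (\<bar>i\<bar> + \<bar>j\<bar> + 2)"
    define m n where "m = nat (i + int k)" "n = nat (j + int k)"
    have mn: "nat (i + int k) = m" "nat (j + int k) = n" "nat (i + 1 + int k) = Suc m"
      "nat (j + 1 + int k) = Suc n"
      unfolding m_n_def k_def by linarith+
    have K: "K (i, j) \<le> k" "K (i + 1, j) \<le> k" "K (i, j + 1) \<le> k" "K (i + 1, j + 1) \<le> k"
      unfolding K_def k_def by simp_all
    have "\<phi> (i, j) = f k m n" "\<phi> (i + 1, j) = f k (Suc m) n" "\<phi> (i, j + 1) = f k m (Suc n)"
      "\<phi> (i + 1, j + 1) = f k (Suc m) (Suc n)"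
      using K[THEN \<phi>] mn by simp_all
    ultimately show ?thesis using vert_chambers[OF w(1)[of k] w(2)[of k], of m n] unfolding f_def by auto
  qed
  have "\<phi> ` \<sigma> \<in> D" if "\<sigma> \<in> coxeter_complex" for \<sigma>
    using that ch unfolding building_def coxeter_complex_def complex_of_def by blast
  then have "apartment_chart D \<phi>" using inj by (auto simp: apartment_chart_def)
  moreover have "\<phi> (int m, int n) = vert v s m n" for m n
    using f2[of 0 "K (int m, int n)" m n] w(3)
    unfolding \<phi>_def by (simp add: nat_add_distrib f_def add.commute)
  ultimately show ?thesis by blast
qed

lemma vertex_iff: "{v} \<in> D \<longleftrightarrow> v \<in> carrier G"
proof
  assume "{v} \<in> D"
  then show "v \<in> carrier G" using chamber_carrier unfolding building_def complex_of_def by blast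
next
  assume v: "v \<in> carrier G"
  obtain s where s: "tiling T s" using ex_tiling by blast
  have "{v, vert v s 1 0, vert v s 0 1} \<in> chambers P T"
    using vert_chambers(1)[OF v s, of 0 0] v by simp
  then show "{v} \<in> D" unfolding building_def complex_of_def by blast
qed

abbreviation "Sec v s \<equiv> sec (vert v s)"

lemma std_cone:
  "{(0, 0), (1, 0), (0, 1)} \<in> coxeter_chambers" "cone_point (0, 0) (1, 0) (0, 1) m n = (int m, int n)"
proof -
  have "{(0, 0), (0 + 1, 0), (0, 0 + 1)} \<in> coxeter_chambers" unfolding coxeter_chambers_def by blast
  then show "{(0, 0), (1, 0), (0, 1)} \<in> coxeter_chambers" by simp
qed (simp add: cone_point_def)

lemma sectors_at_eq:
  assumes "v \<in> carrier G"
  shows "sectors_at D v = Sec v ` {s. tiling T s}"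
proof
  show "sectors_at D v \<subseteq> Sec v ` {s. tiling T s}"
  proof
    fix S assume "S \<in> sectors_at D v"
    then obtain \<phi> p a b where S: "S = (`) \<phi> ` (coxeter_complex \<inter> Pow (cone p a b))"
      and \<phi>: "apartment_chart D \<phi>" and c: "{p, a, b} \<in> coxeter_chambers" and p: "\<phi> p = v"
      unfolding sectors_at_def by blast
    \<comment> \<open>Every vertex of a chamber has an outgoing edge in it, so one bounding ray
      starts with an outgoing edge. If it is the ray through \<open>b\<close>, the roles of
      \<open>a\<close> and \<open>b\<close> are exchanged; the cone is unchanged.\<close>
    have sw: "{p, b, a} \<in> coxeter_chambers" using c by (simp add: insert_commute)
    have "cone_point p a b m n = cone_point p b a n m" for m n by (simp add: cone_point_def)
    then have cw: "cone p a b = cone p b a" unfolding cone_def by metis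
    obtain g x y z where g: "g \<in> carrier G" "(x, y, z) \<in> T"
      "\<phi> ` {p, a, b} = {g, g \<otimes>\<^bsub>G\<^esub> gen x, g \<otimes>\<^bsub>G\<^esub> gen x \<otimes>\<^bsub>G\<^esub> gen y}"
      using chamberE[OF chart_chamber[OF \<phi> c]] .
    note X = T_in[OF g(2)]
    have gz: "g = g \<otimes>\<^bsub>G\<^esub> gen x \<otimes>\<^bsub>G\<^esub> gen y \<otimes>\<^bsub>G\<^esub> gen z" using triangle_mult(2)[OF g(2,1)] by simp
    have eq: "{\<phi> p, \<phi> a, \<phi> b} = {g, g \<otimes>\<^bsub>G\<^esub> gen x, g \<otimes>\<^bsub>G\<^esub> gen x \<otimes>\<^bsub>G\<^esub> gen y}" using g(3) by simp
    have "\<phi> p \<in> {g, g \<otimes>\<^bsub>G\<^esub> gen x, g \<otimes>\<^bsub>G\<^esub> gen x \<otimes>\<^bsub>G\<^esub> gen y}"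
      unfolding eq[symmetric] by simp
    then consider "\<phi> p = g" | "\<phi> p = g \<otimes>\<^bsub>G\<^esub> gen x" | "\<phi> p = g \<otimes>\<^bsub>G\<^esub> gen x \<otimes>\<^bsub>G\<^esub> gen y"
      by blast
    then have "\<exists>u\<in>P. \<phi> p \<otimes>\<^bsub>G\<^esub> gen u \<in> {\<phi> p, \<phi> a, \<phi> b}"
      unfolding eq
    proof cases
      case 1
      then show "\<exists>u\<in>P. \<phi> p \<otimes>\<^bsub>G\<^esub> gen u \<in> {g, g \<otimes>\<^bsub>G\<^esub> gen x, g \<otimes>\<^bsub>G\<^esub> gen x \<otimes>\<^bsub>G\<^esub> gen y}"
        using X by (intro bexI[of _ x]) simp_all
    next
      case 2
      then show "\<exists>u\<in>P. \<phi> p \<otimes>\<^bsub>G\<^esub> gen u \<in> {g, g \<otimes>\<^bsub>G\<^esub> gen x, g \<otimes>\<^bsub>G\<^esub> gen x \<otimes>\<^bsub>G\<^esub> gen y}"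
        using X by (intro bexI[of _ y]) simp_all
    next
      case 3
      then show "\<exists>u\<in>P. \<phi> p \<otimes>\<^bsub>G\<^esub> gen u \<in> {g, g \<otimes>\<^bsub>G\<^esub> gen x, g \<otimes>\<^bsub>G\<^esub> gen x \<otimes>\<^bsub>G\<^esub> gen y}"
        using X gz[symmetric] by (intro bexI[of _ z]) simp_all
    qed
    then obtain u where u: "u \<in> P" "\<phi> p \<otimes>\<^bsub>G\<^esub> gen u \<in> {\<phi> p, \<phi> a, \<phi> b}" by blast
    have "\<phi> p \<otimes>\<^bsub>G\<^esub> gen u \<noteq> \<phi> p" using gen_ne_one[OF u(1)] u(1) chart_carrier[OF \<phi>] by simp
    then consider "\<phi> a = \<phi> p \<otimes>\<^bsub>G\<^esub> gen u" | "\<phi> b = \<phi> p \<otimes>\<^bsub>G\<^esub> gen u" using u by auto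
    then show "S \<in> Sec v ` {s. tiling T s}"
    proof cases
      case 1
      obtain s where s: "tiling T s" "\<And>m n. \<phi> (cone_point p a b m n) = vert v s m n"
        using chart_tiling[OF \<phi> c u(1) 1] p by auto
      have "S = Sec v s" unfolding S cone_sec[OF c] s(2) ..
      then show ?thesis using s(1) by blast
    next
      case 2
      obtain s where s: "tiling T s" "\<And>m n. \<phi> (cone_point p b a m n) = vert v s m n"
        using chart_tiling[OF \<phi> sw u(1) 2] p by auto
      have "S = Sec v s" unfolding S cw cone_sec[OF sw] s(2) ..
      then show ?thesis using s(1) by blast
    qed
  qed
next
  show "Sec v ` {s. tiling T s} \<subseteq> sectors_at D v"
  proof
    fix S assume "S \<in> Sec v ` {s. tiling T s}"
    then obtain s where s: "tiling T s" "S = Sec v s" by blast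
    obtain \<phi> where \<phi>: "apartment_chart D \<phi>" "\<And>m n. \<phi> (int m, int n) = vert v s m n"
      using tiling_chart[OF assms s(1)] by blast
    have "S = (`) \<phi> ` (coxeter_complex \<inter> Pow (cone (0, 0) (1, 0) (0, 1)))"
      unfolding cone_sec[OF std_cone(1)] s(2) std_cone(2) \<phi>(2) ..
    moreover have "\<phi> (0, 0) = v" using \<phi>(2)[of 0 0] assms by simp
    ultimately show "S \<in> sectors_at D v" unfolding sectors_at_def using \<phi>(1) std_cone(1) by blast
  qed
qed

lemma sectors_at_carrier: "S \<in> sectors_at D v \<Longrightarrow> v \<in> carrier G"
  using chart_carrier unfolding sectors_at_def by blast

lemma sectors_eq: "S \<in> sectors D \<longleftrightarrow> (\<exists>v s. v \<in> carrier G \<and> tiling T s \<and> S = Sec v s)"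
proof
  assume "S \<in> sectors D"
  then obtain v where S: "S \<in> sectors_at D v" unfolding sectors_def by blast
  note v = sectors_at_carrier[OF S]
  show "\<exists>v s. v \<in> carrier G \<and> tiling T s \<and> S = Sec v s" using S v unfolding sectors_at_eq[OF v] by blast
next
  assume "\<exists>v s. v \<in> carrier G \<and> tiling T s \<and> S = Sec v s"
  then obtain v s where v: "v \<in> carrier G" "tiling T s" "S = Sec v s" by blast
  have "S \<in> sectors_at D v" unfolding sectors_at_eq[OF v(1)] using v by blast
  then show "S \<in> sectors D" unfolding sectors_def by blast
qed

lemma sectorI: "v \<in> carrier G \<Longrightarrow> tiling T s \<Longrightarrow> Sec v s \<in> sectors D"
  using sectors_eq by blast

subsection \<open>Subsectors\<close>

text \<open>A positive letter has only three displacements. Hence an oriented edge between two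
  vertices of a sector is an edge of its tiling.\<close>

lemma edge_position:
  assumes "v \<in> carrier G" "tiling T s" "vert v s a' b' = vert v s a b \<otimes>\<^bsub>G\<^esub> gen x" "x \<in> P"
  shows "a' = Suc a \<and> b' = b \<and> x = al s a b \<or> a = Suc a' \<and> b' = Suc b \<and> x = ga s a' b \<or>
    a' = a \<and> b = Suc b' \<and> x = be s a b'"
proof -
  have "v \<otimes>\<^bsub>G\<^esub> cls (corner s a' b') = v \<otimes>\<^bsub>G\<^esub> cls (corner s a b @ [(x, True)])"
    using assms by (simp add: vert_def gen_eq cls_mult[symmetric] G.m_assoc)
  then have "cls (corner s a b @ [(x, True)]) = cls (corner s a' b')" using assms by simp
  then have "moves T (corner s a b @ [(x, True)]) s (shift a' b' s) (int a', int b')"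
    using moves_corner[OF assms(2)] cls_moves assms by (metis corner_words fst_conv words_simps)
  then obtain u e where ue: "moves T (corner s a b) s u e" "letter T (x, True) u (shift a' b' s) ((int a', int b') - e)"
    unfolding moves_append moves_single by blast
  then have "e = (int a, int b)" using moves_unique moves_corner[OF assms(2)] by blast
  then have d: "(int a' - int a, int b' - int b) \<in> {(1, 0), (0, -1), (-1, 1)}"
    using letter_disp(1)[OF ue(2)] by simp
  have lab: "x = y" if "vert v s a' b' = vert v s a b \<otimes>\<^bsub>G\<^esub> gen y" "y \<in> P" for y
    using that assms gen_inject by simp
  note E = vert_edges[OF assms(1,2)]
  from d consider "a' = Suc a" "b' = b" | "a = Suc a'" "b' = Suc b" | "a' = a" "b = Suc b'"
    by fastforce
  then show ?thesis
  proof cases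
    case 1
    then show ?thesis using lab[of "al s a b"] E(1)[of a b] assms(2) by simp
  next
    case 2
    then show ?thesis using lab[of "ga s a' b"] E(2)[of a' b] assms(2) by simp
  next
    case 3
    then show ?thesis using lab[of "be s a b'"] E(3)[of a b'] assms(2) by simp
  qed
qed

text \<open>Any change between the three directions of oriented edges runs along two sides of one
  triangle, which would give \<open>A x y\<close>.\<close>

lemma straight_position:
  assumes "v \<in> carrier G" "tiling T s" "vert v s a' b' = vert v s a b \<otimes>\<^bsub>G\<^esub> gen x" "x \<in> P"
    "vert v s a'' b'' = vert v s a' b' \<otimes>\<^bsub>G\<^esub> gen y" "y \<in> P" "\<not> A x y"
  shows "int a'' - int a' = int a' - int a \<and> int b'' - int b' = int b' - int b"
proof -
  note D = tilingD(3,4)[OF assms(2)]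
  note U = A_T[OF D(1)] A_T[OF D(2)]
  show ?thesis
    using edge_position[OF assms(1,2,3,4)] edge_position[OF assms(1,2,5,6)]
  proof (elim disjE)
  qed (use U assms(7) in auto)
qed

lemma arith_progression_nonneg:
  fixes c :: "nat \<Rightarrow> nat"
  assumes "\<And>m. int (c (Suc (Suc m))) - int (c (Suc m)) = int (c (Suc m)) - int (c m)"
  shows "int (c m) = int (c 0) + int m * (int (c 1) - int (c 0))" "int (c 1) - int (c 0) \<ge> 0"
proof -
  have d: "int (c (Suc m)) - int (c m) = int (c 1) - int (c 0)" for m
    by (induction m) (use assms in auto)
  show *: "int (c m) = int (c 0) + int m * (int (c 1) - int (c 0))" for m
  proof (induction m)
    case (Suc m)
    then show ?case using d[of m] by (simp add: algebra_simps)
  qed simp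
  show "int (c 1) - int (c 0) \<ge> 0"
  proof (rule ccontr)
    assume "\<not> ?thesis"
    then have "int (Suc (c 0)) * (int (c 1) - int (c 0)) \<le> int (Suc (c 0)) * (-1)"
      by (intro mult_left_mono) auto
    then show False using *[of "Suc (c 0)"] by simp
  qed
qed

text \<open>Along a row or a column of the smaller sector the steps are straight, hence of constant
  direction in the larger sector, and only the positive directions can be followed forever.\<close>

lemma subsector:
  assumes v: "v \<in> carrier G" and w: "w \<in> carrier G" and s: "tiling T s" and t: "tiling T t"
    and sub: "\<And>m n. \<exists>a b. vert w t m n = vert v s a b"
  shows "\<exists>i j. (\<forall>m n. vert w t m n = vert v s (i + m) (j + n)) \<and> t = shift i j s"
proof -
  obtain a b where ab: "\<And>m n. vert w t m n = vert v s (a m n) (b m n)" using sub by metis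
  note E = vert_edges[OF w t, unfolded ab]
  have row: "a m n = a 0 n + m \<and> b m n = b 0 n" for m n
  proof -
    have st: "int (a (Suc (Suc m)) n) - int (a (Suc m) n) = int (a (Suc m) n) - int (a m n) \<and>
        int (b (Suc (Suc m)) n) - int (b (Suc m) n) = int (b (Suc m) n) - int (b m n)" for m
      by (rule straight_position[OF v s E(1) _ E(1)]) (use t al_straight[OF t] in auto)
    have X: "int (a m n) = int (a 0 n) + int m * (int (a 1 n) - int (a 0 n))" "int (a 1 n) - int (a 0 n) \<ge> 0"
      using arith_progression_nonneg[of "\<lambda>m. a m n"] st by blast+
    have Y: "int (b m n) = int (b 0 n) + int m * (int (b 1 n) - int (b 0 n))" "int (b 1 n) - int (b 0 n) \<ge> 0"
      using arith_progression_nonneg[of "\<lambda>m. b m n"] st by blast+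
    \<comment> \<open>Among the directions (1, 0), (0, -1) and (-1, 1) of outgoing edges only the
      first has no negative coordinate.\<close>
    have "a 1 n = Suc (a 0 n) \<and> b 1 n = b 0 n"
      using edge_position[OF v s E(1)[of 0 n]] t X(2) Y(2) by auto
    then show ?thesis using X(1) Y(1) by simp
  qed
  have col: "a 0 n = a 0 0 \<and> b 0 n = b 0 0 + n" for n
  proof -
    have st: "int (a 0 n) - int (a 0 (Suc n)) = int (a 0 (Suc n)) - int (a 0 (Suc (Suc n))) \<and>
        int (b 0 n) - int (b 0 (Suc n)) = int (b 0 (Suc n)) - int (b 0 (Suc (Suc n)))" for n
      by (rule straight_position[OF v s E(3) _ E(3)]) (use t tilingD(7)[OF t] in auto)
    have st': "int (a 0 (Suc (Suc n))) - int (a 0 (Suc n)) = int (a 0 (Suc n)) - int (a 0 n)"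
      "int (b 0 (Suc (Suc n))) - int (b 0 (Suc n)) = int (b 0 (Suc n)) - int (b 0 n)" for n
      using st[of n] by linarith+
    have X: "int (a 0 n) = int (a 0 0) + int n * (int (a 0 1) - int (a 0 0))" "int (a 0 1) - int (a 0 0) \<ge> 0"
      using arith_progression_nonneg[of "a 0"] st' by blast+
    have Y: "int (b 0 n) = int (b 0 0) + int n * (int (b 0 1) - int (b 0 0))" "int (b 0 1) - int (b 0 0) \<ge> 0"
      using arith_progression_nonneg[of "b 0"] st' by blast+
    \<comment> \<open>The column is climbed against its edges, so the directions are the opposite
      ones; only (0, 1) has no negative coordinate.\<close>
    have "a 0 1 = a 0 0 \<and> b 0 1 = Suc (b 0 0)"
      using edge_position[OF v s E(3)[of 0 0]] t X(2) Y(2) by auto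
    then show ?thesis using X(1) Y(1) by simp
  qed
  have eq: "vert w t m n = vert v s (a 0 0 + m) (b 0 0 + n)" for m n
    using row[of m n] col[of n] ab by simp
  have wv: "w = vert v s (a 0 0) (b 0 0)" using eq[of 0 0] w by simp
  have "vert w t m n = vert w (shift (a 0 0) (b 0 0) s) m n" for m n
    unfolding wv vert_shift[OF v s] using eq wv by simp
  then have "agree m n t (shift (a 0 0) (b 0 0) s)" for m n
    using vert_unique[OF w t tiling_shift[OF s]] by blast
  then have "t = shift (a 0 0) (b 0 0) s" by (rule agree_all_eq)
  then show ?thesis using eq by blast
qed

lemma sector_equiv_iff:
  assumes "v \<in> carrier G" "w \<in> carrier G" "tiling T s" "tiling T t"
  shows "(Sec v s, Sec w t) \<in> sector_equiv D \<longleftrightarrow> tail_eq v s w t"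
proof
  assume "(Sec v s, Sec w t) \<in> sector_equiv D"
  then obtain S where S: "S \<in> sectors D" "S \<subseteq> Sec v s" "S \<subseteq> Sec w t"
    unfolding sector_equiv_def by blast
  then obtain u r where u: "u \<in> carrier G" "tiling T r" "S = Sec u r" using sectors_eq by auto
  have "\<exists>a b. vert u r m n = vert v s a b" "\<exists>a b. vert u r m n = vert w t a b" for m n
    using S(2,3) singleton_sec unfolding u(3) by (metis subsetD)+
  then obtain i j i' j' where "\<And>m n. vert u r m n = vert v s (i + m) (j + n)" "r = shift i j s"
    "\<And>m n. vert u r m n = vert w t (i' + m) (j' + n)" "r = shift i' j' t"
    using subsector[OF assms(1) u(1) assms(3) u(2)] subsector[OF assms(2) u(1) assms(4) u(2)] by metis
  then show "tail_eq v s w t" unfolding tail_eq_def by (metis add_0_right)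
next
  assume "tail_eq v s w t"
  then obtain i j i' j' where e: "vert v s i j = vert w t i' j'" "shift i j s = shift i' j' t"
    unfolding tail_eq_def by blast
  have "Sec (vert v s i j) (shift i j s) = sec (\<lambda>m n. vert v s (i + m) (j + n))"
    using vert_shift[OF assms(1,3)] by presburger
  moreover have "Sec (vert w t i' j') (shift i' j' t) = sec (\<lambda>m n. vert w t (i' + m) (j' + n))"
    using vert_shift[OF assms(2,4)] by presburger
  ultimately have "Sec (vert v s i j) (shift i j s) \<subseteq> Sec v s" "Sec (vert v s i j) (shift i j s) \<subseteq> Sec w t"
    using sec_shift[of "vert v s" i j] sec_shift[of "vert w t" i' j'] e by simp_all
  moreover have "Sec (vert v s i j) (shift i j s) \<in> sectors D" "Sec v s \<in> sectors D" "Sec w t \<in> sectors D"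
    using assms by (simp_all add: sectorI)
  ultimately show "(Sec v s, Sec w t) \<in> sector_equiv D" unfolding sector_equiv_def by blast
qed


subsection \<open>The boundary\<close>

lemma sector_equiv_equiv: "equiv (sectors D) (sector_equiv D)"
proof (rule equivI)
  show "sector_equiv D \<subseteq> sectors D \<times> sectors D" unfolding sector_equiv_def by blast
  show "refl_on (sectors D) (sector_equiv D)"
    by (rule refl_onI) (auto simp: sector_equiv_def)
  show "sym (sector_equiv D)"
    by (rule symI) (auto simp: sector_equiv_def)
  show "Relation.trans (sector_equiv D)"
  proof (rule transI)
    fix X Y Z assume XY: "(X, Y) \<in> sector_equiv D" and YZ: "(Y, Z) \<in> sector_equiv D"
    then have "X \<in> sectors D" "Y \<in> sectors D" "Z \<in> sectors D" by (auto simp: sector_equiv_def)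
    then obtain v s w t u r where v: "v \<in> carrier G" "tiling T s" "X = Sec v s"
      and w: "w \<in> carrier G" "tiling T t" "Y = Sec w t" and u: "u \<in> carrier G" "tiling T r" "Z = Sec u r"
      unfolding sectors_eq by blast
    have "tail_eq v s w t" "tail_eq w t u r"
      using XY YZ sector_equiv_iff[OF v(1) w(1) v(2) w(2)] sector_equiv_iff[OF w(1) u(1) w(2) u(2)]
      by (simp_all add: v w u)
    then show "(X, Z) \<in> sector_equiv D"
      using sector_equiv_iff[OF v(1) u(1) v(2) u(2)] tail_eq_trans[OF v(1) w(1) u(1) v(2) w(2) u(2)]
      by (simp add: v u)
  qed
qed

lemma boundary_sector:
  "\<omega> \<in> boundary D \<Longrightarrow> S \<in> \<omega> \<Longrightarrow> S \<in> sectors D"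
  unfolding boundary_def using in_quotient_imp_subset[OF sector_equiv_equiv] by blast

lemma boundary_equiv_iff:
  assumes "\<omega> \<in> boundary D" "Sec v s \<in> \<omega>" "v \<in> carrier G" "tiling T s" "w \<in> carrier G" "tiling T t"
  shows "Sec w t \<in> \<omega> \<longleftrightarrow> tail_eq v s w t"
proof -
  have "Sec w t \<in> \<omega> \<longleftrightarrow> (Sec v s, Sec w t) \<in> sector_equiv D"
    using assms(1,2) in_quotient_imp_in_rel[OF sector_equiv_equiv]
      in_quotient_imp_closed[OF sector_equiv_equiv] unfolding boundary_def by blast
  then show ?thesis using sector_equiv_iff assms by simp
qed

text \<open>Existence is change of base point, uniqueness is \<open>tail_eq_unique\<close>.\<close>

lemma boundary_rep:
  assumes "\<omega> \<in> boundary D" "v \<in> carrier G"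
  shows "\<exists>!s. tiling T s \<and> Sec v s \<in> \<omega>"
proof -
  have "\<omega> \<noteq> {}" using assms(1) in_quotient_imp_non_empty[OF sector_equiv_equiv] by (auto simp: boundary_def)
  then obtain S where S: "S \<in> \<omega>" by blast
  then obtain w r where w: "w \<in> carrier G" "tiling T r" "S = Sec w r"
    using boundary_sector[OF assms(1)] sectors_eq by blast
  obtain t where t: "tiling T t" "tail_eq w r v t" using rebase[OF w(1) assms(2) w(2)] by blast
  then have "Sec v t \<in> \<omega>" using boundary_equiv_iff[OF assms(1) _ w(1,2) assms(2)] S w(3) by blast
  moreover have "s = t" if "tiling T s" "Sec v s \<in> \<omega>" for s
    using boundary_equiv_iff[OF assms(1) that(2) assms(2) that(1) assms(2) t(1)] \<open>Sec v t \<in> \<omega>\<close>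
      tail_eq_unique[OF assms(2) that(1) t(1)] by blast
  ultimately show ?thesis using t(1) by blast
qed

definition base_tiling :: "'p word set \<Rightarrow> 'p word set set set set \<Rightarrow> 'p tiling" where
  "base_tiling v \<omega> = (THE s. tiling T s \<and> Sec v s \<in> \<omega>)"

lemma base_tiling:
  assumes "\<omega> \<in> boundary D" "v \<in> carrier G"
  shows "tiling T (base_tiling v \<omega>)" "Sec v (base_tiling v \<omega>) \<in> \<omega>"
    "\<And>s. tiling T s \<Longrightarrow> Sec v s \<in> \<omega> \<Longrightarrow> s = base_tiling v \<omega>"
proof -
  show t: "tiling T (base_tiling v \<omega>)" "Sec v (base_tiling v \<omega>) \<in> \<omega>"
    using theI'[OF boundary_rep[OF assms]] unfolding base_tiling_def by blast+
  show "s = base_tiling v \<omega>" if "tiling T s" "Sec v s \<in> \<omega>" for s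
    unfolding base_tiling_def by (rule the1_equality[OF boundary_rep[OF assms], symmetric]) (simp add: that)
qed

lemma sector_from_eq:
  assumes "\<omega> \<in> boundary D" "v \<in> carrier G"
  shows "sector_from D v \<omega> = Sec v (base_tiling v \<omega>)"
  unfolding sector_from_def sectors_at_eq[OF assms(2)]
proof (rule the_equality)
  show "Sec v (base_tiling v \<omega>) \<in> \<omega> \<and> Sec v (base_tiling v \<omega>) \<in> Sec v ` {s. tiling T s}"
    using base_tiling(1,2)[OF assms] by simp
next
  fix S assume "S \<in> \<omega> \<and> S \<in> Sec v ` {s. tiling T s}"
  then obtain s where "tiling T s" "S = Sec v s" "Sec v s \<in> \<omega>" by blast
  then show "S = Sec v (base_tiling v \<omega>)" using base_tiling(3)[OF assms, of s] by simp
qed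

lemma corner_agree: "agree m n s t \<Longrightarrow> corner s m n = corner t m n"
  unfolding corner_def agree_def by (intro arg_cong2[where f = route] map_cong) auto

text \<open>Since a vertex determines its coordinates and its parallelogram, the sets on which the
  measure is equidistributed are cylinders of base tilings.\<close>

lemma boundary_through_eq:
  assumes "v \<in> carrier G" "tiling T s"
  shows "boundary_through D v (vert v s m n) = {\<omega> \<in> boundary D. agree m n s (base_tiling v \<omega>)}"
proof -
  have "{vert v s m n} \<in> sector_from D v \<omega> \<longleftrightarrow> agree m n s (base_tiling v \<omega>)" if w: "\<omega> \<in> boundary D" for \<omega>
  proof -
    have "{vert v s m n} \<in> sector_from D v \<omega> \<longleftrightarrow> (\<exists>k l. vert v s m n = vert v (base_tiling v \<omega>) k l)"
      unfolding sector_from_eq[OF w assms(1)] singleton_sec ..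
    also have "\<dots> \<longleftrightarrow> agree m n s (base_tiling v \<omega>)"
      using vert_unique[OF assms base_tiling(1)[OF w assms(1)]] corner_agree unfolding vert_def by metis
    finally show ?thesis .
  qed
  then show ?thesis unfolding boundary_through_def by blast
qed

text \<open>This makes equidistribution applicable to any two tilings at \<open>v\<close>.\<close>

lemma vertices_at_vert:
  assumes "v \<in> carrier G" "tiling T s"
  shows "vert v s m n \<in> vertices_at P T v m n"
proof -
  obtain \<phi> where \<phi>: "apartment_chart D \<phi>" "\<And>m n. \<phi> (int m, int n) = vert v s m n"
    using tiling_chart[OF assms] by blast
  let ?c = "cone_point (0, 0) (1, 0) (0, 1)"
  have f: "\<phi> (?c m n) = vert v s m n" for m n unfolding std_cone(2) \<phi>(2) ..
  have "oriented_edge P T (\<phi> (?c k 0)) (\<phi> (?c (Suc k) 0))"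
    "oriented_edge P T (\<phi> (?c 0 (Suc k))) (\<phi> (?c 0 k))" for k
    unfolding f oriented_edge_def
    using vert_edges(1)[OF assms, of k 0] vert_edges(3)[OF assms, of 0 k] assms
    by (metis tiling_in(1) vert_carrier, metis tiling_in(2) vert_carrier)
  moreover have "\<phi> (0, 0) = v" using \<phi>(2)[of 0 0] assms(1) by simp
  moreover have "vert v s m n = \<phi> (?c m n)" using f by simp
  ultimately show ?thesis unfolding vertices_at_def using \<phi>(1) std_cone(1) by blast
qed

lemma base_chamber_in:
  assumes \<phi>: "apartment_chart D \<phi>" and S: "S = (`) \<phi> ` (coxeter_complex \<inter> Pow quadrant)"
  shows "base_chamber S (\<phi> (0, 0)) \<in> S"
proof -
  let ?c = "{(0, 0), (1, 0), (0, 1)} :: (int \<times> int) set"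
  have inj: "inj \<phi>" using \<phi> by (simp add: apartment_chart_def)
  have c: "?c \<in> coxeter_complex"
    using std_cone(1) unfolding coxeter_complex_def complex_of_def by blast
  have "(THE c. c \<in> S \<and> card c = 3 \<and> \<phi> (0, 0) \<in> c) = \<phi> ` ?c"
  proof (rule the_equality)
    have "card (\<phi> ` ?c) = card ?c" by (rule card_image[OF inj_on_subset[OF inj]]) simp
    then have "card (\<phi> ` ?c) = 3" by simp
    moreover have "?c \<subseteq> quadrant" by (simp add: quadrant_def)
    ultimately show "\<phi> ` ?c \<in> S \<and> card (\<phi> ` ?c) = 3 \<and> \<phi> (0, 0) \<in> \<phi> ` ?c"
      using c unfolding S by blast
  next
    fix d assume d: "d \<in> S \<and> card d = 3 \<and> \<phi> (0, 0) \<in> d"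
    then obtain \<sigma> where \<sigma>: "\<sigma> \<in> coxeter_complex" "\<sigma> \<subseteq> quadrant" "d = \<phi> ` \<sigma>" unfolding S by blast
    have "card \<sigma> = 3" using d \<sigma>(3) card_image[OF inj_on_subset[OF inj, of \<sigma>]] by simp
    have z: "(0, 0) \<in> \<sigma>" using d \<sigma>(3) inj by (simp add: inj_image_mem_iff)
    obtain c' where c': "c' \<in> coxeter_chambers" "\<sigma> \<subseteq> c'"
      using \<sigma>(1) unfolding coxeter_complex_def complex_of_def by blast
    have "finite c'" "card c' = 3" using c'(1) unfolding coxeter_chambers_def by auto
    then have "\<sigma> \<in> coxeter_chambers" using c' \<open>card \<sigma> = 3\<close> card_subset_eq by metis
    then obtain i j where ij:
      "\<sigma> = {(i, j), (i + 1, j), (i, j + 1)} \<or> \<sigma> = {(i + 1, j), (i, j + 1), (i + 1, j + 1)}"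
      unfolding coxeter_chambers_def by blast
    have "\<sigma> = ?c" using ij
    proof
      assume e: "\<sigma> = {(i, j), (i + 1, j), (i, j + 1)}"
      have "0 \<le> i" "0 \<le> j" "(0, 0) \<in> {(i, j), (i + 1, j), (i, j + 1)}"
        using \<sigma>(2) z unfolding e by (simp_all add: quadrant_def)
      then have "i = 0" "j = 0" by auto
      then show ?thesis using e by simp
    next
      assume e: "\<sigma> = {(i + 1, j), (i, j + 1), (i + 1, j + 1)}"
      have "0 \<le> i" "0 \<le> j" "(0, 0) \<in> {(i + 1, j), (i, j + 1), (i + 1, j + 1)}"
        using \<sigma>(2) z unfolding e by (simp_all add: quadrant_def)
      then show ?thesis by auto
    qed
    then show "d = \<phi> ` ?c" using \<sigma>(3) by simp
  qed
  moreover have "?c \<subseteq> quadrant" by (simp add: quadrant_def)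
  then have "\<phi> ` ?c \<in> S" using c unfolding S by blast
  ultimately show ?thesis by (simp add: base_chamber_def)
qed

text \<open>A sector is the intersection of two half-apartments of an apartment around it. Both
  contain \<open>u\<close> and the base chamber, so the hull stays inside.\<close>

lemma hull_subset:
  assumes w: "\<omega> \<in> boundary D" and v: "v \<in> carrier G" and u: "{u} \<in> sector_from D v \<omega>"
  shows "hull_toward D v u \<omega> \<subseteq> sector_from D v \<omega>"
proof -
  define S where "S = sector_from D v \<omega>"
  note t = base_tiling[OF w v]
  obtain \<phi> where \<phi>: "apartment_chart D \<phi>" "\<And>m n. \<phi> (int m, int n) = vert v (base_tiling v \<omega>) m n"
    using tiling_chart[OF v t(1)] by blast
  have inj: "inj \<phi>" using \<phi> by (simp add: apartment_chart_def)
  have q: "on_quadrant (vert v (base_tiling v \<omega>)) x = \<phi> x" if "x \<in> quadrant" for x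
  proof -
    have "(int (nat (fst x)), int (nat (snd x))) = x"
      using that by (cases x) (simp add: quadrant_def)
    then show ?thesis unfolding on_quadrant_def \<phi>(2)[symmetric] by simp
  qed
  have S: "S = (`) \<phi> ` (coxeter_complex \<inter> Pow quadrant)"
    unfolding S_def sector_from_eq[OF w v] sec_def
  proof (rule image_cong)
    fix \<sigma> assume "\<sigma> \<in> coxeter_complex \<inter> Pow quadrant"
    then show "on_quadrant (vert v (base_tiling v \<omega>)) ` \<sigma> = \<phi> ` \<sigma>" by (intro image_cong q) auto
  qed simp
  have "\<phi> (0, 0) = v" using \<phi>(2)[of 0 0] v by simp
  then have bc: "base_chamber S v \<in> S" using base_chamber_in[OF \<phi>(1) S] by simp
  define H1 H2 where H: "H1 = (`) \<phi> ` (coxeter_complex \<inter> Pow {(i, j). i \<ge> 0})"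
    "H2 = (`) \<phi> ` (coxeter_complex \<inter> Pow {(i, j). j \<ge> 0})"
  have "{(i, j). i \<ge> 0} \<in> coxeter_half_planes" "{(i, j). j \<ge> 0} \<in> coxeter_half_planes"
    unfolding coxeter_half_planes_def by blast+
  then have "H1 \<in> half_apartments D" "H2 \<in> half_apartments D"
    unfolding H half_apartments_def using \<phi>(1) by blast+
  moreover have "quadrant \<subseteq> {(i, j). i \<ge> 0}" "quadrant \<subseteq> {(i, j). j \<ge> 0}"
    by (auto simp: quadrant_def)
  then have "S \<subseteq> H1" "S \<subseteq> H2" unfolding S H by blast+
  ultimately have "convex_hull_complex D {{u}, base_chamber S v} \<subseteq> H1 \<inter> H2"
    using u bc unfolding convex_hull_complex_def S_def[symmetric] by blast
  also have "\<dots> \<subseteq> S"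
  proof
    fix x assume "x \<in> H1 \<inter> H2"
    then obtain \<sigma> \<tau> where \<sigma>: "x = \<phi> ` \<sigma>" "\<sigma> \<in> coxeter_complex" "\<sigma> \<subseteq> {(i, j). i \<ge> 0}"
      and \<tau>: "x = \<phi> ` \<tau>" "\<tau> \<subseteq> {(i, j). j \<ge> 0}" unfolding H by blast
    have "\<sigma> = \<tau>" using \<sigma>(1) \<tau>(1) inj by (simp add: inj_image_eq_iff)
    then have "\<sigma> \<subseteq> quadrant" using \<sigma>(3) \<tau>(2) by (auto simp: quadrant_def)
    then show "x \<in> S" unfolding S using \<sigma>(1,2) by blast
  qed
  finally show ?thesis by (simp add: hull_toward_def S_def)
qed

text \<open>The set is the union of the basic open sets of its own points: each hull lies in the
  sector of its point and contains \<open>u\<close>.\<close>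

lemma openin_boundary_through:
  assumes v: "v \<in> carrier G"
  shows "openin (boundary_topology D) (boundary_through D v u)"
proof -
  let ?U = "\<lambda>\<omega>. {\<omega>' \<in> boundary D. hull_toward D v u \<omega> \<subseteq> sector_from D v \<omega>'}"
  have "boundary_through D v u = (\<Union>\<omega>\<in>boundary_through D v u. ?U \<omega>)"
  proof
    show "boundary_through D v u \<subseteq> (\<Union>\<omega>\<in>boundary_through D v u. ?U \<omega>)"
      using hull_subset[OF _ v] unfolding boundary_through_def by blast
    have "{u} \<in> hull_toward D v u \<omega>" for \<omega>
      unfolding hull_toward_def convex_hull_complex_def by blast
    then show "(\<Union>\<omega>\<in>boundary_through D v u. ?U \<omega>) \<subseteq> boundary_through D v u"
      unfolding boundary_through_def by blast
  qed
  moreover have "openin (boundary_topology D) (?U \<omega>)" if "\<omega> \<in> boundary_through D v u" for \<omega>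
    unfolding boundary_topology_def
    by (rule topology_generated_by_Basis) (use that v vertex_iff in \<open>unfold boundary_through_def, blast\<close>)
  ultimately show ?thesis by (metis (no_types, lifting) openin_Union imageE)
qed

subsection \<open>Fixed points\<close>

lemma tail_eq_left_mult:
  assumes "tail_eq v s w t" "v \<in> carrier G" "w \<in> carrier G" "tiling T s" "tiling T t" "g \<in> carrier G"
  shows "tail_eq (g \<otimes>\<^bsub>G\<^esub> v) s (g \<otimes>\<^bsub>G\<^esub> w) t"
proof -
  from assms(1) obtain i j i' j' where "vert v s i j = vert w t i' j'" "shift i j s = shift i' j' t"
    unfolding tail_eq_def by blast
  moreover from this have "vert (g \<otimes>\<^bsub>G\<^esub> v) s i j = vert (g \<otimes>\<^bsub>G\<^esub> w) t i' j'"
    using assms(2-6) by (simp add: vert_left_mult)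
  ultimately show ?thesis unfolding tail_eq_def by blast
qed

lemma left_mult_Sec:
  assumes "v \<in> carrier G" "tiling T s" "g \<in> carrier G"
  shows "(`) ((`) (\<lambda>h. g \<otimes>\<^bsub>G\<^esub> h)) (Sec v s) = Sec (g \<otimes>\<^bsub>G\<^esub> v) s"
  unfolding sec_image vert_left_mult[OF assms, symmetric] ..

text \<open>Left multiplication keeps all labels and moves only the base point, and a class is
  decided by one of its sectors; so the tiling at \<open>v\<close> is compared with itself placed at
  \<open>g v\<close>.\<close>

lemma fixed_iff:
  assumes w: "\<omega> \<in> boundary D" and v: "v \<in> carrier G" and g: "g \<in> carrier G"
  shows "boundary_action G g \<omega> = \<omega> \<longleftrightarrow> tail_eq (g \<otimes>\<^bsub>G\<^esub> v) (base_tiling v \<omega>) v (base_tiling v \<omega>)"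
proof -
  define s where "s = base_tiling v \<omega>"
  have s: "tiling T s" "Sec v s \<in> \<omega>" using base_tiling(1,2)[OF w v] by (simp_all add: s_def)
  have gv: "g \<otimes>\<^bsub>G\<^esub> v \<in> carrier G" using v g by simp
  let ?a = "(`) ((`) (\<lambda>h. g \<otimes>\<^bsub>G\<^esub> h))"
  have act: "boundary_action G g \<omega> = ?a ` \<omega>" by (simp add: boundary_action_def)
  have rep: "\<exists>u r. u \<in> carrier G \<and> tiling T r \<and> Z = Sec u r \<and> tail_eq v s u r" if "Z \<in> \<omega>" for Z
    using boundary_sector[OF w that] boundary_equiv_iff[OF w s(2) v s(1)] that unfolding sectors_eq by blast
  have "?a ` \<omega> = \<omega> \<longleftrightarrow> tail_eq (g \<otimes>\<^bsub>G\<^esub> v) s v s"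
  proof
    assume "?a ` \<omega> = \<omega>"
    then have "Sec (g \<otimes>\<^bsub>G\<^esub> v) s \<in> \<omega>" using s left_mult_Sec[OF v s(1) g] by blast
    then show "tail_eq (g \<otimes>\<^bsub>G\<^esub> v) s v s"
      using boundary_equiv_iff[OF w s(2) v s(1) gv s(1)] tail_eq_sym by blast
  next
    assume q: "tail_eq (g \<otimes>\<^bsub>G\<^esub> v) s v s"
    show "?a ` \<omega> = \<omega>"
    proof
      show "?a ` \<omega> \<subseteq> \<omega>"
      proof
        fix Y assume "Y \<in> ?a ` \<omega>"
        then obtain Z where Z: "Z \<in> \<omega>" "Y = ?a Z" by blast
        then obtain u r where u: "u \<in> carrier G" "tiling T r" "Z = Sec u r" "tail_eq v s u r"
          using rep by blast
        have gu: "g \<otimes>\<^bsub>G\<^esub> u \<in> carrier G" using u g by simp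
        have "Y = Sec (g \<otimes>\<^bsub>G\<^esub> u) r" using Z u left_mult_Sec g by simp
        moreover have "tail_eq v s (g \<otimes>\<^bsub>G\<^esub> u) r"
          using tail_eq_trans[OF v gv gu s(1,1) u(2) tail_eq_sym[OF q]] tail_eq_left_mult[OF u(4) v u(1) s(1) u(2) g]
          by blast
        ultimately show "Y \<in> \<omega>" using boundary_equiv_iff[OF w s(2) v s(1) gu u(2)] by blast
      qed
      show "\<omega> \<subseteq> ?a ` \<omega>"
      proof
        fix Z assume "Z \<in> \<omega>"
        then obtain u r where u: "u \<in> carrier G" "tiling T r" "Z = Sec u r" "tail_eq v s u r"
          using rep by blast
        let ?u = "inv\<^bsub>G\<^esub> g \<otimes>\<^bsub>G\<^esub> u"
        have gu: "?u \<in> carrier G" "g \<otimes>\<^bsub>G\<^esub> ?u = u" "inv\<^bsub>G\<^esub> g \<otimes>\<^bsub>G\<^esub> (g \<otimes>\<^bsub>G\<^esub> v) = v"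
          using u g v by (simp_all add: G.m_assoc[symmetric])
        have "tail_eq (g \<otimes>\<^bsub>G\<^esub> v) s u r" using tail_eq_trans[OF gv v u(1) s(1,1) u(2) q u(4)] .
        from tail_eq_left_mult[OF this gv u(1) s(1) u(2), of "inv\<^bsub>G\<^esub> g"] have "tail_eq v s ?u r"
          using g gu(3) by simp
        then have "Sec ?u r \<in> \<omega>" using boundary_equiv_iff[OF w s(2) v s(1) gu(1) u(2)] by blast
        moreover have "?a (Sec ?u r) = Z" using left_mult_Sec[OF gu(1) u(2) g] gu(2) u(3) by simp
        ultimately show "Z \<in> ?a ` \<omega>" by blast
      qed
    qed
  qed
  then show ?thesis by (simp add: act s_def)
qed

end

section \<open>Coincidences of shifted random tilings\<close>

context tiling_process
begin

text \<open>A property that depends on a bounded parallelogram defines a finite union of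
  cylinders.\<close>

lemma local_sets:
  assumes "\<And>s t. tiling T s \<Longrightarrow> tiling T t \<Longrightarrow> agree m n s t \<Longrightarrow> Q s \<Longrightarrow> Q t"
  shows "{\<omega> \<in> space M. Q (F \<omega>)} \<in> sets M"
proof -
  let ?S = "{\<omega> \<in> space M. Q (F \<omega>)}"
  let ?C = "(\<lambda>\<omega>. cyl m n (F \<omega>)) ` ?S"
  have "?S = \<Union>?C"
  proof
    show "?S \<subseteq> \<Union>?C" by (auto simp: cyl_def)
    show "\<Union>?C \<subseteq> ?S" using assms F_tiling unfolding cyl_def by blast
  qed
  moreover have "finite ?C" by (rule finite_subset[OF _ finite_cyls]) (use F_tiling in blast)
  moreover have "?C \<subseteq> sets M" using cyl_in_sets F_tiling by blast
  ultimately show ?thesis by (metis (no_types, lifting) sets.finite_Union)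
qed

lemma transposed: "tiling_process P (flip T) q M (\<lambda>\<omega>. transp (F \<omega>))"
proof (intro tiling_process.intro dual prob_space_axioms tiling_process_axioms.intro)
  show "tiling (flip T) (transp (F \<omega>))" if "\<omega> \<in> space M" for \<omega>
    using tiling_transp F_tiling that by blast
  have tr: "tiling T (transp s)" if "tiling (flip T) s" for s
    using triangle_system.tiling_transp[OF dual that] by simp
  have ag: "{\<omega> \<in> space M. agree m n s (transp (F \<omega>))} = {\<omega> \<in> space M. agree n m (transp s) (F \<omega>)}"
    for m n s using agree_transp[of m n "transp s"] by simp
  show "{\<omega> \<in> space M. agree m n s (transp (F \<omega>))} \<in> sets M" if "tiling (flip T) s" for s m n
    unfolding ag using cyl_sets[OF tr[OF that]] .
  show "prob {\<omega> \<in> space M. agree m n s (transp (F \<omega>))} = prob {\<omega> \<in> space M. agree m n t (transp (F \<omega>))}"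
    if "tiling (flip T) s" "tiling (flip T) t" for s t m n
    unfolding ag using cyl_eq[OF that[THEN tr]] .
qed

lemma shift_eq_null:
  assumes E: "E \<in> sets M" "\<And>\<omega>. \<omega> \<in> E \<Longrightarrow> shift i j (F \<omega>) = shift i' j' (F \<omega>)"
    and ne: "(i, j) \<noteq> (i', j')"
  shows "E \<in> null_sets M"
proof -
  have al: "al (F \<omega>) (i + m) j = al (F \<omega>) (i' + m) j'" if "\<omega> \<in> E" for \<omega> m
    using shift_eq_sel(1)[OF E(2)[OF that], of m 0] by simp
  have be: "be (F \<omega>) i (j + n) = be (F \<omega>) i' (j' + n)" if "\<omega> \<in> E" for \<omega> n
    using shift_eq_sel(2)[OF E(2)[OF that], of 0 n] by simp
  interpret t: tiling_process P "flip T" q M "\<lambda>\<omega>. transp (F \<omega>)" by (rule transposed)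
  consider "i < i'" | "i' < i" | "j < j'" | "j' < j" using ne by fastforce
  then show ?thesis
  proof cases
    case 1
    then show ?thesis using periodic_null[OF E(1) al] by blast
  next
    case 2
    then show ?thesis using periodic_null[OF E(1) al[symmetric]] by blast
  next
    case 3
    then show ?thesis using t.periodic_null[OF E(1), of j i j' i'] be by simp
  next
    case 4
    then show ?thesis using t.periodic_null[OF E(1), of j' i' j i] be by simp
  qed
qed

end

section \<open>The boundary measure as a random tiling\<close>

lemma (in triangle_system) boundary_process:
  assumes M: "is_boundary_measure P T v M" and v: "v \<in> carrier G"
  shows "tiling_process P T q M (base_tiling v)"
proof -
  interpret prob_space M using M by (simp add: is_boundary_measure_def)
  have sp: "space M = boundary D" and
    st: "sets M = sigma_sets (boundary D) {U. openin (boundary_topology D) U}" and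
    eq: "\<And>m n u u'. u \<in> vertices_at P T v m n \<Longrightarrow> u' \<in> vertices_at P T v m n \<Longrightarrow>
      emeasure M (boundary_through D v u) = emeasure M (boundary_through D v u')"
    using M unfolding is_boundary_measure_def by blast+
  show ?thesis
  proof unfold_locales
    show "tiling T (base_tiling v \<omega>)" if "\<omega> \<in> space M" for \<omega> using base_tiling(1)[OF _ v] that sp by blast
    show "{\<omega> \<in> space M. agree m n s (base_tiling v \<omega>)} \<in> sets M" if "tiling T s" for s m n
      unfolding sp st boundary_through_eq[OF v that, symmetric]
      using openin_boundary_through[OF v] by (intro sigma_sets.Basic) simp
    show "prob {\<omega> \<in> space M. agree m n s (base_tiling v \<omega>)} = prob {\<omega> \<in> space M. agree m n t (base_tiling v \<omega>)}"
      if "tiling T s" "tiling T t" for s t m n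
      unfolding sp boundary_through_eq[OF v that(1), symmetric] boundary_through_eq[OF v that(2), symmetric]
        measure_def using eq[OF vertices_at_vert[OF v that(1)] vertices_at_vert[OF v that(2)]] by simp
  qed
qed

lemma (in triangle_system) fixed_points_null:
  assumes M: "is_boundary_measure P T v M" and v: "v \<in> carrier G" and g: "g \<in> carrier G"
    and g1: "g \<noteq> \<one>\<^bsub>G\<^esub>"
  shows "{\<omega> \<in> boundary D. boundary_action G g \<omega> = \<omega>} \<in> null_sets M"
proof -
  interpret tiling_process P T q M "base_tiling v" by (rule boundary_process[OF M v])
  have sp: "space M = boundary D" using M by (simp add: is_boundary_measure_def)
  \<comment> \<open>The four indices are the positions at which the common tail begins in the
    translated and in the original tiling; there are countably many choices.\<close>
  define E where "E = (\<lambda>(i, j, i', j'). {\<omega> \<in> space M.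
    g \<otimes>\<^bsub>G\<^esub> vert v (base_tiling v \<omega>) i j = vert v (base_tiling v \<omega>) i' j' \<and>
    shift i j (base_tiling v \<omega>) = shift i' j' (base_tiling v \<omega>)})"
  have E_iff: "\<omega> \<in> E (i, j, i', j') \<longleftrightarrow> \<omega> \<in> space M \<and>
      g \<otimes>\<^bsub>G\<^esub> vert v (base_tiling v \<omega>) i j = vert v (base_tiling v \<omega>) i' j' \<and>
      shift i j (base_tiling v \<omega>) = shift i' j' (base_tiling v \<omega>)" for \<omega> i j i' j'
    by (simp only: E_def prod.case mem_Collect_eq)
  have "{\<omega> \<in> boundary D. boundary_action G g \<omega> = \<omega>} = (\<Union>x. E x)"
  proof -
    have fx: "boundary_action G g \<omega> = \<omega> \<longleftrightarrow> (\<exists>x. \<omega> \<in> E x)" if w: "\<omega> \<in> boundary D" for \<omega>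
      unfolding fixed_iff[OF w v g] tail_eq_def vert_left_mult[OF v base_tiling(1)[OF w v] g] split_paired_Ex E_iff
      by (simp only: sp w simp_thms)
    have sub: "E x \<subseteq> boundary D" for x
    proof -
      obtain i j i' j' where "x = (i, j, i', j')" by (cases x)
      then show ?thesis using E_iff sp by blast
    qed
    show ?thesis
    proof (intro equalityI subsetI)
      fix \<omega> assume "\<omega> \<in> {\<omega> \<in> boundary D. boundary_action G g \<omega> = \<omega>}"
      then show "\<omega> \<in> (\<Union>x. E x)" using fx[of \<omega>] by simp
    next
      fix \<omega> assume "\<omega> \<in> (\<Union>x. E x)"
      then obtain x where x: "\<omega> \<in> E x" by blast
      then have "\<omega> \<in> boundary D" using sub[of x] by blast
      then show "\<omega> \<in> {\<omega> \<in> boundary D. boundary_action G g \<omega> = \<omega>}"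
        using fx[of \<omega>] x by (intro CollectI conjI) blast+
    qed
  qed
  moreover have "E x \<in> null_sets M" for x
  proof -
    obtain i j i' j' where x: "x = (i, j, i', j')" by (cases x)
    have "{\<omega> \<in> space M. g \<otimes>\<^bsub>G\<^esub> vert v (base_tiling v \<omega>) i j = vert v (base_tiling v \<omega>) i' j'} \<in> sets M"
    proof (rule local_sets[where m = "max i i'" and n = "max j j'"])
      fix s t assume a: "agree (max i i') (max j j') s t"
        "g \<otimes>\<^bsub>G\<^esub> vert v s i j = vert v s i' j'"
      have "corner s i j = corner t i j" "corner s i' j' = corner t i' j'"
        by (rule corner_agree[OF agree_mono[OF a(1)]]; simp)+
      then show "g \<otimes>\<^bsub>G\<^esub> vert v t i j = vert v t i' j'" using a(2) by (simp add: vert_def)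
    qed
    moreover have "{\<omega> \<in> space M. shift i j (base_tiling v \<omega>) = shift i' j' (base_tiling v \<omega>)} \<in> sets M"
    proof -
      let ?Q = "\<lambda>m n s. al s (i + m) (j + n) = al s (i' + m) (j' + n) \<and>
        be s (i + m) (j + n) = be s (i' + m) (j' + n) \<and> ga s (i + m) (j + n) = ga s (i' + m) (j' + n)"
      have "{\<omega> \<in> space M. shift i j (base_tiling v \<omega>) = shift i' j' (base_tiling v \<omega>)} =
          (\<Inter>m. \<Inter>n. {\<omega> \<in> space M. ?Q m n (base_tiling v \<omega>)})"
      proof -
        have "shift i j s = shift i' j' s \<longleftrightarrow> (\<forall>m n. ?Q m n s)" for s
          using shift_eq_sel[of i j s i' j' s] tiling_eqI[of "shift i j s" "shift i' j' s"] by auto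
        then show ?thesis by auto
      qed
      moreover have "{\<omega> \<in> space M. ?Q m n (base_tiling v \<omega>)} \<in> sets M" for m n
        by (rule local_sets[where m = "Suc (max i i' + m)" and n = "Suc (max j j' + n)"])
          (simp add: agree_def max_def split: if_splits)
      ultimately show ?thesis by (auto intro!: sets.countable_INT)
    qed
    moreover have "E x = {\<omega> \<in> space M. g \<otimes>\<^bsub>G\<^esub> vert v (base_tiling v \<omega>) i j = vert v (base_tiling v \<omega>) i' j'} \<inter>
        {\<omega> \<in> space M. shift i j (base_tiling v \<omega>) = shift i' j' (base_tiling v \<omega>)}"
      using E_iff unfolding x by blast
    ultimately have "E x \<in> sets M" by (simp only: sets.Int)
    show ?thesis
    proof (cases "(i, j) = (i', j')")
      \<comment> \<open>Without displacement \<open>g\<close> would fix a vertex, but left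
        multiplication is free.\<close>
      case True
      have "E x = {}"
      proof (rule ccontr)
        assume "E x \<noteq> {}"
        then obtain \<omega> where w: "\<omega> \<in> boundary D" "g \<otimes>\<^bsub>G\<^esub> vert v (base_tiling v \<omega>) i j = vert v (base_tiling v \<omega>) i j"
          using True sp E_iff unfolding x prod.inject by blast
        then show False using g g1 v base_tiling(1)[OF w(1) v] by simp
      qed
      then show ?thesis by simp
    next
      case False
      show ?thesis
        by (rule shift_eq_null[OF \<open>E x \<in> sets M\<close> _ False]) (use E_iff x in blast)
    qed
  qed
  ultimately show ?thesis by (simp add: null_sets_UN)
qed

subsection \<open>Triangle presentations\<close>

lemma triangle_system_of_presentation:
  assumes plane: "finite_projective_plane P L inc q" and q: "q \<ge> 2" and lam: "bij_betw lam P L"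
    and pres: "triangle_presentation P inc lam T"
  shows "triangle_system P T q"
proof -
  have T_in: "x \<in> P \<and> y \<in> P \<and> z \<in> P" if "(x, y, z) \<in> T" for x y z
    using pres that unfolding triangle_presentation_def by blast
  have adj: "adj T x y \<longleftrightarrow> x \<in> P \<and> y \<in> P \<and> inc y (lam x)" for x y
    using pres T_in unfolding triangle_presentation_def adj_def by meson
  have fin: "finite P" and card_line: "\<And>l. l \<in> L \<Longrightarrow> card {x \<in> P. inc x l} = q + 1"
    and join: "\<And>x y. x \<in> P \<Longrightarrow> y \<in> P \<Longrightarrow> x \<noteq> y \<Longrightarrow> \<exists>!l. l \<in> L \<and> inc x l \<and> inc y l"
    and meet: "\<And>l m. l \<in> L \<Longrightarrow> m \<in> L \<Longrightarrow> l \<noteq> m \<Longrightarrow> \<exists>!x. x \<in> P \<and> inc x l \<and> inc x m"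
    using plane unfolding finite_projective_plane_def projective_plane_def by auto
  have "\<exists>Q\<subseteq>P. card Q = 4 \<and> (\<forall>l\<in>L. card {x \<in> Q. inc x l} \<le> 2)"
    using plane unfolding finite_projective_plane_def projective_plane_def by (elim conjE)
  then obtain Q where Q: "Q \<subseteq> P" "card Q = 4" "\<And>l. l \<in> L \<Longrightarrow> card {x \<in> Q. inc x l} \<le> 2"
    by (elim exE conjE) simp
  have lamL: "lam x \<in> L" if "x \<in> P" for x using lam that by (auto simp: bij_betw_def)
  have lam_surj: "\<exists>x\<in>P. lam x = l" if "l \<in> L" for l using lam that by (auto simp: bij_betw_def)
  have lam_inj: "x = y" if "x \<in> P" "y \<in> P" "lam x = lam y" for x y
    using lam that by (auto simp: bij_betw_def inj_on_def)
  have finQ: "finite Q" using Q(1) fin finite_subset by blast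
  have right: "card {y. adj T x y} = q + 1" if "x \<in> P" for x
    using card_line[OF lamL[OF that]] that by (simp add: adj)
  have ex_right: "\<exists>y. adj T x y \<and> adj T x' y" if x: "x \<in> P" "x' \<in> P" for x x'
  proof (cases "x = x'")
    case True
    have "{y. adj T x y} \<noteq> {}" using right[OF x(1)] by (metis Suc_eq_plus1 card.empty nat.distinct(1))
    then show ?thesis using True by blast
  next
    case False
    then have "lam x \<noteq> lam x'" using lam_inj x by blast
    then show ?thesis using meet[OF lamL[OF x(1)] lamL[OF x(2)]] adj x by blast
  qed
  have ex_left': "\<exists>x. adj T x y \<and> adj T x y'" if y: "y \<in> P" "y' \<in> P" "y \<noteq> y'" for y y'
    using join[OF y] lam_surj adj y by metis
  have uniq: "x = x' \<or> y = y'" if "adj T x y" "adj T x' y" "adj T x y'" "adj T x' y'" for x x' y y'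
    using that join[of y y'] lam_inj lamL unfolding adj by metis
  have other: "\<exists>z\<in>P. z \<noteq> y" for y
  proof (rule ccontr)
    assume "\<not> ?thesis"
    then have "Q \<subseteq> {y}" using Q(1) by blast
    then have "card Q \<le> 1" using card_mono[of "{y}" Q] by simp
    then show False using Q(2) by simp
  qed
  have ex_left: "\<exists>x. adj T x y \<and> adj T x y'" if y: "y \<in> P" "y' \<in> P" for y y'
    using ex_left'[OF y] ex_left'[of y] other[of y] y by metis
  have nonadj_right: "\<exists>y\<in>P. \<not> adj T x y" if "x \<in> P" for x
  proof (rule ccontr)
    assume "\<not> ?thesis"
    then have "{y \<in> Q. inc y (lam x)} = Q" using Q(1) adj by blast
    then show False using Q(2) Q(3)[OF lamL[OF that]] by simp
  qed
  \<comment> \<open>If every line passed through \<open>y\<close>, a line through \<open>y\<close>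
    and another point \<open>a\<close> of the quadrangle \<open>Q\<close> would contain all of
    \<open>Q\<close>, because the line joining \<open>a\<close> to any further point would be the
    same one.\<close>
  have nonadj_left: "\<exists>x\<in>P. \<not> adj T x y" if y: "y \<in> P" for y
  proof (rule ccontr)
    assume n: "\<not> ?thesis"
    obtain a where a: "a \<in> Q" "a \<noteq> y"
    proof -
      have "\<not> Q \<subseteq> {y}" using Q(2) card_mono[of "{y}" Q] by auto
      then show ?thesis using that by blast
    qed
    obtain x where x: "adj T x y" "adj T x a" using ex_left'[OF y _ a(2)[symmetric]] a(1) Q(1) by blast
    have "{z \<in> Q. inc z (lam x)} = Q"
    proof -
      have "inc z (lam x)" if z: "z \<in> Q" for z
      proof (cases "z = a")
        case True
        then show ?thesis using x adj by blast
      next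
        case False
        then obtain x' where x': "adj T x' a" "adj T x' z" using ex_left'[of a z] a(1) z Q(1) by blast
        then have "adj T x' y" using n adj by blast
        then have "x' = x" using uniq[OF x'(1) x(2) \<open>adj T x' y\<close> x(1)] a(2) by blast
        then show ?thesis using x'(2) adj by blast
      qed
      then show ?thesis by blast
    qed
    then show False using Q(2) Q(3)[OF lamL] x adj by (metis numeral_le_iff semiring_norm(69,71))
  qed
  \<comment> \<open>Projection from \<open>y\<close> onto a line that misses it: a line through
    \<open>y\<close> is sent to its intersection with the line of \<open>x0\<close>.\<close>
  have left: "card {x. adj T x y} = q + 1" if y: "y \<in> P" for y
  proof -
    obtain x0 where x0: "x0 \<in> P" "\<not> adj T x0 y" using nonadj_left[OF y] by blast
    define f where "f x = (SOME z. adj T x z \<and> adj T x0 z)" for x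
    have f: "adj T x (f x) \<and> adj T x0 (f x)" if "adj T x y" for x
    proof -
      have "\<exists>z. adj T x z \<and> adj T x0 z" using ex_right[OF _ x0(1)] that adj by blast
      then show ?thesis unfolding f_def by (rule someI_ex)
    qed
    have "bij_betw f {x. adj T x y} {z. adj T x0 z}"
      unfolding bij_betw_def
    proof
      show "inj_on f {x. adj T x y}"
      proof (rule inj_onI)
        fix x x' assume x: "x \<in> {x. adj T x y}" "x' \<in> {x. adj T x y}" "f x = f x'"
        then show "x = x'" using uniq[of x y x' "f x"] f[of x] f[of x'] x0(2) by auto
      qed
      show "f ` {x. adj T x y} = {z. adj T x0 z}"
      proof
        show "f ` {x. adj T x y} \<subseteq> {z. adj T x0 z}" using f by blast
        show "{z. adj T x0 z} \<subseteq> f ` {x. adj T x y}"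
        proof
          fix z assume z: "z \<in> {z. adj T x0 z}"
          then obtain x where x: "adj T x y" "adj T x z" using ex_left[OF y] adj by blast
          then have "f x = z" using uniq[of x z x0 "f x"] f[OF x(1)] z x0(2) by auto
          then show "z \<in> f ` {x. adj T x y}" using x(1) by blast
        qed
      qed
    qed
    then show ?thesis using bij_betw_same_card right[OF x0(1)] by metis
  qed
  show ?thesis
  proof
    show "(y, z, x) \<in> T" if "(x, y, z) \<in> T" for x y z
      using pres that unfolding triangle_presentation_def by blast
    show "z = z'" if "(x, y, z) \<in> T" "(x, y, z') \<in> T" for x y z z'
      using pres T_in[OF that(1)] that unfolding triangle_presentation_def by blast
    show "P \<noteq> {}" using other by blast
  qed (fact T_in fin q ex_right ex_left uniq right left nonadj_right nonadj_left)+
qed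

theorem proposition3p9:
  fixes P :: "'p set" and L :: "'l set" and inc :: "'p \<Rightarrow> 'l \<Rightarrow> bool" and q :: nat
    and lam :: "'p \<Rightarrow> 'l" and T :: "('p \<times> 'p \<times> 'p) set"
    and \<nu> :: "'p word set \<Rightarrow> 'p word set set set set measure"
  assumes "finite_projective_plane P L inc q"
    and "q \<ge> 2"
    and "bij_betw lam P L"
    and "triangle_presentation P inc lam T"
    and "\<And>v. v \<in> carrier (triangle_group P T) \<Longrightarrow> is_boundary_measure P T v (\<nu> v)"
  shows "\<forall>v \<in> carrier (triangle_group P T).
    \<forall>g \<in> carrier (triangle_group P T) - {\<one>\<^bsub>triangle_group P T\<^esub>}.
      {\<omega> \<in> boundary (building P T). boundary_action (triangle_group P T) g \<omega> = \<omega>}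
        \<in> null_sets (\<nu> v)"
proof (intro ballI)
  fix v g
  assume v: "v \<in> carrier (triangle_group P T)"
    and g: "g \<in> carrier (triangle_group P T) - {\<one>\<^bsub>triangle_group P T\<^esub>}"
  interpret triangle_system P T q by (rule triangle_system_of_presentation[OF assms(1-4)])
  show "{\<omega> \<in> boundary (building P T). boundary_action (triangle_group P T) g \<omega> = \<omega>}
      \<in> null_sets (\<nu> v)"
    using fixed_points_null[OF assms(5)[OF v] v] g by blast
qed

end
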